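(* Let $\Omega,\widetilde{\Omega}\subset\mathbb{R}^n$ be bounded domains, $1<q<\infty$, $1\le s\le q$, and let $\varphi:\Omega\to\widetilde{\Omega}$ be a homeomorphism of finite distortion with $\varphi\in L^1_q(\Omega)$ which possesses the Luzin $N$-property and satisfies $K^I_{q,s}(\Omega)<\infty$. Then for every function $f\in L^1_\infty(\widetilde{\Omega})$, $$K^{I}_{q,s}(\Omega)^{-1}\,\|f\mid L^1_s(\widetilde{\Omega})\|\le\|f\circ\varphi\mid L^1_q(\Omega)\|\le\|\varphi\mid L^1_q(\Omega)\|\cdot\|f\mid L^1_\infty(\widetilde{\Omega})\|.$$
   Context: For an open set $U\subset\mathbb{R}^n$ and $1\le p\le\infty$, $L^1_p(U)$ denotes the homogeneous Sobolev space of locally integrable, weakly differentiable functions $f:U\to\mathbb{R}$ with finite seminorm $\|f\mid L^1_p(U)\|=\|\nabla f\mid L_p(U)\|$; a mapping belongs to $L^1_p$ if each coordinate function does, and $\|\varphi\mid L^1_q(\Omega)\|=\|\,|D\varphi|\,\mid L_q(\Omega)\|$. Functions in $L^1_p$ are taken in their quasicontinuous representative. For a weakly differentiable $\varphi$, $D\varphi(x)$ is the Jacobi matrix, $J(x,\varphi)=\det D\varphi(x)$, $|D\varphi(x)|$ its operator norm and $l(D\varphi(x))=\min\{|D\varphi(x)h|:|h|=1\}$. $\varphi$ has finite distortion if $D\varphi(x)=0$ for a.e. $x$ with $J(x,\varphi)=0$. $\varphi$ has the Luzin $N$-property if it maps Lebesgue null sets to null sets. The normalized inner $s$-distortion is $K^I_s(x,\varphi)=|J(x,\varphi)|^{1/s}/l(D\varphi(x))$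 if $J(x,\varphi)\neq0$ and $0$ otherwise; $K^I_{q,s}(\Omega)=\|K^I_s(\cdot,\varphi)\mid L_\kappa(\Omega)\|$ with $1/\kappa=1/s-1/q$ ($\kappa=\infty$ if $s=q$). *)

theory Defs
  imports "HOL-Analysis.Analysis"
begin

definition partial :: "'n::finite \<Rightarrow> (real^'n \<Rightarrow> real) \<Rightarrow> real^'n \<Rightarrow> real" where
  "partial i f x = frechet_derivative f (at x) (axis i 1)"

coinductive smooth_fun :: "(real^'n::finite \<Rightarrow> real) \<Rightarrow> bool" where
  "(\<forall>x. f differentiable (at x)) \<Longrightarrow> (\<forall>i. smooth_fun (partial i f)) \<Longrightarrow> smooth_fun f"

definition test_fun :: "(real^'n::finite) set \<Rightarrow> (real^'n \<Rightarrow> real) \<Rightarrow> bool" where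
  "test_fun U \<psi> \<longleftrightarrow> smooth_fun \<psi> \<and> compact (closure {x. \<psi> x \<noteq> 0})
      \<and> closure {x. \<psi> x \<noteq> 0} \<subseteq> U"

definition loc_integrable :: "(real^'n::finite) set \<Rightarrow> (real^'n \<Rightarrow> real) \<Rightarrow> bool" where
  "loc_integrable U f \<longleftrightarrow> (\<forall>K. compact K \<and> K \<subseteq> U \<longrightarrow> set_integrable lebesgue K f)"

definition is_weak_grad :: "(real^'n::finite) set \<Rightarrow> (real^'n \<Rightarrow> real) \<Rightarrow> (real^'n \<Rightarrow> real^'n) \<Rightarrow> bool" where
  "is_weak_grad U f g \<longleftrightarrow> loc_integrable U f \<and> (\<forall>i. loc_integrable U (\<lambda>x. g x $ i)) \<and>
     (\<forall>\<psi> i. test_fun U \<psi> \<longrightarrow>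
        (LINT x:U|lebesgue. f x * partial i \<psi> x) = - (LINT x:U|lebesgue. g x $ i * \<psi> x))"

definition weakly_diff :: "(real^'n::finite) set \<Rightarrow> (real^'n \<Rightarrow> real) \<Rightarrow> bool" where
  "weakly_diff U f \<longleftrightarrow> (\<exists>g. is_weak_grad U f g)"

definition wgrad :: "(real^'n::finite) set \<Rightarrow> (real^'n \<Rightarrow> real) \<Rightarrow> real^'n \<Rightarrow> real^'n" where
  "wgrad U f = (SOME g. is_weak_grad U f g)"

definition wjac :: "(real^'n::finite) set \<Rightarrow> (real^'n \<Rightarrow> real^'n) \<Rightarrow> real^'n \<Rightarrow> real^'n^'n" where
  "wjac U \<phi> x = (\<chi> i. wgrad U (\<lambda>y. \<phi> y $ i) x)"

definition Lp_norm :: "(real^'n::finite) set \<Rightarrow> real \<Rightarrow> (real^'n \<Rightarrow> real) \<Rightarrow> ennreal" where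
  "Lp_norm U p h = (let I = (\<integral>\<^sup>+ x. indicator U x * ennreal (\<bar>h x\<bar> powr p) \<partial>lebesgue)
       in if I = \<infinity> then \<infinity> else ennreal (enn2real I powr (1 / p)))"

definition Linf_norm :: "(real^'n::finite) set \<Rightarrow> (real^'n \<Rightarrow> real) \<Rightarrow> ennreal" where
  "Linf_norm U h = Inf {c. AE x in lebesgue. x \<in> U \<longrightarrow> ennreal \<bar>h x\<bar> \<le> c}"

definition sob_norm :: "(real^'n::finite) set \<Rightarrow> real \<Rightarrow> (real^'n \<Rightarrow> real) \<Rightarrow> ennreal" where
  "sob_norm U p f = Lp_norm U p (\<lambda>x. norm (wgrad U f x))"

definition sob_inf_norm :: "(real^'n::finite) set \<Rightarrow> (real^'n \<Rightarrow> real) \<Rightarrow> ennreal" where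
  "sob_inf_norm U f = Linf_norm U (\<lambda>x. norm (wgrad U f x))"

definition in_L1p :: "(real^'n::finite) set \<Rightarrow> real \<Rightarrow> (real^'n \<Rightarrow> real) \<Rightarrow> bool" where
  "in_L1p U p f \<longleftrightarrow> weakly_diff U f \<and> sob_norm U p f < \<infinity>"

definition in_L1inf :: "(real^'n::finite) set \<Rightarrow> (real^'n \<Rightarrow> real) \<Rightarrow> bool" where
  "in_L1inf U f \<longleftrightarrow> weakly_diff U f \<and> sob_inf_norm U f < \<infinity>"

definition map_in_L1p :: "(real^'n::finite) set \<Rightarrow> real \<Rightarrow> (real^'n \<Rightarrow> real^'n) \<Rightarrow> bool" where
  "map_in_L1p U p \<phi> \<longleftrightarrow> (\<forall>i. in_L1p U p (\<lambda>x. \<phi> x $ i))"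

definition map_sob_norm :: "(real^'n::finite) set \<Rightarrow> real \<Rightarrow> (real^'n \<Rightarrow> real^'n) \<Rightarrow> ennreal" where
  "map_sob_norm U p \<phi> = Lp_norm U p (\<lambda>x. onorm (\<lambda>h. wjac U \<phi> x *v h))"

definition jac :: "(real^'n::finite) set \<Rightarrow> (real^'n \<Rightarrow> real^'n) \<Rightarrow> real^'n \<Rightarrow> real" where
  "jac U \<phi> x = det (wjac U \<phi> x)"

definition lmin :: "real^'n^'n::finite \<Rightarrow> real" where
  "lmin A = Inf {norm (A *v h) | h. norm h = 1}"

definition finite_distortion :: "(real^'n::finite) set \<Rightarrow> (real^'n \<Rightarrow> real^'n) \<Rightarrow> bool" where
  "finite_distortion U \<phi> \<longleftrightarrow>
     (\<forall>i. weakly_diff U (\<lambda>x. \<phi> x $ i)) \<and>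
     (AE x in lebesgue. x \<in> U \<and> jac U \<phi> x = 0 \<longrightarrow> wjac U \<phi> x = 0)"

definition luzin_N :: "(real^'n::finite) set \<Rightarrow> (real^'n \<Rightarrow> real^'n) \<Rightarrow> bool" where
  "luzin_N U \<phi> \<longleftrightarrow> (\<forall>E. E \<subseteq> U \<and> E \<in> null_sets lebesgue \<longrightarrow> \<phi> ` E \<in> null_sets lebesgue)"

definition KI :: "(real^'n::finite) set \<Rightarrow> real \<Rightarrow> (real^'n \<Rightarrow> real^'n) \<Rightarrow> real^'n \<Rightarrow> real" where
  "KI U s \<phi> x = (if jac U \<phi> x \<noteq> 0 then \<bar>jac U \<phi> x\<bar> powr (1 / s) / lmin (wjac U \<phi> x) else 0)"

definition KIqs :: "(real^'n::finite) set \<Rightarrow> real \<Rightarrow> real \<Rightarrow> (real^'n \<Rightarrow> real^'n) \<Rightarrow> ennreal" where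
  "KIqs U q s \<phi> = (if s = q then Linf_norm U (KI U s \<phi>)
                    else Lp_norm U (1 / (1 / s - 1 / q)) (KI U s \<phi>))"

end

theory Submission
  imports Defs
begin

text \<open>A map \<open>\<phi>\<close> of class \<open>W\<^sup>1\<^sub>1\<close> is approximated by mollifications \<open>v\<^sub>k\<close> whose gradients converge
  rapidly in \<open>L\<^sub>1\<close>. Off a set of small measure the maximal functions of the increments
  \<open>\<nabla>(v\<^sub>k\<^sub>+\<^sub>1 - v\<^sub>k)\<close> are at most \<open>2\<^sup>-\<^sup>k\<close>, so \<open>\<phi> - v\<^sub>k\<close> has Lipschitz constant of that order there, and
  \<open>\<phi>\<close> is differentiable relative to this set with the weak Jacobi matrix as derivative. Hence, up
  to a null set, the domain is a countable union of sets on which the classical change of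
  variables applies. It shows that the preimage of a null set is null up to points with
  \<open>J = 0\<close>, where finite distortion gives \<open>D\<phi> = 0\<close>; mollifying \<open>f\<close> then yields
  \<open>\<nabla>(f \<circ> \<phi>) = D\<phi>\<^sup>T (\<nabla>f \<circ> \<phi>)\<close> almost everywhere, and with it the upper bound. With Luzin's
  property, \<open>\<integral>|\<nabla>f|\<^sup>s \<le> \<integral>|\<nabla>f \<circ> \<phi>|\<^sup>s |J|\<close>, and since \<open>l(D\<phi>) |\<nabla>f \<circ> \<phi>| \<le> |\<nabla>(f \<circ> \<phi>)|\<close> the lower bound
  follows from Hoelder's inequality.\<close>

section \<open>Smooth bump functions\<close>

text \<open>For small \<open>q\<close> a Sobolev homeomorphism need not be differentiable almost
  everywhere, so a change of variables cannot be applied to \<open>\<phi>\<close> as a whole;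
  derivatives relative to measurable pieces take the place of derivatives in open sets. The second
  obstacle is that the preimage of a null set may have positive measure:
  \<open>g \<circ> \<phi>\<close> then depends on the representative of the gradient
  \<open>g\<close> of \<open>f\<close>. Only the product of the transposed Jacobi matrix with
  \<open>g \<circ> \<phi>\<close> is unambiguous, because that matrix vanishes on the doubtful set.
  Two features of the definitions cost work. \<open>wgrad\<close> is a choice among weak gradients,
  so every explicit formula for a gradient has to be matched with it by almost everywhere
  uniqueness, and nothing is known about it outside the open set; measurability is therefore always
  stated after multiplication by an indicator. Moreover weak derivatives are only locally
  integrable, so functions are cut off to a compact neighbourhood before they are convolved, with
  radii small enough that the cut-off is not seen at the points of interest.\<close>

definition flat_exp :: "nat \<Rightarrow> real \<Rightarrow> real" where
  "flat_exp m t = (if t \<le> 0 then 0 else exp (- 1 / t) / t ^ m)"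

lemma flat_exp_nonneg: "0 \<le> flat_exp m t"
  by (simp add: flat_exp_def)

lemma flat_exp_pos_iff: "0 < flat_exp m t \<longleftrightarrow> 0 < t"
  by (simp add: flat_exp_def)

lemma flat_exp_eq_0: "t \<le> 0 \<Longrightarrow> flat_exp m t = 0"
  by (simp add: flat_exp_def)

lemma flat_exp_tendsto_0: "(flat_exp m \<longlongrightarrow> 0) (at 0)"
proof -
  have "((\<lambda>x::real. x ^ m / exp x) \<longlongrightarrow> 0) at_top"
    by (rule tendsto_power_div_exp_0)
  then have "((\<lambda>t::real. inverse t ^ m / exp (inverse t)) \<longlongrightarrow> 0) (at_right 0)"
    by (rule filterlim_compose [OF _ filterlim_inverse_at_top_right])
  then have "(flat_exp m \<longlongrightarrow> 0) (at_right 0)"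
  proof (rule Lim_transform_eventually)
    show "\<forall>\<^sub>F t in at_right 0. inverse t ^ m / exp (inverse t) = flat_exp m t"
      unfolding eventually_at_right_field
      by (rule exI [of _ 1]) (auto simp: flat_exp_def field_simps exp_minus)
  qed
  moreover have "(flat_exp m \<longlongrightarrow> 0) (at_left 0)"
  proof (rule Lim_transform_eventually [OF tendsto_const])
    show "\<forall>\<^sub>F t in at_left 0. 0 = flat_exp m t"
      unfolding eventually_at_left_field
      by (rule exI [of _ "-1"]) (auto simp: flat_exp_def)
  qed
  ultimately show ?thesis
    by (simp add: filterlim_at_split)
qed

text \<open>Differentiating exp(-1/t) only produces further powers of 1/t. With the power as an
  index the family is closed under differentiation up to linear combinations, so this single formula
  covers all derivatives.\<close>

lemma flat_exp_has_derivative: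
  "(flat_exp m has_real_derivative (flat_exp (m + 2) t - m * flat_exp (m + 1) t)) (at t)"
proof -
  consider "t < 0" | "t = 0" | "0 < t" by linarith
  then show ?thesis
  proof cases
    case 1
    have "((\<lambda>_. 0) has_real_derivative 0) (at t)" by simp
    then have "(flat_exp m has_real_derivative 0) (at t)"
      by (rule has_field_derivative_transform_within_open [where S = "{..<0}"])
        (use 1 in \<open>auto simp: flat_exp_def\<close>)
    then show ?thesis using 1 by (simp add: flat_exp_def)
  next
    case 2
    \<comment> \<open>The difference quotient at 0 is itself the member of the family with index
      \<open>Suc m\<close>, whose limit is already known.\<close>
    have "((\<lambda>h. flat_exp m h / h) \<longlongrightarrow> 0) (at 0)"
    proof (rule Lim_transform_eventually [OF flat_exp_tendsto_0 [of "Suc m"]])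
      show "\<forall>\<^sub>F t in at 0. flat_exp (Suc m) t = flat_exp m t / t"
        by (auto simp: flat_exp_def eventually_at_filter)
    qed
    then have "(flat_exp m has_real_derivative 0) (at 0)"
      by (simp add: DERIV_def flat_exp_eq_0)
    then show ?thesis using 2 by (simp add: flat_exp_eq_0)
  next
    case 3
    have e: "((\<lambda>t. exp (- 1 / t)) has_real_derivative exp (- 1 / t) / t\<^sup>2) (at t)"
      using 3 by (auto intro!: derivative_eq_intros simp: field_simps power2_eq_square)
    have "((\<lambda>t. exp (- 1 / t) / t ^ m) has_real_derivative
        (exp (-1 / t) / t ^ (m + 2) - m * (exp (-1 / t) / t ^ (m + 1)))) (at t)"
      by (rule DERIV_cong [OF DERIV_divide [OF e DERIV_pow]], use 3 in simp,
          cases m) (use 3 in \<open>simp_all add: field_simps power2_eq_square\<close>)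
    then have "(flat_exp m has_real_derivative
        (exp (-1 / t) / t ^ (m + 2) - m * (exp (-1 / t) / t ^ (m + 1)))) (at t)"
      by (rule has_field_derivative_transform_within_open [where S = "{0<..}"])
        (use 3 in \<open>auto simp: flat_exp_def\<close>)
    then show ?thesis using 3 by (simp add: flat_exp_def)
  qed
qed

lemma partial_eqI:
  assumes "(f has_derivative f') (at x)"
  shows "partial i f x = f' (axis i 1)"
  using frechet_derivative_at [OF assms] by (simp add: partial_def)

text \<open>An algebra of functions that contains the radial bumps and is closed under partial
  derivatives; this closure is what the coinductive predicate \<open>smooth_fun\<close> asks for.\<close>

inductive bump_algebra :: "(real^'n::finite \<Rightarrow> real) \<Rightarrow> bool" where
  const: "bump_algebra (\<lambda>x. c)"
| coord: "bump_algebra (\<lambda>x. x $ i)"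
| radial: "bump_algebra (\<lambda>x. flat_exp m (r - (x - a) \<bullet> (x - a)))"
| add: "bump_algebra f \<Longrightarrow> bump_algebra g \<Longrightarrow> bump_algebra (\<lambda>x. f x + g x)"
| mult: "bump_algebra f \<Longrightarrow> bump_algebra g \<Longrightarrow> bump_algebra (\<lambda>x. f x * g x)"

lemma bump_algebra_partial:
  fixes f :: "real^'n::finite \<Rightarrow> real"
  assumes "bump_algebra f"
  shows "(\<forall>x. f differentiable (at x)) \<and> (\<forall>i. bump_algebra (partial i f))"
  using assms
proof induction
  case (const c)
  have "partial i (\<lambda>x::real^'n. c) = (\<lambda>x. 0)" for i
    by (rule ext) (rule partial_eqI, auto intro!: derivative_eq_intros)
  then show ?case by (auto intro: bump_algebra.const)
next
  case (coord j)
  have d: "((\<lambda>x::real^'n. x $ j) has_derivative (\<lambda>h. h $ j)) (at x)" for x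
    by (rule bounded_linear_imp_has_derivative) (rule bounded_linear_vec_nth)
  have "partial i (\<lambda>x::real^'n. x $ j) = (\<lambda>x. axis i 1 $ j)" for i
    by (rule ext) (rule partial_eqI [OF d])
  then show ?case using d by (auto intro: bump_algebra.const simp: differentiable_def)
next
  case (radial m r a)
  define F where "F k x = flat_exp k (r - (x - a) \<bullet> (x - a))" for k and x :: "real^'n"
  have d: "(F m has_derivative
      (\<lambda>h. (F (m + 2) x - m * F (m + 1) x) * (- 2 * ((x - a) \<bullet> h)))) (at x)" for x
  proof -
    have "((\<lambda>x. r - (x - a) \<bullet> (x - a)) has_derivative (\<lambda>h. - 2 * ((x - a) \<bullet> h))) (at x)"
      by (auto intro!: derivative_eq_intros simp: inner_commute)
    from has_derivative_compose [OF this
        flat_exp_has_derivative [of m "r - (x - a) \<bullet> (x - a)", unfolded has_field_derivative_def]]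
    show ?thesis by (simp add: F_def [abs_def] F_def)
  qed
  \<comment> \<open>The differences are spelled as sums with constant multiples because the algebra
    is generated by sums and products only.\<close>
  have p: "partial i (F m) =
      (\<lambda>x. (F (m + 2) x + (- real m) * F (m + 1) x) * ((- 2) * (x $ i + (- (a $ i)))))" for i
    by (rule ext) (subst partial_eqI [OF d], simp add: inner_axis)
  have "bump_algebra (partial i (F m))" for i
    unfolding p F_def
    by (intro bump_algebra.intros)
  moreover have "(\<lambda>x. flat_exp m (r - (x - a) \<bullet> (x - a))) = F m"
    by (rule ext) (simp add: F_def)
  ultimately show ?case using d by (auto simp: differentiable_def)
next
  case (add f g)
  have "partial i (\<lambda>x. f x + g x) = (\<lambda>x. partial i f x + partial i g x)" for i
  proof
    fix x
    have "((\<lambda>x. f x + g x) has_derivative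
        (\<lambda>h. frechet_derivative f (at x) h + frechet_derivative g (at x) h)) (at x)"
      using add.IH by (intro has_derivative_add) (auto simp: frechet_derivative_works)
    from partial_eqI [OF this]
    show "partial i (\<lambda>x. f x + g x) x = partial i f x + partial i g x"
      by (simp add: partial_def)
  qed
  then show ?case using add.IH by (auto intro: bump_algebra.add)
next
  case (mult f g)
  have "partial i (\<lambda>x. f x * g x) = (\<lambda>x. f x * partial i g x + partial i f x * g x)" for i
  proof
    fix x
    have "((\<lambda>x. f x * g x) has_derivative
        (\<lambda>h. f x * frechet_derivative g (at x) h + frechet_derivative f (at x) h * g x)) (at x)"
      using mult.IH by (intro has_derivative_mult) (auto simp: frechet_derivative_works)
    from partial_eqI [OF this]
    show "partial i (\<lambda>x. f x * g x) x = f x * partial i g x + partial i f x * g x"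
      by (simp add: partial_def)
  qed
  moreover have "bump_algebra (\<lambda>x. f x * partial i g x + partial i f x * g x)" for i
    using mult by (intro bump_algebra.add bump_algebra.mult) auto
  ultimately show ?case using mult.IH by auto
qed

lemma bump_algebra_smooth: "bump_algebra f \<Longrightarrow> smooth_fun f"
proof (coinduction arbitrary: f)
  case smooth_fun
  then show ?case using bump_algebra_partial [OF smooth_fun] by blast
qed

section \<open>Gradients of smooth functions and estimates for compact support\<close>

definition grad :: "(real^'n::finite \<Rightarrow> real) \<Rightarrow> real^'n \<Rightarrow> real^'n" where
  "grad f x = (\<chi> i. partial i f x)"

lemma linear_eq_inner_axis:
  fixes L :: "real^'n::finite \<Rightarrow> real"
  assumes "linear L"
  shows "L h = h \<bullet> (\<chi> i. L (axis i 1))"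
proof -
  have "L h = L (\<Sum>i\<in>UNIV. h $ i *\<^sub>R axis i 1)"
    by (simp only: basis_expansion scalar_mult_eq_scaleR [symmetric])
  also have "\<dots> = (\<Sum>i\<in>UNIV. h $ i * L (axis i 1))"
    using assms by (simp add: linear_sum linear_scale)
  finally show ?thesis by (simp add: inner_vec_def)
qed

lemma has_derivative_grad:
  fixes f :: "real^'n::finite \<Rightarrow> real"
  assumes "f differentiable (at x)"
  shows "(f has_derivative (\<lambda>h. h \<bullet> grad f x)) (at x)"
proof -
  have f: "(f has_derivative frechet_derivative f (at x)) (at x)"
    using assms by (simp add: frechet_derivative_works)
  have "frechet_derivative f (at x) h = h \<bullet> grad f x" for h
    unfolding grad_def partial_def
    by (rule linear_eq_inner_axis [OF has_derivative_linear [OF f]])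
  then have "frechet_derivative f (at x) = (\<lambda>h. h \<bullet> grad f x)" by (rule ext)
  from f [unfolded this] show ?thesis .
qed

lemma partial_has_derivative_inner:
  "(f has_derivative (\<lambda>h. h \<bullet> g)) (at x) \<Longrightarrow> partial i f x = g $ i"
  by (subst partial_eqI, assumption) (simp add: inner_axis inner_commute)

lemma smooth_fun_differentiable: "smooth_fun f \<Longrightarrow> f differentiable (at x)"
  by (erule smooth_fun.cases) blast

lemma smooth_fun_partial: "smooth_fun f \<Longrightarrow> smooth_fun (partial i f)"
  by (erule smooth_fun.cases) blast

lemma smooth_fun_continuous: "smooth_fun f \<Longrightarrow> continuous_on S f"
  by (meson smooth_fun_differentiable continuous_at_imp_continuous_on differentiable_imp_continuous_within)

lemma smooth_fun_continuous_grad: "smooth_fun f \<Longrightarrow> continuous_on S (grad f)"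
  unfolding grad_def [abs_def]
  by (intro continuous_on_vec_lambda smooth_fun_continuous smooth_fun_partial)

lemma partial_eq_0_outside:
  assumes "\<And>x. x \<notin> K \<Longrightarrow> f x = 0" "closed K" "x \<notin> K"
  shows "partial i f x = 0"
proof -
  have "((\<lambda>_. 0) has_derivative (\<lambda>_. 0)) (at x)" by simp
  then have "(f has_derivative (\<lambda>_. 0)) (at x)"
    by (rule has_derivative_transform_within_open [where s = "- K"]) (use assms in auto)
  from partial_eqI [OF this] show ?thesis .
qed

lemma compact_support_bounded:
  fixes f :: "'a::topological_space \<Rightarrow> 'b::real_normed_vector"
  assumes "continuous_on UNIV f" "compact K" "\<And>x. x \<notin> K \<Longrightarrow> f x = 0"
  obtains B where "0 \<le> B" "\<And>x. norm (f x) \<le> B"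
proof -
  have "compact (f ` K)"
    using assms by (intro compact_continuous_image) (auto intro: continuous_on_subset)
  then obtain B where "\<And>x. x \<in> K \<Longrightarrow> norm (f x) \<le> B"
    by (meson bounded_iff compact_imp_bounded imageI)
  then have "norm (f x) \<le> max B 0" for x
    using assms(3) by (cases "x \<in> K") (auto simp: max.coboundedI1)
  then show ?thesis using that [of "max B 0"] by simp
qed

lemma compact_support_integrable:
  fixes f :: "real^'n::finite \<Rightarrow> real"
  assumes "continuous_on UNIV f" "compact K" "\<And>x. x \<notin> K \<Longrightarrow> f x = 0"
  shows "integrable lborel f"
proof -
  have "integrable lborel (\<lambda>x. indicator K x *\<^sub>R f x)"
    using assms by (intro borel_integrable_compact) (auto intro: continuous_on_subset)
  moreover have "(\<lambda>x. indicator K x *\<^sub>R f x) = f"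
    using assms(3) by (auto simp: indicator_def fun_eq_iff)
  ultimately show ?thesis by simp
qed

lemma bounded_grad_imp_lipschitz:
  fixes f :: "real^'n::finite \<Rightarrow> real"
  assumes "\<And>x. f differentiable (at x)" "\<And>x. norm (grad f x) \<le> L"
  shows "\<bar>f x - f y\<bar> \<le> L * norm (x - y)"
proof -
  have "norm (f x - f y) \<le> L * norm (x - y)"
  proof (rule differentiable_bound [where S = UNIV and f' = "\<lambda>x h. h \<bullet> grad f x"])
    show "onorm (\<lambda>h. h \<bullet> grad f x) \<le> L" for x
      by (rule onorm_le)
        (metis Cauchy_Schwarz_ineq2 assms(2) mult.commute mult_left_mono norm_ge_zero order_trans
          real_norm_def)
  qed (use assms has_derivative_grad in auto)
  then show ?thesis by simp
qed

text \<open>The second derivatives are continuous and vanish off \<open>K\<close>, so the gradient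
  is Lipschitz; the mean value inequality applied to the deviation from the linearisation gives the
  second factor \<open>norm h\<close>. That \<open>C\<close> does not depend on \<open>x\<close>
  allows the estimate to be integrated against an arbitrary integrable function.\<close>

lemma smooth_compact_support_taylor:
  fixes f :: "real^'n::finite \<Rightarrow> real"
  assumes f: "smooth_fun f" and K: "compact K" "\<And>x. x \<notin> K \<Longrightarrow> f x = 0"
  obtains C where "0 \<le> C" "\<And>x h. \<bar>f (x + h) - f x - h \<bullet> grad f x\<bar> \<le> C * (norm h)\<^sup>2"
proof -
  have "\<exists>L\<ge>0. \<forall>x y. \<bar>partial i f x - partial i f y\<bar> \<le> L * norm (x - y)" for i
  proof -
    have z: "x \<notin> K \<Longrightarrow> partial i f x = 0" for i x
      using partial_eq_0_outside K compact_imp_closed by metis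
    have z2: "x \<notin> K \<Longrightarrow> grad (partial i f) x = 0" for x
      unfolding grad_def vec_eq_iff
      using partial_eq_0_outside [OF z compact_imp_closed [OF K(1)]] by simp
    obtain L where "0 \<le> L" "\<And>x. norm (grad (partial i f) x) \<le> L"
      using compact_support_bounded [OF smooth_fun_continuous_grad K(1) z2] f smooth_fun_partial
      by metis
    then show ?thesis
      using bounded_grad_imp_lipschitz [OF smooth_fun_differentiable [OF smooth_fun_partial [OF f]]]
      by blast
  qed
  then obtain L where L: "\<And>i. 0 \<le> L i"
      "\<And>i x y. \<bar>partial i f x - partial i f y\<bar> \<le> L i * norm (x - y)"
    by metis
  define C where "C = (\<Sum>i\<in>UNIV. L i)"
  have g: "norm (grad f x - grad f y) \<le> C * norm (x - y)" for x y
  proof -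
    have "norm (grad f x - grad f y) \<le> (\<Sum>i\<in>UNIV. \<bar>(grad f x - grad f y) $ i\<bar>)"
      by (rule norm_le_l1_cart)
    also have "\<dots> \<le> (\<Sum>i\<in>UNIV. L i * norm (x - y))"
      by (rule sum_mono) (simp add: grad_def L)
    finally show ?thesis by (simp add: C_def sum_distrib_right)
  qed
  have "0 \<le> C" unfolding C_def by (intro sum_nonneg L)
  have "\<bar>f (x + h) - f x - h \<bullet> grad f x\<bar> \<le> C * (norm h)\<^sup>2" for x h
  proof -
    have "norm (f (x + h) - f x - (x + h - x) \<bullet> grad f x) \<le> norm (x + h - x) * (C * norm h)"
    proof (rule differentiable_bound_linearization [where S = "closed_segment x (x + h)" and f' = "\<lambda>x h. h \<bullet> grad f x"])
      show "x + t *\<^sub>R (x + h - x) \<in> closed_segment x (x + h)" if "t \<in> {0..1}" for t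
      proof -
        have "x + t *\<^sub>R (x + h - x) = (1 - t) *\<^sub>R x + t *\<^sub>R (x + h)"
          by (simp add: algebra_simps)
        then show ?thesis using that unfolding in_segment by auto
      qed
      show "(f has_derivative (\<lambda>h. h \<bullet> grad f y)) (at y within closed_segment x (x + h))" for y
        by (rule has_derivative_at_withinI [OF has_derivative_grad [OF smooth_fun_differentiable [OF f]]])
      show "onorm ((\<lambda>i. i \<bullet> grad f y) - (\<lambda>i. i \<bullet> grad f x)) \<le> C * norm h"
        if "y \<in> closed_segment x (x + h)" for y
        unfolding fun_diff_def
      proof (rule onorm_le)
        fix i
        have "norm (y - x) \<le> norm h" using segment_bound1 [OF that] by simp
        then have "norm (grad f y - grad f x) \<le> C * norm h"
          using g [of y x] \<open>0 \<le> C\<close> by (meson mult_left_mono order_trans)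
        moreover have "\<bar>i \<bullet> (grad f y - grad f x)\<bar> \<le> norm i * norm (grad f y - grad f x)"
          by (rule Cauchy_Schwarz_ineq2)
        ultimately have "\<bar>i \<bullet> (grad f y - grad f x)\<bar> \<le> norm i * (C * norm h)"
          by (meson mult_left_mono norm_ge_zero order_trans)
        then show "norm (i \<bullet> grad f y - i \<bullet> grad f x) \<le> C * norm h * norm i"
          by (simp add: inner_diff_right mult.commute)
      qed
    qed auto
    then show ?thesis by (simp add: power2_eq_square mult_ac)
  qed
  with \<open>0 \<le> C\<close> that show ?thesis by blast
qed

section \<open>Mollification\<close>

lemma nn_integral_lborel_affine:
  fixes t :: "'a::euclidean_space"
  assumes [measurable]: "f \<in> borel_measurable borel" and c: "c \<noteq> 0"
  shows "(\<integral>\<^sup>+x. f x \<partial>lborel) = ennreal (\<bar>c\<bar> ^ DIM('a)) * (\<integral>\<^sup>+x. f (t + c *\<^sub>R x) \<partial>lborel)"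
  by (subst lborel_affine [OF c, of t])
    (simp add: nn_integral_density nn_integral_distr nn_integral_cmult)

lemma integral_lborel_affine_isometry:
  fixes f :: "'a::euclidean_space \<Rightarrow> real" and t :: 'a
  assumes [measurable]: "f \<in> borel_measurable borel" and c: "\<bar>c\<bar> = 1"
  shows "(\<integral>x. f (t + c *\<^sub>R x) \<partial>lborel) = (\<integral>x. f x \<partial>lborel)"
proof -
  have "(\<integral>x. f x \<partial>lborel) = (\<integral>x. f x \<partial>(distr lborel borel (\<lambda>x. t + c *\<^sub>R x)))"
    using lborel_affine [of c t] c by (auto simp: density_1)
  also have "\<dots> = (\<integral>x. f (t + c *\<^sub>R x) \<partial>lborel)"
    by (rule integral_distr) auto
  finally show ?thesis ..
qed

lemma integrable_bounded_mult:
  fixes h G :: "'a \<Rightarrow> real"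
  assumes "integrable M G" "h \<in> borel_measurable M" "\<And>x. \<bar>h x\<bar> \<le> B"
  shows "integrable M (\<lambda>x. h x * G x)"
proof (rule Bochner_Integration.integrable_bound [where f = "\<lambda>x. B * G x"])
  show "AE x in M. norm (h x * G x) \<le> norm (B * G x)"
  proof (rule AE_I2)
    fix x
    have "\<bar>h x\<bar> * \<bar>G x\<bar> \<le> \<bar>B\<bar> * \<bar>G x\<bar>"
      using assms(3) [of x] by (intro mult_right_mono) auto
    then show "norm (h x * G x) \<le> norm (B * G x)" by (simp add: abs_mult)
  qed
qed (use assms in auto)

lemma continuous_borel_measurable_lebesgue:
  fixes f :: "'a::euclidean_space \<Rightarrow> 'b::topological_space"
  assumes "continuous_on UNIV f"
  shows "f \<in> borel_measurable lebesgue"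
  by (intro measurable_completion) (simp add: assms borel_measurable_continuous_onI)

text \<open>A separate bump for each \<open>r\<close>, normalised by its own integral, in place of
  rescalings of one kernel: every bound on the kernel or its derivatives is used for a fixed
  \<open>r\<close>, and what is uniform in \<open>r\<close> is only positivity, unit mass and
  support in the ball of radius \<open>r\<close>.\<close>

definition mollifier :: "real \<Rightarrow> real^'n::finite \<Rightarrow> real" where
  "mollifier r z = flat_exp 0 (r\<^sup>2 - z \<bullet> z) / (\<integral>w. flat_exp 0 (r\<^sup>2 - w \<bullet> w :: real) \<partial>(lborel :: (real^'n) measure))"

definition mollify :: "real \<Rightarrow> (real^'n::finite \<Rightarrow> real) \<Rightarrow> real^'n \<Rightarrow> real" where
  "mollify r G x = (\<integral>y. mollifier r (x - y) * G y \<partial>lebesgue)"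

lemma smooth_mollifier_translate: "smooth_fun (\<lambda>y. mollifier r (x - y))"
proof -
  have "(\<lambda>y. mollifier r (x - y)) = (\<lambda>y. flat_exp 0 (r\<^sup>2 - (y - x) \<bullet> (y - x)) *
      (1 / (\<integral>w. flat_exp 0 (r\<^sup>2 - w \<bullet> w :: real) \<partial>(lborel :: (real^'a) measure))))"
    by (auto simp: mollifier_def fun_eq_iff norm_minus_commute simp flip: power2_norm_eq_inner)
  then show ?thesis
    by (simp only:) (rule bump_algebra_smooth [OF bump_algebra.mult [OF bump_algebra.radial bump_algebra.const]])
qed

lemma mollifier_uminus: "mollifier r (- z) = mollifier r z"
  by (simp add: mollifier_def)

lemma smooth_mollifier: "smooth_fun (mollifier r)"
proof -
  have "(\<lambda>y. mollifier r (0 - y)) = mollifier r" by (simp add: mollifier_uminus fun_eq_iff)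
  then show ?thesis using smooth_mollifier_translate [of r 0] by metis
qed

lemma mollifier_nonneg: "0 \<le> mollifier r z"
  unfolding mollifier_def by (intro divide_nonneg_nonneg integral_nonneg_AE) (auto simp: flat_exp_nonneg)

lemma mollifier_eq_0:
  assumes "0 < r" "r \<le> norm z"
  shows "mollifier r z = 0"
proof -
  have "r\<^sup>2 \<le> z \<bullet> z" using assms by (simp add: dot_square_norm power_mono)
  then show ?thesis by (simp add: mollifier_def flat_exp_eq_0)
qed

lemma mollifier_outside_cball: "0 < r \<Longrightarrow> z \<notin> cball 0 r \<Longrightarrow> mollifier r z = 0"
  by (rule mollifier_eq_0) auto

lemma partial_mollifier_outside_cball:
  "0 < r \<Longrightarrow> z \<notin> cball 0 r \<Longrightarrow> partial i (mollifier r) z = 0"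
  using partial_eq_0_outside [of "cball 0 r" "mollifier r" z i] mollifier_outside_cball by blast

lemma continuous_mollifier: "continuous_on S (mollifier r)"
  by (rule smooth_fun_continuous [OF smooth_mollifier])

lemma measurable_mollifier [measurable]: "mollifier r \<in> borel_measurable borel"
  by (rule borel_measurable_continuous_onI) (rule continuous_mollifier)

text \<open>The point is that the normalising integral is not 0: the bump is strictly positive on an
  open ball, which is not negligible.\<close>

lemma integral_mollifier:
  assumes "0 < r"
  shows "(\<integral>z. mollifier r z \<partial>(lborel :: (real^'n::finite) measure)) = 1"
proof -
  define F where "F = (\<lambda>w::real^'n. flat_exp 0 (r\<^sup>2 - w \<bullet> w))"
  have sm: "smooth_fun F"
    using bump_algebra_smooth [OF bump_algebra.radial [of 0 "r\<^sup>2" "0::real^'n"]] by (simp add: F_def)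
  have out: "F w = 0" if "w \<notin> cball 0 r" for w
  proof -
    have "r\<^sup>2 \<le> w \<bullet> w" using assms that by (simp add: dot_square_norm power_mono)
    then show ?thesis by (simp add: F_def flat_exp_eq_0)
  qed
  have int: "integrable lborel F"
    by (rule compact_support_integrable [OF smooth_fun_continuous [OF sm] compact_cball [of 0 r] out])
  have "(\<integral>w. F w \<partial>lborel) \<noteq> 0"
  proof
    assume "(\<integral>w. F w \<partial>lborel) = 0"
    then have "AE w in lborel. F w = 0"
      using integral_nonneg_eq_0_iff_AE [OF int] by (simp add: F_def flat_exp_nonneg)
    then have "AE w in lborel. w \<notin> ball (0::real^'n) r"
    proof (rule AE_mp, intro AE_I2 impI notI)
      fix w :: "real^'n"
      assume "F w = 0" "w \<in> ball 0 r"
      then have "w \<bullet> w < r\<^sup>2" using assms by (simp add: dot_square_norm power_strict_mono)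
      with \<open>F w = 0\<close> show False using flat_exp_pos_iff [of 0 "r\<^sup>2 - w \<bullet> w"] by (simp add: F_def)
    qed
    then have "ball (0::real^'n) r \<in> null_sets lborel"
      by (subst (asm) AE_iff_null_sets [symmetric]) auto
    then have "negligible (ball (0::real^'n) r)"
      by (simp add: negligible_iff_null_sets null_sets_completionI)
    then show False using assms negligible_iff_emeasure0 open_not_negligible
      by (metis ball_eq_empty not_le open_ball)
  qed
  then show ?thesis by (simp add: mollifier_def F_def)
qed

lemma integral_mollifier_translate:
  assumes "0 < r"
  shows "(\<integral>y. mollifier r (x - y) \<partial>lborel) = 1" "integrable lborel (\<lambda>y. mollifier r (x - y))"
proof -
  show 1: "(\<integral>y. mollifier r (x - y) \<partial>lborel) = 1"
    using integral_lborel_affine_isometry [of "mollifier r" "-1" x] integral_mollifier [OF assms]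
    by simp
  \<comment> \<open>A function that is not integrable has Bochner integral 0, so the value 1 already
    proves integrability.\<close>
  show "integrable lborel (\<lambda>y. mollifier r (x - y))"
    using 1 not_integrable_integral_eq by fastforce
qed

lemma nn_integral_mollifier_translate:
  assumes "0 < r"
  shows "(\<integral>\<^sup>+x. ennreal (mollifier r (x - y)) \<partial>lborel) = 1"
proof -
  have "(\<integral>\<^sup>+x. ennreal (mollifier r (x - y)) \<partial>lborel)
      = (\<integral>\<^sup>+x. ennreal (mollifier r (y - x)) \<partial>lborel)"
    using mollifier_uminus by (metis minus_diff_eq)
  also have "\<dots> = ennreal 1"
    using integral_mollifier_translate [OF assms, of y] mollifier_nonneg
    by (subst nn_integral_eq_integral) auto
  finally show ?thesis by simp
qed

lemma mollifier_bounded: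
  assumes "0 < r"
  obtains B where "0 \<le> B" "\<And>z. \<bar>mollifier r z\<bar> \<le> B"
  using compact_support_bounded [OF continuous_mollifier compact_cball [of 0 r]
      mollifier_outside_cball [OF assms]] real_norm_def by metis

lemma mollifier_lipschitz:
  assumes "0 < r"
  obtains L where "\<And>z w :: real^'n::finite. \<bar>mollifier r z - mollifier r w\<bar> \<le> L * norm (z - w)"
proof -
  have "x \<notin> cball 0 r \<Longrightarrow> grad (mollifier r) x = 0" for x :: "real^'n"
    using partial_mollifier_outside_cball [OF assms, of x] by (simp add: grad_def vec_eq_iff)
  then obtain L where "\<And>x::real^'n. norm (grad (mollifier r) x) \<le> L"
    using compact_support_bounded [OF smooth_fun_continuous_grad [OF smooth_mollifier] compact_cball [of 0 r]]
    by metis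
  then show ?thesis
    using that bounded_grad_imp_lipschitz [OF smooth_fun_differentiable [OF smooth_mollifier]]
    by metis
qed

lemma continuous_translate_measurable:
  fixes k :: "real^'n::finite \<Rightarrow> real"
  assumes "continuous_on UNIV k"
  shows "(\<lambda>y. k (x - y)) \<in> borel_measurable lebesgue"
  by (rule continuous_borel_measurable_lebesgue)
    (intro continuous_on_compose2 [OF assms] continuous_intros, simp)

lemma mollify_integrable:
  fixes G :: "real^'n::finite \<Rightarrow> real"
  assumes "integrable lebesgue G" "0 < r"
  shows "integrable lebesgue (\<lambda>y. mollifier r (x - y) * G y)"
proof -
  obtain B where "\<And>z::real^'n. \<bar>mollifier r z\<bar> \<le> B" using mollifier_bounded [OF assms(2)] by metis
  then show ?thesis
    by (intro integrable_bounded_mult [OF assms(1) continuous_translate_measurable])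
      (auto intro: continuous_mollifier)
qed

text \<open>A weighted mean of values within \<open>e\<close> of \<open>c\<close> lies within
  \<open>e\<close> of \<open>c\<close>. It is used with \<open>c\<close> a value of a continuous
  function (uniform convergence), with \<open>c = 0\<close> and \<open>e = 0\<close> (support of the
  mollification), and with \<open>c = 0\<close> and \<open>e\<close> an essential bound; the last
  use is why the hypothesis is only almost everywhere.\<close>

lemma mollify_near:
  fixes G :: "real^'n::finite \<Rightarrow> real"
  assumes G: "integrable lebesgue G" and r: "0 < r"
    and near: "AE y in lebesgue. y \<in> ball x r \<longrightarrow> \<bar>G y - c\<bar> \<le> e"
  shows "\<bar>mollify r G x - c\<bar> \<le> e"
proof -
  let ?k = "\<lambda>y. mollifier r (x - y)"
  have meas: "?k \<in> borel_measurable lborel" by measurable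
  have k: "integrable lebesgue ?k" "(\<integral>y. ?k y \<partial>lebesgue) = 1"
    using integral_mollifier_translate [OF r, of x] meas
    by (simp_all add: integrable_completion integral_completion)
  have kG: "integrable lebesgue (\<lambda>y. ?k y * G y)" by (rule mollify_integrable [OF G r])
  have "mollify r G x - c = (\<integral>y. ?k y * G y \<partial>lebesgue) - (\<integral>y. c * ?k y \<partial>lebesgue)"
    by (simp add: mollify_def k)
  also have "\<dots> = (\<integral>y. ?k y * G y - c * ?k y \<partial>lebesgue)"
    using k kG by (subst Bochner_Integration.integral_diff) auto
  finally have "\<bar>mollify r G x - c\<bar> = \<bar>\<integral>y. ?k y * G y - c * ?k y \<partial>lebesgue\<bar>" by simp
  also have "\<dots> \<le> (\<integral>y. \<bar>?k y * G y - c * ?k y\<bar> \<partial>lebesgue)"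
    by (rule integral_abs_bound)
  also have "\<dots> \<le> (\<integral>y. e * ?k y \<partial>lebesgue)"
  proof (rule integral_mono_AE)
    show "AE y in lebesgue. \<bar>?k y * G y - c * ?k y\<bar> \<le> e * ?k y"
      using near
    proof (rule AE_mp, intro AE_I2 impI)
      fix y assume y: "y \<in> ball x r \<longrightarrow> \<bar>G y - c\<bar> \<le> e"
      show "\<bar>?k y * G y - c * ?k y\<bar> \<le> e * ?k y"
      proof (cases "y \<in> ball x r")
        case True
        have "\<bar>?k y * G y - c * ?k y\<bar> = ?k y * \<bar>G y - c\<bar>"
          using mollifier_nonneg [of r "x - y"]
          by (metis abs_mult abs_of_nonneg mult.commute right_diff_distrib)
        also have "\<dots> \<le> ?k y * e" using y True by (intro mult_left_mono mollifier_nonneg) auto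
        finally show ?thesis by (simp add: mult.commute)
      next
        case False
        then have "?k y = 0" using r by (intro mollifier_eq_0) (auto simp: dist_norm)
        then show ?thesis by simp
      qed
    qed
  qed (use k kG in auto)
  also have "\<dots> = e" by (simp add: k)
  finally show ?thesis .
qed

text \<open>For fixed \<open>r\<close> the kernel is Lipschitz, hence so is the mollification, with
  the constant multiplied by the L1 norm of \<open>G\<close>.\<close>

lemma continuous_mollify:
  fixes G :: "real^'n::finite \<Rightarrow> real"
  assumes G: "integrable lebesgue G" and r: "0 < r"
  shows "continuous_on S (mollify r G)"
proof -
  obtain L where L: "\<And>z w :: real^'n. \<bar>mollifier r z - mollifier r w\<bar> \<le> L * norm (z - w)"
    using mollifier_lipschitz [OF r] by metis
  define C where "C = (\<integral>y. \<bar>G y\<bar> \<partial>lebesgue)"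
  have "\<bar>mollify r G x - mollify r G x'\<bar> \<le> \<bar>L\<bar> * C * norm (x - x')" for x x'
  proof -
    have i: "integrable lebesgue (\<lambda>y. mollifier r (x - y) * G y - mollifier r (x' - y) * G y)"
      by (intro Bochner_Integration.integrable_diff mollify_integrable assms)
    have "mollify r G x - mollify r G x' = (\<integral>y. mollifier r (x - y) * G y - mollifier r (x' - y) * G y \<partial>lebesgue)"
      unfolding mollify_def
      by (rule Bochner_Integration.integral_diff [symmetric]) (intro mollify_integrable assms)+
    then have "\<bar>mollify r G x - mollify r G x'\<bar>
        \<le> (\<integral>y. \<bar>mollifier r (x - y) * G y - mollifier r (x' - y) * G y\<bar> \<partial>lebesgue)"
      by (simp only: integral_abs_bound)
    also have "\<dots> \<le> (\<integral>y. \<bar>L\<bar> * norm (x - x') * \<bar>G y\<bar> \<partial>lebesgue)"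
    proof (rule integral_mono)
      fix y
      have "\<bar>mollifier r (x - y) - mollifier r (x' - y)\<bar> \<le> \<bar>L\<bar> * norm (x - x')"
        using L [of "x - y" "x' - y"] mult_right_mono [OF abs_ge_self norm_ge_zero, of L "x - x'"]
        by simp
      then show "\<bar>mollifier r (x - y) * G y - mollifier r (x' - y) * G y\<bar> \<le> \<bar>L\<bar> * norm (x - x') * \<bar>G y\<bar>"
        by (simp add: abs_mult mult_right_mono flip: left_diff_distrib)
    qed (use i G in auto)
    finally show ?thesis by (simp add: C_def mult_ac)
  qed
  then have "(\<bar>L\<bar> * C)-lipschitz_on S (mollify r G)"
    by (intro lipschitz_onI) (auto simp: dist_norm C_def)
  then show ?thesis by (rule lipschitz_on_continuous_on)
qed

lemma has_derivative_quadratic_error: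
  fixes f :: "'a::real_normed_vector \<Rightarrow> 'b::real_normed_vector"
  assumes "bounded_linear f'" "\<And>h. norm (f (x + h) - f x - f' h) \<le> C * (norm h)\<^sup>2"
  shows "(f has_derivative f') (at x)"
  unfolding has_derivative_at
proof
  show "((\<lambda>h. norm (f (x + h) - f x - f' h) / norm h) \<longlongrightarrow> 0) (at 0)"
  proof (rule tendsto_sandwich [OF _ _ tendsto_const])
    show "\<forall>\<^sub>F h in at 0. norm (f (x + h) - f x - f' h) / norm h \<le> C * norm h"
      using assms(2) by (intro always_eventually allI) (auto simp: divide_simps power2_eq_square mult_ac)
    show "((\<lambda>h. C * norm h) \<longlongrightarrow> 0) (at (0::'a))"
      by (rule tendsto_eq_intros | simp)+
  qed auto
qed (fact assms)

text \<open>The Taylor estimate for the kernel is uniform in the base point. Integrated against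
  \<open>G\<close> it leaves an error quadratic in \<open>h\<close>, which gives the derivative
  directly, without a limit under the integral sign.\<close>

lemma mollify_has_derivative:
  fixes G :: "real^'n::finite \<Rightarrow> real"
  assumes G: "integrable lebesgue G" and r: "0 < r"
  shows "(mollify r G has_derivative
      (\<lambda>h. h \<bullet> (\<chi> i. \<integral>y. partial i (mollifier r) (x - y) * G y \<partial>lebesgue))) (at x)"
proof -
  define V where "V = (\<chi> i. \<integral>y. partial i (mollifier r) (x - y) * G y \<partial>lebesgue)"
  obtain C where C: "0 \<le> C"
      "\<And>(x::real^'n) h. \<bar>mollifier r (x + h) - mollifier r x - h \<bullet> grad (mollifier r) x\<bar> \<le> C * (norm h)\<^sup>2"
    using smooth_compact_support_taylor [OF smooth_mollifier compact_cball [of 0 r]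
        mollifier_outside_cball [OF r]] by metis
  have ip: "integrable lebesgue (\<lambda>y. partial i (mollifier r) (x - y) * G y)" for i
  proof -
    have c: "continuous_on UNIV (partial i (mollifier r))"
      by (intro smooth_fun_continuous smooth_fun_partial smooth_mollifier)
    obtain B where "\<And>z. norm (partial i (mollifier r) z) \<le> B"
      using compact_support_bounded [OF c compact_cball [of 0 r]
          partial_mollifier_outside_cball [OF r]] by metis
    then show ?thesis
      by (intro integrable_bounded_mult [OF G continuous_translate_measurable [OF c]]) auto
  qed
  have error: "norm (mollify r G (x + h) - mollify r G x
      - h \<bullet> (\<chi> i. \<integral>y. partial i (mollifier r) (x - y) * G y \<partial>lebesgue))
      \<le> (C * (\<integral>y. \<bar>G y\<bar> \<partial>lebesgue)) * (norm h)\<^sup>2" for h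
  proof -
    have V: "h \<bullet> V = (\<integral>y. (h \<bullet> grad (mollifier r) (x - y)) * G y \<partial>lebesgue)"
      using ip by (simp add: V_def inner_vec_def grad_def sum_distrib_right mult.assoc)
    have ih: "integrable lebesgue (\<lambda>y. (h \<bullet> grad (mollifier r) (x - y)) * G y)"
      using ip by (simp add: inner_vec_def grad_def sum_distrib_right mult.assoc)
    have im: "integrable lebesgue (\<lambda>y. mollifier r (z - y) * G y)" for z
      by (rule mollify_integrable [OF G r])
    have "mollify r G (x + h) - mollify r G x - h \<bullet> V =
        (\<integral>y. mollifier r (x + h - y) * G y - mollifier r (x - y) * G y
          - (h \<bullet> grad (mollifier r) (x - y)) * G y \<partial>lebesgue)"
      unfolding V mollify_def using im ih
      by (simp add: Bochner_Integration.integral_diff Bochner_Integration.integrable_diff)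
    then have "\<bar>mollify r G (x + h) - mollify r G x - h \<bullet> V\<bar> \<le>
        (\<integral>y. \<bar>mollifier r (x + h - y) * G y - mollifier r (x - y) * G y
          - (h \<bullet> grad (mollifier r) (x - y)) * G y\<bar> \<partial>lebesgue)"
      by (simp only: integral_abs_bound)
    also have "\<dots> \<le> (\<integral>y. (C * (norm h)\<^sup>2) * \<bar>G y\<bar> \<partial>lebesgue)"
    proof (rule integral_mono)
      show "integrable lebesgue (\<lambda>y. \<bar>mollifier r (x + h - y) * G y - mollifier r (x - y) * G y
          - (h \<bullet> grad (mollifier r) (x - y)) * G y\<bar>)"
        using im ih by (intro integrable_abs Bochner_Integration.integrable_diff)
      fix y
      have "\<bar>mollifier r (x + h - y) - mollifier r (x - y) - h \<bullet> grad (mollifier r) (x - y)\<bar>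
          \<le> C * (norm h)\<^sup>2"
        using C(2) [of "x - y" h] by (simp add: algebra_simps)
      then have "\<bar>mollifier r (x + h - y) - mollifier r (x - y) - h \<bullet> grad (mollifier r) (x - y)\<bar> * \<bar>G y\<bar>
          \<le> C * (norm h)\<^sup>2 * \<bar>G y\<bar>" by (rule mult_right_mono) simp
      then show "\<bar>mollifier r (x + h - y) * G y - mollifier r (x - y) * G y
          - (h \<bullet> grad (mollifier r) (x - y)) * G y\<bar> \<le> C * (norm h)\<^sup>2 * \<bar>G y\<bar>"
        by (simp only: abs_mult [symmetric] left_diff_distrib)
    qed (use G in auto)
    also have "\<dots> = (C * (\<integral>y. \<bar>G y\<bar> \<partial>lebesgue)) * (norm h)\<^sup>2" by simp
    finally show ?thesis by (simp add: V_def)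
  qed
  show ?thesis
    by (rule has_derivative_quadratic_error [OF bounded_linear_inner_left error])
qed

text \<open>Tonelli: the integral over \<open>x\<close> is taken first, and there the kernel has
  mass 1.\<close>

lemma nn_integral_mollify_le:
  fixes G :: "real^'n::finite \<Rightarrow> real"
  assumes G: "integrable lebesgue G" and r: "0 < r"
  shows "(\<integral>\<^sup>+x. ennreal \<bar>mollify r G x\<bar> \<partial>lebesgue) \<le> (\<integral>\<^sup>+x. ennreal \<bar>G x\<bar> \<partial>lebesgue)"
proof -
  \<comment> \<open>The exchange of integrals takes place over the product of Borel measures, so the
    Lebesgue measurable \<open>G\<close> is first replaced by a Borel function that is equal to it
    almost everywhere.\<close>
  obtain F where F [measurable]: "F \<in> borel_measurable lborel" and ae: "AE x in lborel. G x = F x"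
    using completion_ex_borel_measurable_real [of G lborel] G by auto
  have ae': "AE x in lebesgue. G x = F x" by (rule AE_completion [OF ae])
  have F': "F \<in> borel_measurable borel" using F by simp
  have "(\<integral>\<^sup>+x. ennreal \<bar>mollify r G x\<bar> \<partial>lebesgue)
      \<le> (\<integral>\<^sup>+x. (\<integral>\<^sup>+y. ennreal (mollifier r (x - y) * \<bar>F y\<bar>) \<partial>lborel) \<partial>lebesgue)"
  proof (rule nn_integral_mono)
    fix x
    have "ennreal \<bar>mollify r G x\<bar> \<le> (\<integral>\<^sup>+y. ennreal (norm (mollifier r (x - y) * G y)) \<partial>lebesgue)"
      unfolding mollify_def real_norm_def [symmetric]
      by (rule integral_norm_bound_ennreal) (rule mollify_integrable [OF G r])
    also have "\<dots> = (\<integral>\<^sup>+y. ennreal (mollifier r (x - y) * \<bar>F y\<bar>) \<partial>lebesgue)"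
      by (rule nn_integral_cong_AE, use ae' in eventually_elim)
        (simp add: abs_mult mollifier_nonneg)
    finally show "ennreal \<bar>mollify r G x\<bar> \<le> (\<integral>\<^sup>+y. ennreal (mollifier r (x - y) * \<bar>F y\<bar>) \<partial>lborel)"
      by (simp add: nn_integral_completion)
  qed
  also have "\<dots> = (\<integral>\<^sup>+x. (\<integral>\<^sup>+y. ennreal (mollifier r (x - y) * \<bar>F y\<bar>) \<partial>lborel) \<partial>lborel)"
    by (rule nn_integral_completion)
  also have "\<dots> = (\<integral>\<^sup>+y. (\<integral>\<^sup>+x. ennreal (mollifier r (x - y) * \<bar>F y\<bar>) \<partial>lborel) \<partial>lborel)"
    using F' by (intro lborel_pair.Fubini' [symmetric]) measurable
  also have "\<dots> = (\<integral>\<^sup>+y. ennreal \<bar>F y\<bar> \<partial>lborel)"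
  proof (rule nn_integral_cong)
    fix y
    have "(\<integral>\<^sup>+x. ennreal (mollifier r (x - y) * \<bar>F y\<bar>) \<partial>lborel)
        = (\<integral>\<^sup>+x. ennreal (mollifier r (x - y)) * ennreal \<bar>F y\<bar> \<partial>lborel)"
      by (simp add: ennreal_mult mollifier_nonneg)
    also have "\<dots> = ennreal \<bar>F y\<bar>"
      by (subst nn_integral_multc) (auto simp: nn_integral_mollifier_translate [OF r])
    finally show "(\<integral>\<^sup>+x. ennreal (mollifier r (x - y) * \<bar>F y\<bar>) \<partial>lborel) = ennreal \<bar>F y\<bar>" .
  qed
  also have "\<dots> = (\<integral>\<^sup>+y. ennreal \<bar>G y\<bar> \<partial>lebesgue)"
    unfolding nn_integral_completion
    by (rule nn_integral_cong_AE, use ae in eventually_elim) simp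
  finally show ?thesis .
qed

section \<open>Density of continuous functions of compact support and L1 convergence of
  mollifications\<close>

definition L1_cont_approx :: "(real^'n::finite \<Rightarrow> real) \<Rightarrow> bool" where
  "L1_cont_approx G \<longleftrightarrow> (\<forall>e>0. \<exists>h K. continuous_on UNIV h \<and> compact K \<and> (\<forall>x. x \<notin> K \<longrightarrow> h x = 0) \<and>
      (\<integral>x. \<bar>G x - h x\<bar> \<partial>lebesgue) < e)"

lemma compact_support_integrable_lebesgue:
  fixes h :: "real^'n::finite \<Rightarrow> real"
  assumes "continuous_on UNIV h" "compact K" "\<And>x. x \<notin> K \<Longrightarrow> h x = 0"
  shows "integrable lebesgue h"
  using compact_support_integrable [OF assms] assms(1)
  by (simp add: integrable_completion borel_measurable_continuous_onI)

text \<open>Dominated convergence and the triangle inequality. The bound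
  \<open>2 * \<bar>f x\<bar>\<close> has the shape that \<open>integrable_induct\<close> supplies in
  its limit case, so the same lemma serves there and for the exhaustion of a set of finite measure
  by balls.\<close>

lemma L1_cont_approx_limit:
  fixes f :: "real^'n::finite \<Rightarrow> real"
  assumes s: "\<And>i. integrable lebesgue (s i)" "\<And>i. L1_cont_approx (s i)"
    and lim: "\<And>x. (\<lambda>i. s i x) \<longlonglongrightarrow> f x" and bound: "\<And>i x. \<bar>s i x\<bar> \<le> 2 * \<bar>f x\<bar>"
    and f: "integrable lebesgue f"
  shows "L1_cont_approx f"
  unfolding L1_cont_approx_def
proof (intro allI impI)
  fix e :: real assume e: "0 < e"
  have "(\<lambda>i. \<integral>x. \<bar>f x - s i x\<bar> \<partial>lebesgue) \<longlonglongrightarrow> (\<integral>x. 0 \<partial>(lebesgue :: (real^'n) measure))"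
  proof (rule integral_dominated_convergence [where w = "\<lambda>x. 3 * \<bar>f x\<bar>"])
    show "AE x in lebesgue. (\<lambda>i. \<bar>f x - s i x\<bar>) \<longlonglongrightarrow> 0"
      using tendsto_rabs_zero [OF LIM_zero [OF lim]] by (simp add: abs_minus_commute)
    show "AE x in lebesgue. norm \<bar>f x - s i x\<bar> \<le> 3 * \<bar>f x\<bar>" for i
    proof (rule AE_I2)
      fix x show "norm \<bar>f x - s i x\<bar> \<le> 3 * \<bar>f x\<bar>" using bound [of i x] by simp
    qed
    show "(\<lambda>x. \<bar>f x - s i x\<bar>) \<in> borel_measurable lebesgue" for i
      using f s(1) [of i] by (intro borel_measurable_abs borel_measurable_diff) auto
  qed (use f s in auto)
  then obtain i where i: "(\<integral>x. \<bar>f x - s i x\<bar> \<partial>lebesgue) < e / 2"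
    using order_tendstoD(2) [where a = "e/2"] e by (fastforce simp: eventually_sequentially)
  obtain h K where h: "continuous_on UNIV h" "compact K" "\<And>x. x \<notin> K \<Longrightarrow> h x = 0"
      "(\<integral>x. \<bar>s i x - h x\<bar> \<partial>lebesgue) < e / 2"
    using s(2) [of i] e unfolding L1_cont_approx_def by (meson half_gt_zero)
  have hi: "integrable lebesgue h" by (rule compact_support_integrable_lebesgue [OF h(1-3)])
  have "(\<integral>x. \<bar>f x - h x\<bar> \<partial>lebesgue) \<le> (\<integral>x. \<bar>f x - s i x\<bar> + \<bar>s i x - h x\<bar> \<partial>lebesgue)"
    by (rule integral_mono) (use f s(1) [of i] hi in auto)
  also have "\<dots> = (\<integral>x. \<bar>f x - s i x\<bar> \<partial>lebesgue) + (\<integral>x. \<bar>s i x - h x\<bar> \<partial>lebesgue)"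
    by (rule Bochner_Integration.integral_add) (use f s(1) [of i] hi in auto)
  also have "\<dots> < e" using i h(4) by simp
  finally show "\<exists>h K. continuous_on UNIV h \<and> compact K \<and> (\<forall>x. x \<notin> K \<longrightarrow> h x = 0) \<and>
      (\<integral>x. \<bar>f x - h x\<bar> \<partial>lebesgue) < e"
    using h by blast
qed

text \<open>\<open>A\<close> is squeezed between a closed and an open set of almost the same
  measure. A Urysohn function for the two differs from the indicator only on the gap, and there by
  at most 1.\<close>

lemma L1_cont_approx_bounded_indicator:
  fixes A :: "(real^'n::finite) set" and c :: real
  assumes A: "A \<in> sets lebesgue" and R: "A \<subseteq> ball 0 R"
  shows "L1_cont_approx (\<lambda>x. indicator A x * c)"
  unfolding L1_cont_approx_def
proof (intro allI impI)
  fix e :: real assume e: "0 < e"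
  \<comment> \<open>Each of the two gaps has measure below \<open>d\<close>, so the error is at most
    \<open>\<bar>c\<bar> * (d + d)\<close>, which is below \<open>e\<close>; the summand 1 covers
    \<open>c = 0\<close>.\<close>
  define d where "d = e / (2 * (\<bar>c\<bar> + 1))"
  have d: "0 < d" using e by (simp add: d_def)
  obtain U where U: "open U" "A \<subseteq> U" "U - A \<in> lmeasurable" "emeasure lebesgue (U - A) < ennreal d"
    using sets_lebesgue_outer_open [OF A d] by metis
  obtain T where T: "closed T" "T \<subseteq> A" "A - T \<in> lmeasurable" "emeasure lebesgue (A - T) < ennreal d"
    using sets_lebesgue_inner_closed [OF A d] by metis
  define W where "W = U \<inter> ball 0 R"
  have W: "open W" "A \<subseteq> W" using U R by (auto simp: W_def)
  obtain f :: "real^'n \<Rightarrow> real" where f: "continuous_on UNIV f" "\<And>x. f x \<in> closed_segment 0 1"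
      "\<And>x. x \<in> - W \<Longrightarrow> f x = 0" "\<And>x. x \<in> T \<Longrightarrow> f x = 1"
  proof (rule Urysohn [of "- W" T "0::real" 1])
    show "closed (- W)" "closed T" "- W \<inter> T = {}" using W T by auto
  qed auto
  have f01: "0 \<le> f x" "f x \<le> 1" for x using f(2) [of x] by (auto simp: closed_segment_eq_real_ivl)
  define h where "h x = f x * c" for x
  have hc: "continuous_on UNIV h" unfolding h_def by (intro continuous_intros f)
  have h0: "h x = 0" if "x \<notin> cball 0 R" for x
    using that f(3) [of x] by (auto simp: h_def W_def)
  have hi: "integrable lebesgue h" by (rule compact_support_integrable_lebesgue [OF hc compact_cball h0])
  have lm: "U - A \<union> (A - T) \<in> lmeasurable" using U T by blast
  have Al: "A \<in> lmeasurable"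
    using A R lmeasurable_ball [of 0 R] by (metis fmeasurableI2)
  have "(\<integral>x. \<bar>indicator A x * c - h x\<bar> \<partial>lebesgue) \<le> (\<integral>x. \<bar>c\<bar> * indicator (U - A \<union> (A - T)) x \<partial>lebesgue)"
  proof (rule integral_mono)
    show "integrable lebesgue (\<lambda>x. \<bar>indicator A x * c - h x\<bar>)"
      using hi Al by (intro integrable_abs Bochner_Integration.integrable_diff)
        (auto simp: fmeasurable_def)
    show "integrable lebesgue (\<lambda>x. \<bar>c\<bar> * indicator (U - A \<union> (A - T)) x)"
      using lm by (auto simp: fmeasurable_def)
    fix x
    show "\<bar>indicator A x * c - h x\<bar> \<le> \<bar>c\<bar> * indicator (U - A \<union> (A - T)) x"
    proof (cases "x \<in> T \<or> x \<notin> W")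
      case True
      then have "indicator A x * c - h x = 0"
        using f(3,4) [of x] T(2) W(2) by (auto simp: h_def indicator_def)
      then show ?thesis by simp
    next
      case False
      then have x: "x \<in> U - A \<union> (A - T)" by (auto simp: W_def)
      have "\<bar>indicator A x * c - h x\<bar> = \<bar>indicator A x - f x\<bar> * \<bar>c\<bar>"
        by (simp add: h_def abs_mult flip: left_diff_distrib)
      also have "\<dots> \<le> 1 * \<bar>c\<bar>"
        using f01 [of x] by (intro mult_right_mono) (auto simp: indicator_def)
      finally show ?thesis using x by simp
    qed
  qed
  also have "\<dots> = \<bar>c\<bar> * measure lebesgue (U - A \<union> (A - T))" by simp
  also have "\<dots> \<le> \<bar>c\<bar> * (d + d)"
  proof (rule mult_left_mono)
    have "measure lebesgue (U - A \<union> (A - T)) \<le> measure lebesgue (U - A) + measure lebesgue (A - T)"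
      using U T by (intro measure_Un_le) (auto simp: fmeasurable_def)
    also have "\<dots> \<le> d + d"
      using U T d by (intro add_mono) (auto simp: emeasure_eq_measure2 ennreal_less_iff)
    finally show "measure lebesgue (U - A \<union> (A - T)) \<le> d + d" .
  qed simp
  also have "\<dots> < e"
    using e by (simp add: d_def divide_simps)
  finally show "\<exists>h K. continuous_on UNIV h \<and> compact K \<and> (\<forall>x. x \<notin> K \<longrightarrow> h x = 0) \<and>
      (\<integral>x. \<bar>indicator A x * c - h x\<bar> \<partial>lebesgue) < e"
    using hc h0 compact_cball by blast
qed

lemma L1_cont_approx_integrable:
  fixes G :: "real^'n::finite \<Rightarrow> real"
  assumes "integrable lebesgue G"
  shows "L1_cont_approx G"
  using assms
proof (induction rule: integrable_induct)
  case (base A c)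
  have Ai: "integrable lebesgue (\<lambda>x. indicator A x * c)" using base by auto
  have "L1_cont_approx (\<lambda>x. indicator A x * c)"
  proof (rule L1_cont_approx_limit [where s = "\<lambda>i x. indicator (A \<inter> ball 0 (real i)) x * c"])
    fix i
    have m: "A \<inter> ball 0 (real i) \<in> sets lebesgue" using base by auto
    then have "A \<inter> ball 0 (real i) \<in> lmeasurable"
      by (rule fmeasurableI2 [OF lmeasurable_ball Int_lower2])
    then show "integrable lebesgue (\<lambda>x. indicator (A \<inter> ball 0 (real i)) x * c)"
      by (auto simp: fmeasurable_def)
    show "L1_cont_approx (\<lambda>x. indicator (A \<inter> ball 0 (real i)) x * c)"
      by (rule L1_cont_approx_bounded_indicator [OF m]) auto
  next
    fix x :: "real^'n"
    obtain N where N: "norm x < real N" using reals_Archimedean2 by blast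
    show "(\<lambda>i. indicator (A \<inter> ball 0 (real i)) x * c) \<longlonglongrightarrow> indicator A x * c"
      by (rule tendsto_eventually) (use N in \<open>auto simp: eventually_sequentially indicator_def intro!: exI [of _ N]\<close>)
  qed (use Ai in \<open>auto simp: indicator_def\<close>)
  then show ?case by simp
next
  case (add f g)
  show ?case
    unfolding L1_cont_approx_def
  proof (intro allI impI)
    fix e :: real assume e: "0 < e"
    obtain h K where h: "continuous_on UNIV h" "compact K" "\<And>x. x \<notin> K \<Longrightarrow> h x = 0"
        "(\<integral>x. \<bar>f x - h x\<bar> \<partial>lebesgue) < e / 2"
      using add(3) e unfolding L1_cont_approx_def by (meson half_gt_zero)
    obtain k L where k: "continuous_on UNIV k" "compact L" "\<And>x. x \<notin> L \<Longrightarrow> k x = 0"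
        "(\<integral>x. \<bar>g x - k x\<bar> \<partial>lebesgue) < e / 2"
      using add(4) e unfolding L1_cont_approx_def by (meson half_gt_zero)
    have hi: "integrable lebesgue h" "integrable lebesgue k"
      using compact_support_integrable_lebesgue [OF h(1-3)] compact_support_integrable_lebesgue [OF k(1-3)] by auto
    have "(\<integral>x. \<bar>f x + g x - (h x + k x)\<bar> \<partial>lebesgue) \<le> (\<integral>x. \<bar>f x - h x\<bar> + \<bar>g x - k x\<bar> \<partial>lebesgue)"
      by (rule integral_mono) (use add hi in auto)
    also have "\<dots> = (\<integral>x. \<bar>f x - h x\<bar> \<partial>lebesgue) + (\<integral>x. \<bar>g x - k x\<bar> \<partial>lebesgue)"
      by (rule Bochner_Integration.integral_add) (use add hi in auto)
    also have "\<dots> < e" using k h(4) by simp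
    finally have "(\<integral>x. \<bar>f x + g x - (h x + k x)\<bar> \<partial>lebesgue) < e" .
    moreover have "continuous_on UNIV (\<lambda>x. h x + k x)" by (intro continuous_intros h k)
    moreover have "x \<notin> K \<union> L \<Longrightarrow> h x + k x = 0" for x using h k by auto
    ultimately show "\<exists>h K. continuous_on UNIV h \<and> compact K \<and> (\<forall>x. x \<notin> K \<longrightarrow> h x = 0) \<and>
        (\<integral>x. \<bar>f x + g x - h x\<bar> \<partial>lebesgue) < e"
      using compact_Un [OF h(2) k(2)] by blast
  qed
next
  case (lim f s)
  show ?case
    by (rule L1_cont_approx_limit [of s]) (use lim in auto)
qed

lemma mollify_diff:
  fixes F G :: "real^'n::finite \<Rightarrow> real"
  assumes "integrable lebesgue F" "integrable lebesgue G" "0 < r"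
  shows "mollify r (\<lambda>x. F x - G x) x = mollify r F x - mollify r G x"
  unfolding mollify_def
  using mollify_integrable [OF assms(1,3), of x] mollify_integrable [OF assms(2,3), of x]
  by (simp add: right_diff_distrib)

lemma mollify_L1_uniform:
  fixes h :: "real^'n::finite \<Rightarrow> real"
  assumes h: "continuous_on UNIV h" and K: "compact K" "\<And>x. x \<notin> K \<Longrightarrow> h x = 0" and e: "0 < e"
  shows "\<exists>d>0. \<forall>r. 0 < r \<and> r < d \<longrightarrow>
      (\<integral>\<^sup>+x. ennreal \<bar>mollify r h x - h x\<bar> \<partial>lebesgue) < ennreal e"
proof -
  \<comment> \<open>For radii below 1 both \<open>h\<close> and its mollification vanish off
    \<open>K1\<close>, and the averages at points of \<open>K1\<close> see only points of
    \<open>K2\<close>.\<close>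
  define K1 where "K1 = (\<Union>x\<in>K. cball x 1)"
  define K2 where "K2 = (\<Union>x\<in>K. cball x 2)"
  have cK: "compact K1" "compact K2" unfolding K1_def K2_def by (intro compact_minkowski_sum_cball K)+
  have hi: "integrable lebesgue h" by (rule compact_support_integrable_lebesgue [OF h K])
  define m where "m = measure lebesgue K1"
  have K1l: "K1 \<in> lmeasurable" using cK lmeasurable_compact by blast
  define w where "w = e / (2 * (m + 1))"
  have m: "0 \<le> m" by (simp add: m_def)
  have w: "0 < w" using e m by (simp add: w_def)
  have "uniformly_continuous_on K2 h"
    using cK h by (intro compact_uniformly_continuous) (auto intro: continuous_on_subset)
  then obtain d where d: "0 < d" "\<And>x y. x \<in> K2 \<Longrightarrow> y \<in> K2 \<Longrightarrow> dist y x < d \<Longrightarrow> dist (h y) (h x) < w"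
    unfolding uniformly_continuous_on_def using w by metis
  show ?thesis
  proof (intro exI [of _ "min d 1"] conjI allI impI)
    fix r assume r: "0 < r \<and> r < min d 1"
    have near: "\<bar>mollify r h x - h x\<bar> \<le> w * indicator K1 x" for x
    proof (cases "x \<in> K1")
      case True
      then obtain z where z: "z \<in> K" "dist z x \<le> 1" by (auto simp: K1_def)
      have "x \<in> K2" using z by (force simp: K2_def)
      have "\<bar>h y - h x\<bar> \<le> w" if "y \<in> ball x r" for y
      proof -
        have "dist z y \<le> 2" using dist_triangle [of z y x] z that r by auto
        then have "y \<in> K2" using z by (auto simp: K2_def)
        with d(2) [of x y] \<open>x \<in> K2\<close> that r show ?thesis by (auto simp: dist_norm norm_minus_commute)
      qed
      then have "\<bar>mollify r h x - h x\<bar> \<le> w"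
        by (intro mollify_near [OF hi]) (use r in auto)
      then show ?thesis using True by simp
    next
      case False
      have "h y = 0" if "y \<in> ball x r" for y
      proof (rule K(2))
        show "y \<notin> K"
        proof
          assume "y \<in> K"
          then have "x \<in> K1" using that r by (auto simp: K1_def dist_commute intro!: bexI [of _ y])
          then show False using False by simp
        qed
      qed
      then have "\<bar>mollify r h x - 0\<bar> \<le> 0"
        by (intro mollify_near [OF hi]) (use r in auto)
      moreover have "h x = 0" using False K(2) [of x] by (force simp: K1_def)
      ultimately show ?thesis using w by simp
    qed
    have "(\<integral>\<^sup>+x. ennreal \<bar>mollify r h x - h x\<bar> \<partial>lebesgue) \<le> (\<integral>\<^sup>+x. ennreal w * indicator K1 x \<partial>lebesgue)"
    proof (rule nn_integral_mono)
      fix x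
      have "ennreal \<bar>mollify r h x - h x\<bar> \<le> ennreal (w * indicator K1 x)"
        by (rule ennreal_leI [OF near])
      also have "\<dots> = ennreal w * indicator K1 x" by (simp add: indicator_def)
      finally show "ennreal \<bar>mollify r h x - h x\<bar> \<le> ennreal w * indicator K1 x" .
    qed
    also have "\<dots> = ennreal w * emeasure lebesgue K1"
      using K1l by (intro nn_integral_cmult_indicator) (auto simp: fmeasurable_def)
    also have "\<dots> = ennreal (w * m)"
      using K1l w m by (simp add: m_def emeasure_eq_measure2 ennreal_mult)
    also have "\<dots> < ennreal e"
    proof (rule ennreal_lessI [OF e])
      have "e * m < e * (2 * (m + 1))" using e m by (intro mult_strict_left_mono) auto
      then show "w * m < e" using m by (simp add: w_def divide_simps)
    qed
    finally show "(\<integral>\<^sup>+x. ennreal \<bar>mollify r h x - h x\<bar> \<partial>lebesgue) < ennreal e" .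
  qed (use d in auto)
qed

text \<open>Mollification is linear and does not increase the L1 norm, so passing from
  \<open>G\<close> to a continuous \<open>h\<close> costs the approximation error twice; the third
  share of \<open>e\<close> is the error for \<open>h\<close>.\<close>

proposition mollify_L1_convergence:
  fixes G :: "real^'n::finite \<Rightarrow> real"
  assumes G: "integrable lebesgue G" and e: "0 < e"
  shows "\<exists>d>0. \<forall>r. 0 < r \<and> r < d \<longrightarrow>
      (\<integral>\<^sup>+x. ennreal \<bar>mollify r G x - G x\<bar> \<partial>lebesgue) < ennreal e"
proof -
  obtain h K where h: "continuous_on UNIV h" "compact K" "\<And>x. x \<notin> K \<Longrightarrow> h x = 0"
      "(\<integral>x. \<bar>G x - h x\<bar> \<partial>lebesgue) < e / 3"
    using L1_cont_approx_integrable [OF G] e unfolding L1_cont_approx_def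
    by (metis divide_pos_pos zero_less_numeral)
  have hi: "integrable lebesgue h" by (rule compact_support_integrable_lebesgue [OF h(1-3)])
  have Gh: "(\<integral>\<^sup>+x. ennreal \<bar>G x - h x\<bar> \<partial>lebesgue) < ennreal (e / 3)"
    using G hi h(4) e by (subst nn_integral_eq_integral) (auto intro!: ennreal_lessI)
  obtain d where d: "0 < d" "\<And>r. 0 < r \<Longrightarrow> r < d \<Longrightarrow>
      (\<integral>\<^sup>+x. ennreal \<bar>mollify r h x - h x\<bar> \<partial>lebesgue) < ennreal (e / 3)"
    using mollify_L1_uniform [OF h(1-3), of "e / 3"] e by auto
  have "(\<integral>\<^sup>+x. ennreal \<bar>mollify r G x - G x\<bar> \<partial>lebesgue) < ennreal e" if r: "0 < r" "r < d" for r
  proof -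
    have [measurable]: "G \<in> borel_measurable lebesgue" "h \<in> borel_measurable lebesgue"
      "mollify r h \<in> borel_measurable lebesgue" "mollify r G \<in> borel_measurable lebesgue"
      using G hi by (auto intro!: continuous_borel_measurable_lebesgue continuous_mollify r)
    have "(\<integral>\<^sup>+x. ennreal \<bar>mollify r G x - G x\<bar> \<partial>lebesgue) \<le>
        (\<integral>\<^sup>+x. ennreal \<bar>mollify r (\<lambda>x. G x - h x) x\<bar> + (ennreal \<bar>mollify r h x - h x\<bar> + ennreal \<bar>G x - h x\<bar>) \<partial>lebesgue)"
      by (intro nn_integral_mono) (simp add: mollify_diff [OF G hi r(1)] flip: ennreal_plus)
    also have "\<dots> = (\<integral>\<^sup>+x. ennreal \<bar>mollify r (\<lambda>x. G x - h x) x\<bar> \<partial>lebesgue) +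
        ((\<integral>\<^sup>+x. ennreal \<bar>mollify r h x - h x\<bar> \<partial>lebesgue) + (\<integral>\<^sup>+x. ennreal \<bar>G x - h x\<bar> \<partial>lebesgue))"
      by (subst nn_integral_add; (subst nn_integral_add)?) (auto simp: mollify_diff [OF G hi r(1)])
    also have "\<dots> \<le> (\<integral>\<^sup>+x. ennreal \<bar>G x - h x\<bar> \<partial>lebesgue) +
        ((\<integral>\<^sup>+x. ennreal \<bar>mollify r h x - h x\<bar> \<partial>lebesgue) + (\<integral>\<^sup>+x. ennreal \<bar>G x - h x\<bar> \<partial>lebesgue))"
      by (intro add_right_mono nn_integral_mollify_le r) (use G hi in auto)
    also have "\<dots> < ennreal (e / 3) + (ennreal (e / 3) + ennreal (e / 3))"
      by (intro add_strict_mono Gh d r)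
    also have "\<dots> = ennreal e"
      using e by (simp flip: ennreal_plus)
    finally show ?thesis .
  qed
  with d show ?thesis by blast
qed

section \<open>Weak gradients and their mollifications\<close>

lemma partial_reflect:
  fixes k :: "real^'n::finite \<Rightarrow> real"
  assumes "k differentiable (at (x - y))"
  shows "partial i (\<lambda>y. k (x - y)) y = - partial i k (x - y)"
proof -
  have "((\<lambda>y. x - y) has_derivative (\<lambda>h. - h)) (at y)"
    by (auto intro!: derivative_eq_intros)
  from partial_eqI [OF has_derivative_compose [OF this has_derivative_grad [OF assms]]]
  show ?thesis by (simp add: inner_axis' grad_def)
qed

lemma closure_support_subset:
  "closed K \<Longrightarrow> (\<And>x. x \<notin> K \<Longrightarrow> f x = 0) \<Longrightarrow> closure {x. f x \<noteq> 0} \<subseteq> K"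
  by (rule closure_minimal) auto

lemma test_fun_mollifier:
  assumes "0 < r" "cball x r \<subseteq> U"
  shows "test_fun U (\<lambda>y. mollifier r (x - y))"
proof -
  have "closure {y. mollifier r (x - y) \<noteq> 0} \<subseteq> cball x r"
    using assms by (intro closure_support_subset) (auto intro!: mollifier_eq_0 simp: dist_norm)
  moreover from this have "compact (closure {y. mollifier r (x - y) \<noteq> 0})"
    by (meson bounded_cball bounded_closure bounded_subset closed_closure closure_subset compact_eq_bounded_closed)
  ultimately show ?thesis
    unfolding test_fun_def using smooth_mollifier_translate assms by auto
qed

lemma loc_integrable_compact:
  "loc_integrable U f \<Longrightarrow> compact K \<Longrightarrow> K \<subseteq> U \<Longrightarrow> integrable lebesgue (\<lambda>x. indicator K x * f x)"
  by (auto simp: loc_integrable_def set_integrable_def)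

text \<open>The reflected kernel centred at \<open>x\<close> is a test function, and the definition
  of the weak gradient moves the derivative from the kernel to \<open>g\<close>. Since
  \<open>K\<close> contains the ball over which the average at \<open>x\<close> is taken, cutting
  off to \<open>K\<close> changes nothing there.\<close>

lemma weak_grad_mollify:
  fixes f :: "real^'n::finite \<Rightarrow> real"
  assumes wg: "is_weak_grad U f g" and K: "compact K" "K \<subseteq> U" and r: "0 < r" and x: "cball x r \<subseteq> K"
  shows "(mollify r (\<lambda>y. indicator K y * f y) has_derivative
     (\<lambda>h. h \<bullet> (\<chi> i. mollify r (\<lambda>y. indicator K y * g y $ i) x))) (at x)"
proof -
  let ?\<psi> = "\<lambda>y. mollifier r (x - y)"
  have fi: "integrable lebesgue (\<lambda>y. indicator K y * f y)"
    using wg K by (intro loc_integrable_compact) (auto simp: is_weak_grad_def)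
  have "(\<integral>y. partial i (mollifier r) (x - y) * (indicator K y * f y) \<partial>lebesgue)
      = mollify r (\<lambda>y. indicator K y * g y $ i) x" for i
  proof -
    have "cball x r \<subseteq> U" using x K by blast
    have "test_fun U ?\<psi>" using test_fun_mollifier [OF r] x K by blast
    then have *: "(LINT y:U|lebesgue. f y * partial i ?\<psi> y) = - (LINT y:U|lebesgue. g y $ i * ?\<psi> y)"
      using wg by (auto simp: is_weak_grad_def)
    \<comment> \<open>The sign from the reflection cancels the sign in the definition of the weak
      gradient.\<close>
    have p: "partial i ?\<psi> y = - partial i (mollifier r) (x - y)" for y
      by (rule partial_reflect) (rule smooth_fun_differentiable [OF smooth_mollifier])
    have "indicator U y *\<^sub>R (f y * partial i ?\<psi> y) =
        - (partial i (mollifier r) (x - y) * (indicator K y * f y))" for y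
    proof (cases "y \<in> cball x r")
      case True
      then have "y \<in> K" "y \<in> U" using x K by auto
      then show ?thesis by (simp add: p)
    next
      case False
      then have "partial i (mollifier r) (x - y) = 0"
        using r by (intro partial_mollifier_outside_cball) (auto simp: dist_norm norm_minus_commute)
      then show ?thesis by (simp add: p)
    qed
    then have l: "(LINT y:U|lebesgue. f y * partial i ?\<psi> y) =
        - (\<integral>y. partial i (mollifier r) (x - y) * (indicator K y * f y) \<partial>lebesgue)"
      unfolding set_lebesgue_integral_def by simp
    have "indicator U y *\<^sub>R (g y $ i * ?\<psi> y) = ?\<psi> y * (indicator K y * g y $ i)" for y
    proof (cases "y \<in> cball x r")
      case True
      then have "y \<in> K" "y \<in> U" using x K by auto
      then show ?thesis by simp
    next
      case False
      then have "?\<psi> y = 0"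
        using r by (intro mollifier_outside_cball) (auto simp: dist_norm norm_minus_commute)
      then show ?thesis by simp
    qed
    then have "(LINT y:U|lebesgue. g y $ i * ?\<psi> y) = mollify r (\<lambda>y. indicator K y * g y $ i) x"
      unfolding set_lebesgue_integral_def mollify_def by (simp only:)
    with l * show ?thesis by simp
  qed
  then show ?thesis using mollify_has_derivative [OF fi r, of x] by simp
qed

text \<open>This is the only form in which mollification is used for limits later on. Continuity of
  \<open>f\<close> is what turns L1 convergence of the functions into uniform convergence on
  \<open>K\<close>; the gradients converge only in L1. The last clause is quantified over
  \<open>M\<close> so that an essential bound of the gradient, where there is one, becomes a bound
  at every point of \<open>W\<close>.\<close>

lemma weak_grad_C1_approx:
  fixes f :: "real^'n::finite \<Rightarrow> real"
  assumes U: "open U" and wg: "is_weak_grad U f g" and f: "continuous_on U f"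
    and K: "compact K" "K \<subseteq> U"
  obtains W v G where "open W" "K \<subseteq> W" "W \<subseteq> U"
    "\<And>k x. x \<in> W \<Longrightarrow> (v k has_derivative (\<lambda>h. h \<bullet> G k x)) (at x)"
    "\<And>k. continuous_on UNIV (G k)"
    "uniform_limit K v f sequentially"
    "\<And>i. (\<lambda>k::nat. \<integral>\<^sup>+x\<in>K. ennreal \<bar>G k x $ i - g x $ i\<bar> \<partial>lebesgue) \<longlonglongrightarrow> 0"
    "\<And>M k x i. (AE y in lebesgue. y \<in> U \<longrightarrow> norm (g y) \<le> M) \<Longrightarrow> x \<in> W \<Longrightarrow> \<bar>G k x $ i\<bar> \<le> M"
proof -
  obtain e where e: "0 < e" "(\<Union>x\<in>K. cball x e) \<subseteq> U"
    using compact_subset_open_imp_cball_epsilon_subset [OF K(1) U K(2)] by metis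
  define K' where "K' = (\<Union>x\<in>K. cball x e)"
  have K': "compact K'" "K' \<subseteq> U" unfolding K'_def using K e by (auto intro: compact_minkowski_sum_cball)
  have KK': "K \<subseteq> K'" using e by (force simp: K'_def)
  \<comment> \<open>Points of \<open>W\<close> are within \<open>e / 2\<close> of \<open>K\<close>
    and all radii \<open>r k\<close> are at most \<open>e / 2\<close>, so the averages stay inside
    \<open>K'\<close>.\<close>
  define W where "W = (\<Union>x\<in>K. ball x (e / 2))"
  define r where "r k = e / (2 * (real k + 1))" for k
  have r: "0 < r k" "r k \<le> e / 2" for k using e by (auto simp: r_def divide_simps)
  have rlim: "r \<longlonglongrightarrow> 0"
  proof -
    have "(\<lambda>k. (e / 2) * inverse (real (Suc k))) \<longlonglongrightarrow> (e / 2) * 0"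
      by (intro tendsto_intros LIMSEQ_inverse_real_of_nat)
    moreover have "r = (\<lambda>k. (e / 2) * inverse (real (Suc k)))"
      by (auto simp: r_def fun_eq_iff divide_simps)
    ultimately show ?thesis by simp
  qed
  have W: "cball x (r k) \<subseteq> K'" if "x \<in> W" for x k
  proof
    fix y assume "y \<in> cball x (r k)"
    then have xy: "dist x y \<le> e / 2" using r(2) [of k] by auto
    from that obtain z where z: "z \<in> K" "dist z x < e / 2" by (auto simp: W_def)
    have "dist z y \<le> e" using dist_triangle [of z y x] xy z by linarith
    then show "y \<in> K'" using z by (auto simp: K'_def)
  qed
  have KW: "K \<subseteq> W" using e by (force simp: W_def)
  define F where "F = (\<lambda>y. indicator K' y * f y)"
  define H where "H i = (\<lambda>y. indicator K' y * g y $ i)" for i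
  have Fi: "integrable lebesgue F" and Hi: "integrable lebesgue (H i)" for i
    unfolding F_def H_def using wg K' by (auto intro!: loc_integrable_compact simp: is_weak_grad_def)
  show thesis
  proof (rule that [of W "\<lambda>k. mollify (r k) F" "\<lambda>k x. \<chi> i. mollify (r k) (H i) x"])
    show "open W" by (auto simp: W_def)
    show "K \<subseteq> W" by (rule KW)
    show "W \<subseteq> U"
    proof
      fix x assume "x \<in> W"
      then have "x \<in> K'" using W [of x 0] r(1) [of 0] by (auto simp: subset_iff)
      then show "x \<in> U" using K' by blast
    qed
    show "(mollify (r k) F has_derivative (\<lambda>h. h \<bullet> (\<chi> i. mollify (r k) (H i) x))) (at x)"
      if "x \<in> W" for k x
      unfolding F_def H_def by (rule weak_grad_mollify [OF wg K' r(1) W [OF that]])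
    show "continuous_on UNIV (\<lambda>x. \<chi> i. mollify (r k) (H i) x)" for k
      by (intro continuous_on_vec_lambda continuous_mollify Hi r)
    show "uniform_limit K (\<lambda>k. mollify (r k) F) f sequentially"
    proof (rule uniform_limitI)
      fix d :: real assume d: "0 < d"
      have "uniformly_continuous_on K' f"
        using K' f by (intro compact_uniformly_continuous) (auto intro: continuous_on_subset)
      then obtain b where b: "0 < b" "\<And>x y. x \<in> K' \<Longrightarrow> y \<in> K' \<Longrightarrow> dist y x < b \<Longrightarrow> dist (f y) (f x) < d / 2"
        unfolding uniformly_continuous_on_def using d by (meson half_gt_zero)
      have "\<forall>\<^sub>F k in sequentially. r k < b" by (rule order_tendstoD(2) [OF rlim b(1)])
      then show "\<forall>\<^sub>F k in sequentially. \<forall>x\<in>K. dist (mollify (r k) F x) (f x) < d"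
      proof eventually_elim
        case (elim k)
        show ?case
        proof
          fix x assume x: "x \<in> K"
          have "\<bar>mollify (r k) F x - f x\<bar> \<le> d / 2"
          proof (rule mollify_near [OF Fi r(1)], intro AE_I2 impI)
            fix y assume y: "y \<in> ball x (r k)"
            then have "y \<in> K'" using W [of x k] KW x by (auto simp: subset_iff)
            then show "\<bar>F y - f x\<bar> \<le> d / 2"
              using b(2) [of x y] x KK' elim y by (auto simp: F_def dist_norm norm_minus_commute subset_iff)
          qed
          then show "dist (mollify (r k) F x) (f x) < d" using d by (simp add: dist_norm)
        qed
      qed
    qed
    show "(\<lambda>k. \<integral>\<^sup>+x\<in>K. ennreal \<bar>(\<chi> i. mollify (r k) (H i) x) $ i - g x $ i\<bar> \<partial>lebesgue) \<longlonglongrightarrow> 0" for i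
    proof (rule tendsto_sandwich [OF _ _ tendsto_const])
      show "(\<lambda>k. \<integral>\<^sup>+x. ennreal \<bar>mollify (r k) (H i) x - H i x\<bar> \<partial>lebesgue) \<longlonglongrightarrow> 0"
      proof (rule order_tendstoI)
        fix a :: ennreal assume "0 < a"
        then obtain b where b: "0 < b" "b < a" using dense by blast
        then have "b < top" using less_le_trans [OF b(2) top_greatest] by simp
        then obtain a' where a'': "b = ennreal a'" "0 \<le> a'" by (cases b) auto
        then have a': "0 < a'" "ennreal a' < a" using b by auto
        obtain d where d: "0 < d" "\<And>s. 0 < s \<Longrightarrow> s < d \<Longrightarrow>
            (\<integral>\<^sup>+x. ennreal \<bar>mollify s (H i) x - H i x\<bar> \<partial>lebesgue) < ennreal a'"
          using mollify_L1_convergence [OF Hi a'(1)] by metis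
        have "\<forall>\<^sub>F k in sequentially. r k < d" by (rule order_tendstoD(2) [OF rlim d(1)])
        then show "\<forall>\<^sub>F k in sequentially. (\<integral>\<^sup>+x. ennreal \<bar>mollify (r k) (H i) x - H i x\<bar> \<partial>lebesgue) < a"
          by eventually_elim (use d(2) r a' in \<open>meson less_trans\<close>)
      qed auto
      show "\<forall>\<^sub>F k in sequentially. (\<integral>\<^sup>+x\<in>K. ennreal \<bar>(\<chi> i. mollify (r k) (H i) x) $ i - g x $ i\<bar> \<partial>lebesgue)
          \<le> (\<integral>\<^sup>+x. ennreal \<bar>mollify (r k) (H i) x - H i x\<bar> \<partial>lebesgue)"
        by (intro always_eventually allI nn_integral_mono) (use KK' in \<open>auto simp: H_def indicator_def\<close>)
    qed auto
    show "\<bar>(\<chi> i. mollify (r k) (H i) x) $ i\<bar> \<le> M"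
      if "AE y in lebesgue. y \<in> U \<longrightarrow> norm (g y) \<le> M" "x \<in> W" for M k x i
    proof -
      have "AE y in lebesgue. y \<in> ball x (r k) \<longrightarrow> \<bar>H i y - 0\<bar> \<le> M"
        using that(1)
      proof eventually_elim
        case (elim y)
        show ?case
        proof
          assume "y \<in> ball x (r k)"
          then have y: "y \<in> K'" "y \<in> U" using W [OF that(2), of k] K' by (auto simp: subset_iff)
          then show "\<bar>H i y - 0\<bar> \<le> M"
            using elim component_le_norm_cart [of "g y" i] by (simp add: H_def)
        qed
      qed
      from mollify_near [OF Hi r(1) this] show ?thesis by simp
    qed
  qed
qed

lemma open_AE_from_compacts:
  fixes U :: "(real^'n::finite) set"
  assumes "open U" "\<And>K. compact K \<Longrightarrow> K \<subseteq> U \<Longrightarrow> AE x in lebesgue. x \<in> K \<longrightarrow> P x"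
  shows "AE x in lebesgue. x \<in> U \<longrightarrow> P x"
proof -
  obtain C :: "nat \<Rightarrow> (real^'n) set" where C: "\<And>n. compact (C n)" "\<And>n. C n \<subseteq> U" "\<Union>(range C) = U"
    using open_Union_compact_subsets [OF assms(1)] by metis
  have "AE x in lebesgue. \<forall>n. x \<in> C n \<longrightarrow> P x"
    unfolding AE_all_countable using assms(2) C by blast
  then show ?thesis by eventually_elim (use C(3) in blast)
qed

text \<open>Near \<open>K\<close> both candidates, once mollified, are the derivative of the same
  smooth function. Their difference thus has vanishing mollifications on \<open>K\<close>, while
  these converge to it in L1.\<close>

lemma weak_grad_unique:
  fixes f :: "real^'n::finite \<Rightarrow> real"
  assumes U: "open U" and wg: "is_weak_grad U f g1" "is_weak_grad U f g2"
  shows "AE x in lebesgue. x \<in> U \<longrightarrow> g1 x = g2 x"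
proof (rule open_AE_from_compacts [OF U])
  fix K :: "(real^'n) set" assume K: "compact K" "K \<subseteq> U"
  obtain e where e: "0 < e" "(\<Union>x\<in>K. cball x e) \<subseteq> U"
    using compact_subset_open_imp_cball_epsilon_subset [OF K(1) U K(2)] by metis
  define K' where "K' = (\<Union>x\<in>K. cball x e)"
  have K': "compact K'" "K' \<subseteq> U" unfolding K'_def using K e by (auto intro: compact_minkowski_sum_cball)
  have KK': "K \<subseteq> K'" using e by (force simp: K'_def)
  have "AE x in lebesgue. x \<in> K \<longrightarrow> g1 x $ i = g2 x $ i" for i
  proof -
    define H1 where "H1 = (\<lambda>y. indicator K' y * g1 y $ i)"
    define H2 where "H2 = (\<lambda>y. indicator K' y * g2 y $ i)"
    have Hi: "integrable lebesgue H1" "integrable lebesgue H2"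
      unfolding H1_def H2_def using wg K' by (auto intro!: loc_integrable_compact simp: is_weak_grad_def)
    define H where "H = (\<lambda>y. H1 y - H2 y)"
    have H: "integrable lebesgue H" unfolding H_def using Hi by (rule Bochner_Integration.integrable_diff)
    have zero: "mollify r H x = 0" if "x \<in> K" "0 < r" "r < e" for x r
    proof -
      have c: "cball x r \<subseteq> K'" using that by (auto simp: K'_def intro!: bexI [of _ x])
      have "(\<lambda>h. h \<bullet> (\<chi> i. mollify r (\<lambda>y. indicator K' y * g1 y $ i) x)) =
          (\<lambda>h. h \<bullet> (\<chi> i. mollify r (\<lambda>y. indicator K' y * g2 y $ i) x))"
        by (rule has_derivative_unique [OF weak_grad_mollify [OF wg(1) K' that(2) c]
              weak_grad_mollify [OF wg(2) K' that(2) c]])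
      then have "axis i 1 \<bullet> (\<chi> i. mollify r (\<lambda>y. indicator K' y * g1 y $ i) x) =
          axis i 1 \<bullet> (\<chi> i. mollify r (\<lambda>y. indicator K' y * g2 y $ i) x)"
        by (rule fun_cong)
      then have "mollify r H1 x = mollify r H2 x" by (simp add: inner_axis' H1_def H2_def)
      then show ?thesis unfolding H_def using mollify_diff [OF Hi that(2)] by simp
    qed
    have small: "(\<integral>\<^sup>+x\<in>K. ennreal \<bar>H x\<bar> \<partial>lebesgue) \<le> ennreal d" if d: "0 < d" for d
    proof -
      obtain b where b: "0 < b" "\<And>s. 0 < s \<Longrightarrow> s < b \<Longrightarrow>
          (\<integral>\<^sup>+x. ennreal \<bar>mollify s H x - H x\<bar> \<partial>lebesgue) < ennreal d"
        using mollify_L1_convergence [OF H d] by metis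
      define s where "s = min b e / 2"
      have s: "0 < s" "s < b" "s < e" using b e by (auto simp: s_def)
      have "(\<integral>\<^sup>+x\<in>K. ennreal \<bar>H x\<bar> \<partial>lebesgue) \<le> (\<integral>\<^sup>+x. ennreal \<bar>mollify s H x - H x\<bar> \<partial>lebesgue)"
        by (intro nn_integral_mono) (use zero [OF _ s(1,3)] in \<open>auto simp: indicator_def\<close>)
      also have "\<dots> \<le> ennreal d" using b(2) [OF s(1,2)] by (rule less_imp_le)
      finally show ?thesis .
    qed
    have "(\<integral>\<^sup>+x\<in>K. ennreal \<bar>H x\<bar> \<partial>lebesgue) \<le> 0"
      by (rule ennreal_le_epsilon, subst add_0) (rule small)
    then have z: "(\<integral>\<^sup>+x\<in>K. ennreal \<bar>H x\<bar> \<partial>lebesgue) = 0" by simp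
    have Ks: "K \<in> sets lebesgue" using K lmeasurable_compact by blast
    have "(\<lambda>x. ennreal \<bar>H x\<bar> * indicator K x) \<in> borel_measurable lebesgue"
      using H Ks by measurable
    from z [unfolded nn_integral_0_iff_AE [OF this]]
    have "AE x in lebesgue. ennreal \<bar>H x\<bar> * indicator K x = 0" .
    then show ?thesis
    proof eventually_elim
      case (elim x)
      then show ?case using KK' by (auto simp: H_def H1_def H2_def indicator_def split: if_splits)
    qed
  qed
  then have "AE x in lebesgue. \<forall>i. x \<in> K \<longrightarrow> g1 x $ i = g2 x $ i"
    unfolding AE_all_countable by blast
  then show "AE x in lebesgue. x \<in> K \<longrightarrow> g1 x = g2 x"
    by eventually_elim (auto simp: vec_eq_iff)
qed

section \<open>Integration by parts and the chain rule\<close>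

lemma has_derivative_inner_imp_directional:
  fixes F :: "real^'n::finite \<Rightarrow> real"
  assumes "(F has_derivative (\<lambda>h. h \<bullet> g)) (at x)"
  shows "(\<lambda>k. real (Suc k) * (F (x + inverse (real (Suc k)) *\<^sub>R axis i 1) - F x)) \<longlonglongrightarrow> g $ i"
proof -
  let ?e = "axis i (1::real) :: real^'n"
  have "((\<lambda>t. x + t *\<^sub>R ?e) has_derivative (\<lambda>t. t *\<^sub>R ?e)) (at 0)"
    by (auto intro!: derivative_eq_intros)
  from has_derivative_compose [OF this, of F "\<lambda>h. h \<bullet> g"] assms
  have "((\<lambda>t. F (x + t *\<^sub>R ?e)) has_derivative (\<lambda>t. (t *\<^sub>R ?e) \<bullet> g)) (at 0)"
    by simp
  moreover have "(\<lambda>t. (t *\<^sub>R ?e) \<bullet> g) = (*) (g $ i)"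
    by (simp add: inner_axis' fun_eq_iff)
  ultimately have "((\<lambda>t. F (x + t *\<^sub>R ?e)) has_real_derivative g $ i) (at 0)"
    unfolding has_field_derivative_def by (simp only:)
  then have *: "((\<lambda>t. (F (x + t *\<^sub>R ?e) - F x) / t) \<longlongrightarrow> g $ i) (at 0)"
    by (simp add: DERIV_def)
  have "filterlim (\<lambda>k. inverse (real (Suc k))) (at 0) sequentially"
    unfolding filterlim_at using LIMSEQ_inverse_real_of_nat by auto
  from filterlim_compose [OF * this] show ?thesis
    by (simp add: divide_inverse mult.commute)
qed

text \<open>By translation invariance every difference quotient of \<open>F\<close> has integral 0.
  The quotients converge to the partial derivative and are dominated through the Lipschitz constant
  of \<open>F\<close>.\<close>

lemma integral_partial_eq_0:
  fixes F :: "real^'n::finite \<Rightarrow> real"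
  assumes d: "\<And>x. (F has_derivative (\<lambda>h. h \<bullet> F' x)) (at x)" and c: "continuous_on UNIV F'"
    and K: "compact K" "\<And>x. x \<notin> K \<Longrightarrow> F x = 0"
  shows "(\<integral>x. F' x $ i \<partial>lborel) = 0"
proof -
  have F': "F' x = grad F x" for x
    using partial_has_derivative_inner [OF d] by (simp add: grad_def vec_eq_iff)
  have Fd: "F differentiable (at x)" for x using d differentiable_def by blast
  have cF: "continuous_on UNIV F"
    by (meson Fd continuous_at_imp_continuous_on differentiable_imp_continuous_within)
  have z: "x \<notin> K \<Longrightarrow> F' x = 0" for x
    using partial_eq_0_outside [OF K(2) compact_imp_closed [OF K(1)]]
    by (simp add: F' grad_def vec_eq_iff)
  obtain B where B: "0 \<le> B" "\<And>x. norm (F' x) \<le> B"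
    using compact_support_bounded [OF c K(1) z] by metis
  have lip: "\<bar>F x - F y\<bar> \<le> B * norm (x - y)" for x y
    by (rule bounded_grad_imp_lipschitz [OF Fd]) (use B F' in auto)
  \<comment> \<open>The increments have length at most 1, so all quotients vanish off this compact
    set and the dominating function is integrable.\<close>
  define K1 where "K1 = (\<Union>x\<in>K. cball x 1)"
  have cK1: "compact K1" unfolding K1_def by (intro compact_minkowski_sum_cball K)
  have Fi: "integrable lborel F" by (rule compact_support_integrable [OF cF K])
  define q where "q k x = real (Suc k) * (F (x + inverse (real (Suc k)) *\<^sub>R axis i 1) - F x)" for k x
  have meas: "F \<in> borel_measurable borel" by (rule borel_measurable_continuous_onI [OF cF])
  have "(\<lambda>k. \<integral>x. q k x \<partial>lborel) \<longlonglongrightarrow> (\<integral>x. F' x $ i \<partial>lborel)"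
  proof (rule integral_dominated_convergence [where w = "\<lambda>x. indicator K1 x *\<^sub>R B"])
    show "integrable lborel (\<lambda>x. indicator K1 x *\<^sub>R B)"
      by (rule borel_integrable_compact [OF cK1]) auto
    show "AE x in lborel. (\<lambda>k. q k x) \<longlonglongrightarrow> F' x $ i"
      unfolding q_def using has_derivative_inner_imp_directional [OF d] by auto
    show "AE x in lborel. norm (q k x) \<le> indicator K1 x *\<^sub>R B" for k
    proof (rule AE_I2)
      fix x
      let ?y = "x + inverse (real (Suc k)) *\<^sub>R axis i (1::real)"
      show "norm (q k x) \<le> indicator K1 x *\<^sub>R B"
      proof (cases "x \<in> K1")
        case True
        have "\<bar>F ?y - F x\<bar> \<le> B * inverse (real (Suc k))"
          using lip [of ?y x] by simp
        then have "real (Suc k) * \<bar>F ?y - F x\<bar> \<le> real (Suc k) * (B * inverse (real (Suc k)))"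
          by (rule mult_left_mono) simp
        also have "\<dots> = B" by (simp add: field_simps)
        finally show ?thesis using True by (simp add: q_def abs_mult)
      next
        case False
        have "x \<notin> K" using False by (force simp: K1_def)
        moreover have "?y \<notin> K"
        proof
          assume "?y \<in> K"
          moreover have "dist ?y x \<le> 1" by (simp add: dist_norm inverse_le_1_iff)
          ultimately have "x \<in> K1" by (auto simp: K1_def)
          with False show False ..
        qed
        ultimately show ?thesis using False K(2) by (simp add: q_def)
      qed
    qed
    show "(\<lambda>x. F' x $ i) \<in> borel_measurable lborel"
      using c by (auto intro!: borel_measurable_continuous_onI continuous_on_component)
    show "q k \<in> borel_measurable lborel" for k
      unfolding q_def using meas by measurable
  qed
  moreover have "(\<integral>x. q k x \<partial>lborel) = 0" for k
  proof -
    let ?t = "inverse (real (Suc k)) *\<^sub>R axis i (1::real) :: real^'n"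
    have c': "continuous_on UNIV (\<lambda>x. F (x + ?t))"
      by (intro continuous_on_compose2 [OF cF] continuous_intros) simp
    have "integrable lborel (\<lambda>x. F (x + ?t))"
    proof (rule compact_support_integrable [OF c' cK1])
      fix x assume x: "x \<notin> K1"
      have "x + ?t \<notin> K"
      proof
        assume "x + ?t \<in> K"
        moreover have "dist (x + ?t) x \<le> 1" by (simp add: dist_norm inverse_le_1_iff)
        ultimately have "x \<in> K1" by (auto simp: K1_def)
        with x show False ..
      qed
      then show "F (x + ?t) = 0" by (rule K(2))
    qed
    moreover have "(\<integral>x. F (x + ?t) \<partial>lborel) = (\<integral>x. F x \<partial>lborel)"
      using integral_lborel_affine_isometry [OF meas, of 1 ?t] by (simp add: add.commute)
    ultimately show ?thesis
      unfolding q_def using Fi by (simp add: Bochner_Integration.integral_diff)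
  qed
  ultimately show ?thesis using LIMSEQ_unique [OF _ tendsto_const] by force
qed

lemma integration_by_parts_C1:
  fixes h :: "real^'n::finite \<Rightarrow> real"
  assumes W: "open W" and K: "compact K" "K \<subseteq> W"
    and h: "\<And>x. x \<in> W \<Longrightarrow> (h has_derivative (\<lambda>v. v \<bullet> h' x)) (at x)" "continuous_on W h'"
    and \<psi>: "smooth_fun \<psi>" "\<And>x. x \<notin> K \<Longrightarrow> \<psi> x = 0"
  shows "(\<integral>x. h x * partial i \<psi> x \<partial>lebesgue) = - (\<integral>x. h' x $ i * \<psi> x \<partial>lebesgue)"
proof -
  have cl: "closed K" by (rule compact_imp_closed [OF K(1)])
  have p0: "x \<notin> K \<Longrightarrow> partial i \<psi> x = 0" for x i by (rule partial_eq_0_outside [OF \<psi>(2) cl])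
  have g0: "x \<notin> K \<Longrightarrow> grad \<psi> x = 0" for x by (simp add: grad_def vec_eq_iff p0)
  have hc: "continuous_on W h"
    using h(1) has_derivative_continuous continuous_at_imp_continuous_on by blast
  \<comment> \<open>Extension by zero: \<open>W\<close> and the complement of \<open>K\<close> form
    an open cover, and on the latter the function is constant.\<close>
  have ext: "continuous_on UNIV F" if "continuous_on W F" "\<And>x. x \<notin> K \<Longrightarrow> F x = 0"
    for F :: "real^'n \<Rightarrow> 'b::real_normed_vector"
  proof -
    have "continuous_on (- K) F"
      by (rule continuous_on_cong [THEN iffD2, OF refl _ continuous_on_const]) (use that in auto)
    then have "continuous_on (W \<union> - K) F"
      by (intro continuous_on_open_Un that W) (use cl in auto)
    moreover have "W \<union> - K = UNIV" using K by blast
    ultimately show ?thesis by simp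
  qed
  define F where "F x = h x * \<psi> x" for x
  define F' where "F' x = h x *\<^sub>R grad \<psi> x + \<psi> x *\<^sub>R h' x" for x
  have "(F has_derivative (\<lambda>v. v \<bullet> F' x)) (at x)" for x
  proof (cases "x \<in> W")
    case True
    have "(\<psi> has_derivative (\<lambda>v. v \<bullet> grad \<psi> x)) (at x)"
      by (rule has_derivative_grad [OF smooth_fun_differentiable [OF \<psi>(1)]])
    from has_derivative_mult [OF h(1) [OF True] this]
    show ?thesis by (simp add: F_def [abs_def] F'_def inner_add_right algebra_simps)
  next
    case False
    then have x: "x \<in> - K" using K by blast
    have "((\<lambda>_. 0) has_derivative (\<lambda>v. 0)) (at x)" by simp
    then have "(F has_derivative (\<lambda>v. 0)) (at x)"
      by (rule has_derivative_transform_within_open [where s = "- K"]) (use x cl \<psi>(2) in \<open>auto simp: F_def\<close>)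
    moreover have "F' x = 0" using x by (simp add: F'_def \<psi>(2) g0)
    ultimately show ?thesis by simp
  qed
  moreover have "continuous_on UNIV F'"
  proof (rule ext)
    show "continuous_on W F'"
      unfolding F'_def
      by (intro continuous_intros hc h(2) smooth_fun_continuous_grad smooth_fun_continuous \<psi>)
  qed (simp add: F'_def \<psi>(2) g0)
  moreover have "x \<notin> K \<Longrightarrow> F x = 0" for x by (simp add: F_def \<psi>)
  ultimately have 0: "(\<integral>x. F' x $ i \<partial>lborel) = 0"
    using integral_partial_eq_0 [OF _ _ K(1)] by blast
  have c1: "continuous_on UNIV (\<lambda>x. h x * partial i \<psi> x)"
    by (rule ext [OF continuous_on_mult [OF hc smooth_fun_continuous [OF smooth_fun_partial [OF \<psi>(1)]]]])
      (simp add: p0)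
  have c2: "continuous_on UNIV (\<lambda>x. h' x $ i * \<psi> x)"
    by (rule ext [OF continuous_on_mult [OF continuous_on_component [OF h(2)] smooth_fun_continuous [OF \<psi>(1)]]])
      (simp add: \<psi>(2))
  have i1: "integrable lborel (\<lambda>x. h x * partial i \<psi> x)"
    by (rule compact_support_integrable [OF c1 K(1)]) (simp add: p0)
  have i2: "integrable lborel (\<lambda>x. h' x $ i * \<psi> x)"
    by (rule compact_support_integrable [OF c2 K(1)]) (simp add: \<psi>(2))
  have "(\<integral>x. F' x $ i \<partial>lborel) = (\<integral>x. h x * partial i \<psi> x + h' x $ i * \<psi> x \<partial>lborel)"
    by (simp add: F'_def grad_def mult.commute)
  also have "\<dots> = (\<integral>x. h x * partial i \<psi> x \<partial>lborel) + (\<integral>x. h' x $ i * \<psi> x \<partial>lborel)"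
    by (rule Bochner_Integration.integral_add [OF i1 i2])
  finally have "(\<integral>x. h x * partial i \<psi> x \<partial>lborel) = - (\<integral>x. h' x $ i * \<psi> x \<partial>lborel)"
    using 0 by simp
  then show ?thesis
    using borel_measurable_continuous_onI [OF c1] borel_measurable_continuous_onI [OF c2]
    by (simp add: integral_completion)
qed

section \<open>Limits of products under uniform and L1 convergence\<close>

lemma continuous_on_compact_measurable:
  fixes a :: "real^'n::finite \<Rightarrow> real"
  assumes "compact K" "continuous_on K a"
  shows "(\<lambda>x. indicator K x * a x) \<in> borel_measurable lebesgue"
proof -
  have "(\<lambda>x. indicator K x *\<^sub>R a x) \<in> borel_measurable lborel"
    using borel_integrable_compact [OF assms] by auto
  then show ?thesis by (intro measurable_completion) simp
qed

lemma compact_mult_integrable: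
  fixes a b :: "real^'n::finite \<Rightarrow> real"
  assumes K: "compact K" and a: "continuous_on K a"
    and b: "integrable lebesgue (\<lambda>x. indicator K x * b x)"
  shows "integrable lebesgue (\<lambda>x. indicator K x * (a x * b x))"
proof -
  obtain B where B: "\<And>x. x \<in> K \<Longrightarrow> \<bar>a x\<bar> \<le> B"
    using compact_imp_bounded [OF compact_continuous_image [OF a K]] unfolding bounded_iff
    by (metis image_eqI real_norm_def)
  have "integrable lebesgue (\<lambda>x. (indicator K x * a x) * (indicator K x * b x))"
    by (rule integrable_bounded_mult [OF b continuous_on_compact_measurable [OF K a], of "\<bar>B\<bar>"])
      (use B in \<open>force simp: indicator_def\<close>)
  moreover have "(\<lambda>x. (indicator K x * a x) * (indicator K x * b x)) = (\<lambda>x. indicator K x * (a x * b x))"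
    by (auto simp: indicator_def)
  ultimately show ?thesis by simp
qed

text \<open>Written as \<open>a k * (b k - b') + (a k - a') * b'\<close>, the error has one factor
  that is bounded and one that is small, in L1 and uniformly respectively. In the applications the
  uniform factor is a continuous function composed with a map and the other one is a weak derivative
  or a test function.\<close>

lemma integral_mult_uniform_L1_limit:
  fixes a :: "nat \<Rightarrow> real^'n::finite \<Rightarrow> real"
  assumes K: "compact K" and a: "\<And>k. continuous_on K (a k)" "continuous_on K a'"
    and lim: "uniform_limit K a a' sequentially"
    and b: "\<And>k. integrable lebesgue (\<lambda>x. indicator K x * b k x)" "integrable lebesgue (\<lambda>x. indicator K x * b' x)"
    and L1: "(\<lambda>k. \<integral>\<^sup>+x\<in>K. ennreal \<bar>b k x - b' x\<bar> \<partial>lebesgue) \<longlonglongrightarrow> 0"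
  shows "(\<lambda>k. \<integral>x. indicator K x * (a k x * b k x) \<partial>lebesgue)
     \<longlonglongrightarrow> (\<integral>x. indicator K x * (a' x * b' x) \<partial>lebesgue)"
proof -
  obtain B where B: "0 \<le> B" "\<And>x. x \<in> K \<Longrightarrow> \<bar>a' x\<bar> \<le> B"
  proof -
    obtain B where "\<And>x. x \<in> K \<Longrightarrow> \<bar>a' x\<bar> \<le> B"
      using compact_imp_bounded [OF compact_continuous_image [OF a(2) K]] unfolding bounded_iff
      by (metis image_eqI real_norm_def)
    then show ?thesis using that [of "max B 0"] by (simp add: max.coboundedI1)
  qed
  define D where "D k = (\<integral>x. indicator K x * \<bar>b k x - b' x\<bar> \<partial>lebesgue)" for k
  define E where "E = (\<integral>x. indicator K x * \<bar>b' x\<bar> \<partial>lebesgue)"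
  have di: "integrable lebesgue (\<lambda>x. indicator K x * \<bar>b k x - b' x\<bar>)" for k
  proof -
    have "integrable lebesgue (\<lambda>x. \<bar>indicator K x * b k x - indicator K x * b' x\<bar>)"
      by (intro integrable_abs Bochner_Integration.integrable_diff b)
    moreover have "(\<lambda>x. \<bar>indicator K x * b k x - indicator K x * b' x\<bar>) = (\<lambda>x. indicator K x * \<bar>b k x - b' x\<bar>)"
      by (auto simp: indicator_def)
    ultimately show ?thesis by simp
  qed
  have ei: "integrable lebesgue (\<lambda>x. indicator K x * \<bar>b' x\<bar>)"
  proof -
    have "integrable lebesgue (\<lambda>x. \<bar>indicator K x * b' x\<bar>)"
      by (intro integrable_abs b)
    moreover have "(\<lambda>x. \<bar>indicator K x * b' x\<bar>) = (\<lambda>x. indicator K x * \<bar>b' x\<bar>)"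
      by (auto simp: indicator_def)
    ultimately show ?thesis by simp
  qed
  have D0: "0 \<le> D k" "0 \<le> E" for k unfolding D_def E_def by (auto intro!: integral_nonneg_AE)
  have "ennreal (D k) = (\<integral>\<^sup>+x\<in>K. ennreal \<bar>b k x - b' x\<bar> \<partial>lebesgue)" for k
  proof -
    have "ennreal (D k) = (\<integral>\<^sup>+x. ennreal (indicator K x * \<bar>b k x - b' x\<bar>) \<partial>lebesgue)"
      unfolding D_def by (rule nn_integral_eq_integral [symmetric, OF di]) auto
    also have "\<dots> = (\<integral>\<^sup>+x\<in>K. ennreal \<bar>b k x - b' x\<bar> \<partial>lebesgue)"
      by (intro nn_integral_cong) (auto simp: indicator_def)
    finally show ?thesis .
  qed
  with L1 have "(\<lambda>k. ennreal (D k)) \<longlonglongrightarrow> ennreal 0" by simp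
  then have Dl: "D \<longlonglongrightarrow> 0" using D0(1) by (subst (asm) tendsto_ennreal_iff) auto
  show ?thesis
  proof (rule LIMSEQ_I)
    fix e :: real assume e: "0 < e"
    \<comment> \<open>The cap 1 keeps \<open>a k\<close> below \<open>B + 1\<close>; the other bound
      makes \<open>d * E\<close> less than \<open>e / 2\<close>, with \<open>E + 1\<close> to avoid
      dividing by zero.\<close>
    define d where "d = min 1 (e / (2 * (E + 1)))"
    have d: "0 < d" "d \<le> 1" using e D0 by (auto simp: d_def)
    have dE: "d * E < e / 2"
    proof -
      have "d * E \<le> e / (2 * (E + 1)) * E" using D0 by (intro mult_right_mono) (auto simp: d_def)
      also have "\<dots> < e / 2" using e D0(2) by (simp add: divide_simps)
      finally show ?thesis .
    qed
    have "\<forall>\<^sub>F k in sequentially. D k < e / (2 * (B + 1))"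
      using B e by (intro order_tendstoD(2) [OF Dl]) auto
    moreover have "\<forall>\<^sub>F k in sequentially. \<forall>x\<in>K. dist (a k x) (a' x) < d"
      by (rule uniform_limitD [OF lim d(1)])
    ultimately have "\<forall>\<^sub>F k in sequentially. norm ((\<integral>x. indicator K x * (a k x * b k x) \<partial>lebesgue)
        - (\<integral>x. indicator K x * (a' x * b' x) \<partial>lebesgue)) < e"
    proof eventually_elim
      case (elim k)
      have i1: "integrable lebesgue (\<lambda>x. indicator K x * (a k x * b k x))"
        by (rule compact_mult_integrable [OF K a(1) b(1)])
      have i2: "integrable lebesgue (\<lambda>x. indicator K x * (a' x * b' x))"
        by (rule compact_mult_integrable [OF K a(2) b(2)])
      have "norm ((\<integral>x. indicator K x * (a k x * b k x) \<partial>lebesgue)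
          - (\<integral>x. indicator K x * (a' x * b' x) \<partial>lebesgue))
        = \<bar>\<integral>x. indicator K x * (a k x * b k x) - indicator K x * (a' x * b' x) \<partial>lebesgue\<bar>"
        by (simp add: Bochner_Integration.integral_diff [OF i1 i2])
      also have "\<dots> \<le> (\<integral>x. \<bar>indicator K x * (a k x * b k x) - indicator K x * (a' x * b' x)\<bar> \<partial>lebesgue)"
        by (rule integral_abs_bound)
      also have "\<dots> \<le> (\<integral>x. (B + 1) * (indicator K x * \<bar>b k x - b' x\<bar>) + d * (indicator K x * \<bar>b' x\<bar>) \<partial>lebesgue)"
      proof (rule integral_mono)
        fix x
        show "\<bar>indicator K x * (a k x * b k x) - indicator K x * (a' x * b' x)\<bar>
          \<le> (B + 1) * (indicator K x * \<bar>b k x - b' x\<bar>) + d * (indicator K x * \<bar>b' x\<bar>)"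
        proof (cases "x \<in> K")
          case True
          have ak: "\<bar>a k x - a' x\<bar> \<le> d" using elim(2) True by (auto simp: dist_norm)
          then have "\<bar>a k x\<bar> \<le> B + 1" using B(2) [OF True] d by linarith
          then have "\<bar>a k x\<bar> * \<bar>b k x - b' x\<bar> \<le> (B + 1) * \<bar>b k x - b' x\<bar>" by (rule mult_right_mono) simp
          moreover have "\<bar>a k x - a' x\<bar> * \<bar>b' x\<bar> \<le> d * \<bar>b' x\<bar>" using ak by (rule mult_right_mono) simp
          moreover have "a k x * b k x - a' x * b' x = a k x * (b k x - b' x) + (a k x - a' x) * b' x"
            by (simp add: algebra_simps)
          then have "\<bar>a k x * b k x - a' x * b' x\<bar> \<le> \<bar>a k x\<bar> * \<bar>b k x - b' x\<bar> + \<bar>a k x - a' x\<bar> * \<bar>b' x\<bar>"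
            by (metis abs_mult abs_triangle_ineq)
          ultimately show ?thesis using True by simp
        qed simp
      next
        show "integrable lebesgue (\<lambda>x. (B + 1) * (indicator K x * \<bar>b k x - b' x\<bar>) + d * (indicator K x * \<bar>b' x\<bar>))"
          using di ei by (intro Bochner_Integration.integrable_add integrable_mult_right) auto
      qed (use i1 i2 in \<open>intro integrable_abs Bochner_Integration.integrable_diff\<close>)
      also have "\<dots> = (B + 1) * D k + d * E"
        unfolding D_def E_def using di ei
        by (subst Bochner_Integration.integral_add) (auto intro!: integrable_mult_right)
      also have "\<dots> < e"
      proof -
        have "(B + 1) * D k < (B + 1) * (e / (2 * (B + 1)))" using elim(1) B by (intro mult_strict_left_mono) auto
        also have "\<dots> = e / 2" using B by (simp add: divide_simps)
        finally show ?thesis using dE by simp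
      qed
      finally show ?case .
    qed
    then show "\<exists>no. \<forall>k\<ge>no. norm ((\<integral>x. indicator K x * (a k x * b k x) \<partial>lebesgue)
        - (\<integral>x. indicator K x * (a' x * b' x) \<partial>lebesgue)) < e"
      by (simp add: eventually_sequentially)
  qed
qed

lemma uniform_limit_compose_compact:
  fixes \<Phi> :: "'i \<Rightarrow> 'a \<Rightarrow> 'b::metric_space" and f :: "'b \<Rightarrow> 'c::metric_space"
  assumes L: "compact L" "continuous_on L f"
    and mem: "\<And>k x. x \<in> K \<Longrightarrow> \<Phi> k x \<in> L" "\<And>x. x \<in> K \<Longrightarrow> \<phi> x \<in> L"
    and lim: "uniform_limit K \<Phi> \<phi> F"
  shows "uniform_limit K (\<lambda>k x. f (\<Phi> k x)) (\<lambda>x. f (\<phi> x)) F"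
proof (rule uniform_limitI)
  fix e :: real assume e: "0 < e"
  then obtain d where d: "0 < d" "\<And>x y. x \<in> L \<Longrightarrow> y \<in> L \<Longrightarrow> dist y x < d \<Longrightarrow> dist (f y) (f x) < e"
    using compact_uniformly_continuous [OF L(2,1)] unfolding uniformly_continuous_on_def by metis
  show "\<forall>\<^sub>F k in F. \<forall>x\<in>K. dist (f (\<Phi> k x)) (f (\<phi> x)) < e"
    using uniform_limitD [OF lim d(1)] by eventually_elim (use d(2) mem in blast)
qed

lemma uniform_limit_vec:
  fixes v :: "'n::finite \<Rightarrow> nat \<Rightarrow> 'a \<Rightarrow> real" and \<phi> :: "'a \<Rightarrow> real^'n"
  assumes "\<And>l. uniform_limit K (v l) (\<lambda>x. \<phi> x $ l) sequentially"
  shows "uniform_limit K (\<lambda>k x. \<chi> l. v l k x) \<phi> sequentially"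
proof (rule uniform_limitI)
  fix e :: real assume e: "0 < e"
  let ?n = "real CARD('n)"
  have n: "0 < ?n" by simp
  have "\<forall>\<^sub>F k in sequentially. \<forall>x\<in>K. dist (v l k x) (\<phi> x $ l) < e / ?n" for l
    using e n by (intro uniform_limitD [OF assms]) simp
  then have "\<forall>\<^sub>F k in sequentially. \<forall>l. \<forall>x\<in>K. dist (v l k x) (\<phi> x $ l) < e / ?n"
    by (rule eventually_all_finite)
  then show "\<forall>\<^sub>F k in sequentially. \<forall>x\<in>K. dist (\<chi> l. v l k x) (\<phi> x) < e"
  proof eventually_elim
    case (elim k)
    show ?case
    proof
      fix x assume x: "x \<in> K"
      have "dist (\<chi> l. v l k x) (\<phi> x) \<le> (\<Sum>l\<in>UNIV. \<bar>((\<chi> l. v l k x) - \<phi> x) $ l\<bar>)"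
        unfolding dist_norm by (rule norm_le_l1_cart)
      also have "\<dots> < (\<Sum>l\<in>(UNIV::'n set). e / ?n)"
        using elim x by (intro sum_strict_mono) (auto simp: dist_norm)
      also have "\<dots> = e" by simp
      finally show "dist (\<chi> l. v l k x) (\<phi> x) < e" .
    qed
  qed
qed

lemma has_derivative_vec_inner:
  fixes v :: "'m::finite \<Rightarrow> real^'n::finite \<Rightarrow> real"
  assumes "\<And>l. (v l has_derivative (\<lambda>h. h \<bullet> G l)) (at x within S)"
  shows "((\<lambda>x. \<chi> l. v l x) has_derivative (\<lambda>h. \<chi> l. h \<bullet> G l)) (at x within S)"
  unfolding has_derivative_componentwise_within [of "\<lambda>x. \<chi> l. v l x"]
  using assms by (auto simp: Basis_vec_def inner_axis)

text \<open>For a mollified map the identity is classical integration by parts. In the limit the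
  outer function and its gradient converge uniformly on \<open>K\<close> along the maps, and the
  inner gradients converge in L1, so each product passes to the limit.\<close>

lemma weak_chain_rule_C1:
  fixes \<phi> :: "real^'n::finite \<Rightarrow> real^'m::finite" and D :: "real^'n \<Rightarrow> real^'n^'m"
  assumes \<Omega>: "open \<Omega>" "continuous_on \<Omega> \<phi>"
    and wg: "\<And>l. is_weak_grad \<Omega> (\<lambda>x. \<phi> x $ l) (\<lambda>x. D x $ l)"
    and K: "compact K" "K \<subseteq> \<Omega>" and V: "open V" "\<phi> ` K \<subseteq> V"
    and f: "\<And>y. y \<in> V \<Longrightarrow> (f has_derivative (\<lambda>h. h \<bullet> f' y)) (at y)" "continuous_on V f'"
    and \<psi>: "smooth_fun \<psi>" "\<And>x. x \<notin> K \<Longrightarrow> \<psi> x = 0"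
  shows "(\<integral>x. f (\<phi> x) * partial i \<psi> x \<partial>lebesgue)
     = - (\<integral>x. (\<Sum>l\<in>UNIV. f' (\<phi> x) $ l * D x $ l $ i) * \<psi> x \<partial>lebesgue)"
proof -
  define P where "P l W v G \<longleftrightarrow> open W \<and> K \<subseteq> W \<and> W \<subseteq> \<Omega> \<and>
    (\<forall>k x. x \<in> W \<longrightarrow> (v k has_derivative (\<lambda>h. h \<bullet> G k x)) (at x)) \<and>
    (\<forall>k. continuous_on UNIV (G k)) \<and> uniform_limit K v (\<lambda>x. \<phi> x $ l) sequentially \<and>
    (\<forall>i. (\<lambda>k. \<integral>\<^sup>+x\<in>K. ennreal \<bar>G k x $ i - D x $ l $ i\<bar> \<partial>lebesgue) \<longlonglongrightarrow> 0)"
    for l W and v :: "nat \<Rightarrow> real^'n \<Rightarrow> real" and G :: "nat \<Rightarrow> real^'n \<Rightarrow> real^'n"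
  have "\<exists>W v G. P l W v G" for l
    unfolding P_def
    by (rule weak_grad_C1_approx [OF \<Omega>(1) wg [of l] continuous_on_component [OF \<Omega>(2)] K]) blast
  then obtain W v G where PW: "\<And>l. P l (W l) (v l) (G l)" by metis
  note PW = PW [unfolded P_def]
  have W: "open (W l)" "K \<subseteq> W l" "W l \<subseteq> \<Omega>"
    and vd: "x \<in> W l \<Longrightarrow> (v l k has_derivative (\<lambda>h. h \<bullet> G l k x)) (at x)"
    and Gc: "continuous_on UNIV (G l k)"
    and ul: "uniform_limit K (v l) (\<lambda>x. \<phi> x $ l) sequentially"
    and L1: "(\<lambda>k. \<integral>\<^sup>+x\<in>K. ennreal \<bar>G l k x $ i - D x $ l $ i\<bar> \<partial>lebesgue) \<longlonglongrightarrow> 0" for l k x i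
    using PW [of l] by blast+
  define W0 where "W0 = (\<Inter>l. W l)"
  have W0: "open W0" "K \<subseteq> W0" using W by (auto simp: W0_def)
  have cK: "compact (\<phi> ` K)" using K \<Omega> by (intro compact_continuous_image) (auto intro: continuous_on_subset)
  obtain e where e: "0 < e" "(\<Union>y\<in>\<phi> ` K. cball y e) \<subseteq> V"
    using compact_subset_open_imp_cball_epsilon_subset [OF cK V] by metis
  \<comment> \<open>\<open>f\<close> is given only on \<open>V\<close>, and uniform continuity is
    needed at the values of \<open>\<phi>\<close> and of its approximations alike; a compact
    neighbourhood of the image of \<open>K\<close> contains them all from some index on.\<close>
  define L where "L = (\<Union>y\<in>\<phi> ` K. cball y e)"
  have L: "compact L" "L \<subseteq> V"
    unfolding L_def by (rule compact_minkowski_sum_cball [OF cK]) (rule e(2))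
  have \<phi>L: "x \<in> K \<Longrightarrow> \<phi> x \<in> L" for x using e by (force simp: L_def)
  define \<Phi>0 where "\<Phi>0 k x = (\<chi> l. v l k x)" for k x
  have ul0: "uniform_limit K \<Phi>0 \<phi> sequentially"
    unfolding \<Phi>0_def by (rule uniform_limit_vec [OF ul])
  obtain N where N: "\<And>k x. N \<le> k \<Longrightarrow> x \<in> K \<Longrightarrow> dist (\<Phi>0 k x) (\<phi> x) < e"
    using uniform_limitD [OF ul0 e(1)] by (auto simp: eventually_sequentially)
  \<comment> \<open>Dropping the first \<open>N\<close> approximations makes every remaining one map
    \<open>K\<close> into \<open>L\<close>.\<close>
  define \<Phi> where "\<Phi> k = \<Phi>0 (k + N)" for k
  define H where "H l k = G l (k + N)" for l k
  have \<Phi>L: "\<Phi> k x \<in> L" if "x \<in> K" for k x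
    using N [of "k + N" x] that by (auto simp: \<Phi>_def L_def dist_commute intro!: bexI [of _ x] less_imp_le)
  have sub: "filterlim (\<lambda>k. k + N) sequentially sequentially" by (rule filterlim_add_const_nat_at_top)
  have ul': "uniform_limit K \<Phi> \<phi> sequentially"
    unfolding \<Phi>_def by (rule filterlim_compose [OF ul0 sub])
  have \<Phi>d: "(\<Phi> k has_derivative (\<lambda>h. \<chi> l. h \<bullet> H l k x)) (at x)" if "x \<in> W0" for k x
    unfolding \<Phi>_def \<Phi>0_def H_def
    by (rule has_derivative_vec_inner) (use that vd in \<open>auto simp: W0_def\<close>)
  have \<Phi>c: "continuous_on W0 (\<Phi> k)" for k
    by (intro continuous_at_imp_continuous_on ballI) (rule has_derivative_continuous [OF \<Phi>d])
  have Hc: "continuous_on S (H l k)" for l k S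
    unfolding H_def by (rule continuous_on_subset [OF Gc]) simp
  have p0: "x \<notin> K \<Longrightarrow> partial i \<psi> x = 0" for x
    by (rule partial_eq_0_outside [OF \<psi>(2) compact_imp_closed [OF K(1)]])
  have fc: "continuous_on V f"
    by (intro continuous_at_imp_continuous_on ballI) (rule has_derivative_continuous [OF f(1)])
  have eq: "(\<integral>x. indicator K x * (f (\<Phi> k x) * partial i \<psi> x) \<partial>lebesgue)
      = - (\<integral>x. (\<Sum>l\<in>UNIV. indicator K x * ((f' (\<Phi> k x) $ l * \<psi> x) * H l k x $ i)) \<partial>lebesgue)" for k
  proof -
    define W' where "W' = W0 \<inter> \<Phi> k -` V"
    define h' where "h' x = (\<Sum>l\<in>UNIV. f' (\<Phi> k x) $ l *\<^sub>R H l k x)" for x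
    have W': "open W'" unfolding W'_def by (rule continuous_open_preimage [OF \<Phi>c W0(1) V(1)])
    have KW': "K \<subseteq> W'" unfolding W'_def using W0(2) \<Phi>L L(2) by blast
    have hd: "((\<lambda>x. f (\<Phi> k x)) has_derivative (\<lambda>h. h \<bullet> h' x)) (at x)" if "x \<in> W'" for x
    proof -
      have "((\<lambda>x. f (\<Phi> k x)) has_derivative (\<lambda>h. (\<chi> l. h \<bullet> H l k x) \<bullet> f' (\<Phi> k x))) (at x)"
        by (rule has_derivative_compose [OF \<Phi>d f(1)]) (use that in \<open>auto simp: W'_def\<close>)
      moreover have "(\<lambda>h. (\<chi> l. h \<bullet> H l k x) \<bullet> f' (\<Phi> k x)) = (\<lambda>h. h \<bullet> h' x)"
        by (rule ext) (simp add: h'_def inner_vec_def [of "vec_lambda _"] inner_sum_right mult.commute)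
      ultimately show ?thesis by simp
    qed
    have f'c: "continuous_on W' (\<lambda>x. f' (\<Phi> k x))"
      by (rule continuous_on_compose2 [OF f(2) continuous_on_subset [OF \<Phi>c]]) (auto simp: W'_def)
    have "continuous_on W' h'"
      unfolding h'_def by (intro continuous_on_sum continuous_on_scaleR continuous_on_component f'c Hc)
    from integration_by_parts_C1 [OF W' K(1) KW' hd this \<psi>]
    have "(\<integral>x. f (\<Phi> k x) * partial i \<psi> x \<partial>lebesgue) = - (\<integral>x. h' x $ i * \<psi> x \<partial>lebesgue)" .
    moreover have "(\<lambda>x. f (\<Phi> k x) * partial i \<psi> x) = (\<lambda>x. indicator K x * (f (\<Phi> k x) * partial i \<psi> x))"
      using p0 by (auto simp: indicator_def fun_eq_iff)
    moreover have "(\<lambda>x. h' x $ i * \<psi> x) = (\<lambda>x. \<Sum>l\<in>UNIV. indicator K x * ((f' (\<Phi> k x) $ l * \<psi> x) * H l k x $ i))"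
    proof
      fix x
      show "h' x $ i * \<psi> x = (\<Sum>l\<in>UNIV. indicator K x * ((f' (\<Phi> k x) $ l * \<psi> x) * H l k x $ i))"
      proof (cases "x \<in> K")
        case True
        then show ?thesis by (simp add: h'_def sum_distrib_left mult_ac)
      qed (simp add: \<psi>(2))
    qed
    ultimately show ?thesis by (simp only:)
  qed
  have fL: "continuous_on L f" "continuous_on L f'" using fc f(2) L continuous_on_subset by blast+
  have cont\<phi>K: "continuous_on K \<phi>" using \<Omega>(2) K(2) continuous_on_subset by blast
  have \<Phi>cK: "continuous_on K (\<Phi> k)" for k using \<Phi>c W0(2) continuous_on_subset by blast
  have c1: "continuous_on K (\<lambda>x. f (\<Phi> k x))" "continuous_on K (\<lambda>x. f (\<phi> x))" for k
    by (rule continuous_on_compose2 [OF fL(1)], use \<Phi>cK cont\<phi>K \<Phi>L \<phi>L in auto)+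
  have c2: "continuous_on K (\<lambda>x. f' (\<Phi> k x))" "continuous_on K (\<lambda>x. f' (\<phi> x))" for k
    by (rule continuous_on_compose2 [OF fL(2)], use \<Phi>cK cont\<phi>K \<Phi>L \<phi>L in auto)+
  have int: "integrable lebesgue (\<lambda>x. indicator K x * b x)" if "continuous_on UNIV b" for b :: "real^'n \<Rightarrow> real"
  proof -
    have "integrable lborel (\<lambda>x. indicator K x *\<^sub>R b x)"
      by (rule borel_integrable_compact [OF K(1) continuous_on_subset [OF that]]) simp
    moreover from this have "(\<lambda>x. indicator K x *\<^sub>R b x) \<in> borel_measurable lborel" by auto
    ultimately show ?thesis by (simp add: integrable_completion)
  qed
  have lim1: "(\<lambda>k. \<integral>x. indicator K x * (f (\<Phi> k x) * partial i \<psi> x) \<partial>lebesgue)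
      \<longlonglongrightarrow> (\<integral>x. indicator K x * (f (\<phi> x) * partial i \<psi> x) \<partial>lebesgue)"
    by (rule integral_mult_uniform_L1_limit [OF K(1) c1])
      (use \<Phi>L \<phi>L in \<open>auto intro!: uniform_limit_compose_compact [OF L(1) fL(1)] ul' int
        smooth_fun_continuous [OF smooth_fun_partial [OF \<psi>(1)]]\<close>)
  have \<psi>c: "continuous_on K \<psi>" by (rule smooth_fun_continuous [OF \<psi>(1)])
  have Di: "integrable lebesgue (\<lambda>x. indicator K x * D x $ l $ i)" for l
    by (rule loc_integrable_compact [OF _ K]) (use wg [of l] in \<open>auto simp: is_weak_grad_def\<close>)
  have a2: "continuous_on K (\<lambda>x. f' (\<Phi> k x) $ l * \<psi> x)" "continuous_on K (\<lambda>x. f' (\<phi> x) $ l * \<psi> x)" for k l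
    by (intro continuous_on_mult continuous_on_component c2 \<psi>c)+
  have ul2: "uniform_limit K (\<lambda>k x. f' (\<Phi> k x) $ l * \<psi> x) (\<lambda>x. f' (\<phi> x) $ l * \<psi> x) sequentially" for l
  proof (rule uniform_lim_mult)
    show "uniform_limit K (\<lambda>k x. f' (\<Phi> k x) $ l) (\<lambda>x. f' (\<phi> x) $ l) sequentially"
      by (rule uniform_limit_compose_compact [OF L(1) continuous_on_component [OF fL(2)] \<Phi>L \<phi>L ul'])
    show "bounded ((\<lambda>x. f' (\<phi> x) $ l) ` K)" "bounded (\<psi> ` K)"
      by (intro compact_imp_bounded compact_continuous_image continuous_on_component c2 \<psi>c K)+
  qed (rule uniform_limit_const)
  have L1': "(\<lambda>k. \<integral>\<^sup>+x\<in>K. ennreal \<bar>H l k x $ i - D x $ l $ i\<bar> \<partial>lebesgue) \<longlonglongrightarrow> 0" for l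
    unfolding H_def by (rule filterlim_compose [OF L1 sub])
  have lim2: "(\<lambda>k. \<integral>x. indicator K x * ((f' (\<Phi> k x) $ l * \<psi> x) * H l k x $ i) \<partial>lebesgue)
      \<longlonglongrightarrow> (\<integral>x. indicator K x * ((f' (\<phi> x) $ l * \<psi> x) * D x $ l $ i) \<partial>lebesgue)" for l
    by (rule integral_mult_uniform_L1_limit [OF K(1) a2 ul2 int [OF continuous_on_component [OF Hc]] Di L1'])
  have i2: "integrable lebesgue (\<lambda>x. indicator K x * ((f' (\<Phi> k x) $ l * \<psi> x) * H l k x $ i))"
    "integrable lebesgue (\<lambda>x. indicator K x * ((f' (\<phi> x) $ l * \<psi> x) * D x $ l $ i))" for k l
    by (rule compact_mult_integrable [OF K(1) a2(1) int [OF continuous_on_component [OF Hc]]])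
      (rule compact_mult_integrable [OF K(1) a2(2) Di])
  have "(\<lambda>k. - (\<Sum>l\<in>UNIV. \<integral>x. indicator K x * ((f' (\<Phi> k x) $ l * \<psi> x) * H l k x $ i) \<partial>lebesgue))
      \<longlonglongrightarrow> - (\<Sum>l\<in>UNIV. \<integral>x. indicator K x * ((f' (\<phi> x) $ l * \<psi> x) * D x $ l $ i) \<partial>lebesgue)"
    by (intro tendsto_minus tendsto_sum lim2)
  moreover have "(\<lambda>k. - (\<Sum>l\<in>UNIV. \<integral>x. indicator K x * ((f' (\<Phi> k x) $ l * \<psi> x) * H l k x $ i) \<partial>lebesgue))
     = (\<lambda>k. \<integral>x. indicator K x * (f (\<Phi> k x) * partial i \<psi> x) \<partial>lebesgue)"
    by (rule ext, subst eq, subst Bochner_Integration.integral_sum) (use i2 in auto)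
  ultimately have "(\<integral>x. indicator K x * (f (\<phi> x) * partial i \<psi> x) \<partial>lebesgue)
     = - (\<Sum>l\<in>UNIV. \<integral>x. indicator K x * ((f' (\<phi> x) $ l * \<psi> x) * D x $ l $ i) \<partial>lebesgue)"
    using lim1 LIMSEQ_unique by simp
  also have "\<dots> = - (\<integral>x. (\<Sum>l\<in>UNIV. indicator K x * ((f' (\<phi> x) $ l * \<psi> x) * D x $ l $ i)) \<partial>lebesgue)"
    by (subst Bochner_Integration.integral_sum) (use i2 in auto)
  also have "(\<lambda>x. \<Sum>l\<in>UNIV. indicator K x * ((f' (\<phi> x) $ l * \<psi> x) * D x $ l $ i))
      = (\<lambda>x. (\<Sum>l\<in>UNIV. f' (\<phi> x) $ l * D x $ l $ i) * \<psi> x)"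
  proof
    fix x
    show "(\<Sum>l\<in>UNIV. indicator K x * ((f' (\<phi> x) $ l * \<psi> x) * D x $ l $ i))
      = (\<Sum>l\<in>UNIV. f' (\<phi> x) $ l * D x $ l $ i) * \<psi> x"
    proof (cases "x \<in> K")
      case True
      then show ?thesis by (simp add: sum_distrib_left mult_ac)
    qed (simp add: \<psi>(2))
  qed
  also have "(\<lambda>x. indicator K x * (f (\<phi> x) * partial i \<psi> x)) = (\<lambda>x. f (\<phi> x) * partial i \<psi> x)"
    using p0 by (auto simp: indicator_def fun_eq_iff)
  finally show ?thesis .
qed

section \<open>Maximal functions and differentiability on large sets\<close>

lemma cball_in_borel [measurable]: "cball (x::'a::metric_space) r \<in> sets borel"
  by simp

lemma emeasure_lborel_cball_scale:
  fixes x :: "'a::euclidean_space"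
  assumes "0 < r"
  shows "emeasure lborel (cball x r) = ennreal (r ^ DIM('a)) * emeasure lborel (cball (0::'a) 1)"
proof -
  have eq: "indicator (cball x r) (x + r *\<^sub>R z) = (indicator (cball 0 1) z :: ennreal)" for z
    using assms by (simp add: indicator_def dist_norm)
  have "emeasure lborel (cball x r) = (\<integral>\<^sup>+z. indicator (cball x r) z \<partial>lborel)" by simp
  also have "\<dots> = ennreal (\<bar>r\<bar> ^ DIM('a)) * (\<integral>\<^sup>+z. indicator (cball x r) (x + r *\<^sub>R z) \<partial>lborel)"
    using assms by (intro nn_integral_lborel_affine borel_measurable_indicator) auto
  finally show ?thesis using assms by (simp add: eq)
qed

text \<open>\<open>v z - v x\<close> is the integral of the gradient along the segment. After
  exchanging the integrals, the points at parameter \<open>t\<close> fill the ball of radius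
  \<open>t * r\<close>, and the Jacobian of this dilation cancels the ratio of the volumes; so each
  \<open>t\<close> contributes at most \<open>\<tau>\<close> times the volume of the large
  ball.\<close>

lemma radial_segment_average:
  fixes v :: "real^'n::finite \<Rightarrow> real" and G :: "real^'n \<Rightarrow> real^'n"
  assumes v: "\<And>y. y \<in> cball x r \<Longrightarrow> (v has_derivative (\<lambda>h. h \<bullet> G y)) (at y)"
    and G: "continuous_on UNIV G" and r: "0 < r" and \<tau>: "0 \<le> \<tau>"
    and M: "\<And>t. 0 < t \<Longrightarrow> t \<le> r \<Longrightarrow>
       (\<integral>\<^sup>+z\<in>cball x t. ennreal (norm (G z)) \<partial>lborel) \<le> ennreal \<tau> * emeasure lborel (cball x t)"
  shows "(\<integral>\<^sup>+z\<in>cball x r. ennreal \<bar>v z - v x\<bar> \<partial>lborel) \<le> ennreal (r * \<tau>) * emeasure lborel (cball x r)"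
proof -
  let ?n = "DIM(real^'n)"
  have [measurable]: "G \<in> borel_measurable borel" using G by (rule borel_measurable_continuous_onI)
  have pt: "ennreal \<bar>v z - v x\<bar> * indicator (cball x r) z \<le>
      (\<integral>\<^sup>+t. ennreal r * (indicator {0..1} t * (ennreal (norm (G (x + t *\<^sub>R (z - x)))) * indicator (cball x r) z)) \<partial>lborel)" for z
  proof (cases "z \<in> cball x r")
    case True
    let ?p = "\<lambda>t. x + t *\<^sub>R (z - x)"
    have in_ball: "?p t \<in> cball x r" if "0 \<le> t" "t \<le> 1" for t
    proof -
      have "t * norm (z - x) \<le> 1 * norm (z - x)" using that by (intro mult_right_mono) auto
      then show ?thesis using True that by (simp add: dist_norm norm_minus_commute)
    qed
    have "(\<integral>t. indicator {0..1} t *\<^sub>R ((z - x) \<bullet> G (?p t)) \<partial>lborel) = v (?p 1) - v (?p 0)"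
    proof (rule integral_FTC_Icc)
      show "((\<lambda>t. v (?p t)) has_vector_derivative (z - x) \<bullet> G (?p t)) (at t within {0..1})" if "0 \<le> t" "t \<le> 1" for t
      proof -
        have "(?p has_derivative (\<lambda>s. s *\<^sub>R (z - x))) (at t)"
          by (auto intro!: derivative_eq_intros)
        from has_derivative_compose [OF this v [OF in_ball [OF that]]]
        have "((\<lambda>t. v (?p t)) has_derivative (\<lambda>s. (s *\<^sub>R (z - x)) \<bullet> G (?p t))) (at t)" .
        then have "((\<lambda>t. v (?p t)) has_vector_derivative (z - x) \<bullet> G (?p t)) (at t)"
          by (simp add: has_vector_derivative_def)
        then show ?thesis by (rule has_vector_derivative_at_within)
      qed
      show "continuous_on {0..1} (\<lambda>t. (z - x) \<bullet> G (?p t))"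
        by (intro continuous_intros continuous_on_compose2 [OF G]) auto
    qed simp
    then have "ennreal \<bar>v z - v x\<bar> = ennreal (norm (\<integral>t. indicator {0..1} t *\<^sub>R ((z - x) \<bullet> G (?p t)) \<partial>lborel))"
      by simp
    also have "\<dots> \<le> (\<integral>\<^sup>+t. ennreal (norm (indicator {0..1} t *\<^sub>R ((z - x) \<bullet> G (?p t)))) \<partial>lborel)"
    proof (rule integral_norm_bound_ennreal)
      show "integrable lborel (\<lambda>t. indicator {0..1} t *\<^sub>R ((z - x) \<bullet> G (?p t)))"
        by (rule borel_integrable_compact)
          (auto intro!: continuous_intros continuous_on_compose2 [OF G])
    qed
    also have "\<dots> \<le> (\<integral>\<^sup>+t. ennreal r * (indicator {0..1} t * (ennreal (norm (G (?p t))) * indicator (cball x r) z)) \<partial>lborel)"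
    proof (rule nn_integral_mono)
      fix t :: real
      have "\<bar>(z - x) \<bullet> G (?p t)\<bar> \<le> norm (z - x) * norm (G (?p t))" by (rule Cauchy_Schwarz_ineq2)
      also have "\<dots> \<le> r * norm (G (?p t))"
        using True by (intro mult_right_mono) (auto simp: dist_norm norm_minus_commute)
      finally have "ennreal \<bar>(z - x) \<bullet> G (?p t)\<bar> \<le> ennreal r * ennreal (norm (G (?p t)))"
        using r by (simp add: ennreal_leI flip: ennreal_mult)
      then show "ennreal (norm (indicator {0..1} t *\<^sub>R ((z - x) \<bullet> G (?p t))))
          \<le> ennreal r * (indicator {0..1} t * (ennreal (norm (G (?p t))) * indicator (cball x r) z))"
        using True by (simp add: indicator_def)
    qed
    finally show ?thesis using True by simp
  qed simp
  have slice: "(\<integral>\<^sup>+z. ennreal (norm (G (x + t *\<^sub>R (z - x)))) * indicator (cball x r) z \<partial>lborel)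
      \<le> ennreal \<tau> * emeasure lborel (cball x r)" if t: "0 < t" "t \<le> 1" for t
  proof -
    have tr: "0 < t * r" "t * r \<le> r" using t r by (auto simp: mult_le_cancel_right1)
    \<comment> \<open>The affine map is the dilation with centre \<open>x\<close> and factor
      \<open>t\<close>, written as a translation plus a multiple to fit the substitution
      rule.\<close>
    have eq: "indicator (cball x (t * r)) (x - t *\<^sub>R x + t *\<^sub>R z) = (indicator (cball x r) z :: ennreal)" for z
    proof -
      have "x - (x - t *\<^sub>R x + t *\<^sub>R z) = t *\<^sub>R (x - z)" by (simp add: algebra_simps)
      then have "dist x (x - t *\<^sub>R x + t *\<^sub>R z) = t * dist x z" using t by (simp add: dist_norm)
      then show ?thesis using t by (simp add: indicator_def)
    qed
    have pt: "x + t *\<^sub>R (z - x) = x - t *\<^sub>R x + t *\<^sub>R z" for z by (simp add: algebra_simps)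
    have sc: "emeasure lborel (cball x (t * r)) = ennreal (t ^ ?n) * emeasure lborel (cball x r)"
      unfolding emeasure_lborel_cball_scale [OF tr(1)] emeasure_lborel_cball_scale [OF r]
      using t r by (simp add: power_mult_distrib ennreal_mult mult.assoc)
    have "(\<integral>\<^sup>+z\<in>cball x (t * r). ennreal (norm (G z)) \<partial>lborel) = ennreal (\<bar>t\<bar> ^ ?n) *
        (\<integral>\<^sup>+z. ennreal (norm (G (x - t *\<^sub>R x + t *\<^sub>R z))) * indicator (cball x (t * r)) (x - t *\<^sub>R x + t *\<^sub>R z) \<partial>lborel)"
      by (rule nn_integral_lborel_affine, measurable) (use t in simp)
    also have "\<dots> = ennreal (t ^ ?n) * (\<integral>\<^sup>+z. ennreal (norm (G (x + t *\<^sub>R (z - x)))) * indicator (cball x r) z \<partial>lborel)"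
      using t by (simp only: eq pt abs_of_pos)
    finally have "ennreal (t ^ ?n) * (\<integral>\<^sup>+z. ennreal (norm (G (x + t *\<^sub>R (z - x)))) * indicator (cball x r) z \<partial>lborel)
       = (\<integral>\<^sup>+z\<in>cball x (t * r). ennreal (norm (G z)) \<partial>lborel)" ..
    also have "\<dots> \<le> ennreal \<tau> * emeasure lborel (cball x (t * r))" by (rule M [OF tr])
    also have "\<dots> = ennreal (t ^ ?n) * (ennreal \<tau> * emeasure lborel (cball x r))"
      unfolding sc by (simp add: mult_ac)
    finally show ?thesis
      using t by (subst (asm) ennreal_mult_le_mult_iff) auto
  qed
  have "(\<integral>\<^sup>+z\<in>cball x r. ennreal \<bar>v z - v x\<bar> \<partial>lborel) \<le>
      (\<integral>\<^sup>+z. (\<integral>\<^sup>+t. ennreal r * (indicator {0..1} t * (ennreal (norm (G (x + t *\<^sub>R (z - x)))) * indicator (cball x r) z)) \<partial>lborel) \<partial>lborel)"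
    by (rule nn_integral_mono) (rule pt)
  also have "\<dots> = (\<integral>\<^sup>+t. (\<integral>\<^sup>+z. ennreal r * (indicator {0..1} t * (ennreal (norm (G (x + t *\<^sub>R (z - x)))) * indicator (cball x r) z)) \<partial>lborel) \<partial>lborel)"
    by (rule lborel_pair.Fubini') measurable
  also have "\<dots> \<le> (\<integral>\<^sup>+t. ennreal r * (ennreal \<tau> * emeasure lborel (cball x r)) * indicator {0..1} (t::real) \<partial>lborel)"
  proof (rule nn_integral_mono_AE)
    show "AE t in lborel. (\<integral>\<^sup>+z. ennreal r * (indicator {0..1} t * (ennreal (norm (G (x + t *\<^sub>R (z - x)))) * indicator (cball x r) z)) \<partial>lborel)
       \<le> ennreal r * (ennreal \<tau> * emeasure lborel (cball x r)) * indicator {0..1} t"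
      \<comment> \<open>At \<open>t = 0\<close> the dilation degenerates; this one parameter is a
        null set.\<close>
      using AE_lborel_singleton [of "0::real"]
    proof eventually_elim
      case (elim t)
      show ?case
      proof (cases "t \<in> {0..1}")
        case True
        then have "0 < t" "t \<le> 1" using elim by auto
        moreover have "(\<lambda>z. ennreal (norm (G (x + t *\<^sub>R (z - x)))) * indicator (cball x r) z) \<in> borel_measurable lborel"
          by measurable
        ultimately show ?thesis using True slice [of t]
          by (simp add: nn_integral_cmult mult_left_mono)
      qed simp
    qed
  qed
  also have "\<dots> = ennreal (r * \<tau>) * emeasure lborel (cball x r)"
    using r \<tau> by (subst nn_integral_cmult_indicator) (auto simp: ennreal_mult mult_ac)
  finally show ?thesis .
qed

text \<open>Both values are compared with \<open>v z\<close>, averaged over the ball about the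
  midpoint with half the distance as radius, which lies in the balls of radius
  \<open>dist x y\<close> about both points. The volume ratio is 2 to the dimension, and there are
  two terms, hence the constant.\<close>

lemma maximal_two_point_estimate:
  fixes v :: "real^'n::finite \<Rightarrow> real" and G :: "real^'n \<Rightarrow> real^'n"
  assumes v: "\<And>z. z \<in> cball x (dist x y) \<union> cball y (dist x y) \<Longrightarrow> (v has_derivative (\<lambda>h. h \<bullet> G z)) (at z)"
    and G: "continuous_on UNIV G" and \<tau>: "0 \<le> \<tau>"
    and M: "\<And>t w. w \<in> {x, y} \<Longrightarrow> 0 < t \<Longrightarrow> t \<le> dist x y \<Longrightarrow>
       (\<integral>\<^sup>+z\<in>cball w t. ennreal (norm (G z)) \<partial>lborel) \<le> ennreal \<tau> * emeasure lborel (cball w t)"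
  shows "\<bar>v x - v y\<bar> \<le> 2 ^ (DIM(real^'n) + 1) * \<tau> * dist x y"
proof (cases "x = y")
  case False
  let ?n = "DIM(real^'n)"
  define d where "d = dist x y"
  define m where "m = midpoint x y"
  have d: "0 < d" using False by (simp add: d_def)
  have vc: "continuous_on (cball w d) v" if "w \<in> {x, y}" for w
    by (intro continuous_at_imp_continuous_on ballI, rule has_derivative_continuous [OF v])
      (use that in \<open>auto simp: d_def\<close>)
  have sub: "cball m (d / 2) \<subseteq> cball w d" if "w \<in> {x, y}" for w
  proof
    fix z assume "z \<in> cball m (d / 2)"
    moreover have "dist w m = d / 2" using that by (auto simp: m_def d_def dist_midpoint dist_commute)
    ultimately show "z \<in> cball w d" using dist_triangle [of w z m] by auto
  qed
  have est: "(\<integral>\<^sup>+z\<in>cball m (d/2). ennreal \<bar>v z - v w\<bar> \<partial>lborel) \<le> ennreal (d * \<tau>) * emeasure lborel (cball w d)"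
    if w: "w \<in> {x, y}" for w
  proof -
    have "(\<integral>\<^sup>+z\<in>cball m (d/2). ennreal \<bar>v z - v w\<bar> \<partial>lborel) \<le> (\<integral>\<^sup>+z\<in>cball w d. ennreal \<bar>v z - v w\<bar> \<partial>lborel)"
      by (rule nn_integral_mono) (use sub [OF w] in \<open>auto simp: indicator_def\<close>)
    also have "\<dots> \<le> ennreal (d * \<tau>) * emeasure lborel (cball w d)"
      by (rule radial_segment_average [OF _ G d \<tau>]) (use v M [OF w] w in \<open>auto simp: d_def\<close>)
    finally show ?thesis .
  qed
  have meas: "(\<lambda>z. ennreal \<bar>v z - v w\<bar> * indicator (cball m (d/2)) z) \<in> borel_measurable lborel" if w: "w \<in> {x, y}" for w
  proof -
    have "continuous_on (cball m (d/2)) (\<lambda>z. \<bar>v z - v w\<bar>)"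
      by (intro continuous_intros continuous_on_subset [OF vc [OF w] sub [OF w]])
    from borel_integrable_compact [OF compact_cball this]
    have "(\<lambda>z. indicator (cball m (d/2)) z *\<^sub>R \<bar>v z - v w\<bar>) \<in> borel_measurable lborel" by auto
    moreover have "(\<lambda>z. ennreal \<bar>v z - v w\<bar> * indicator (cball m (d/2)) z)
        = (\<lambda>z. ennreal (indicator (cball m (d/2)) z *\<^sub>R \<bar>v z - v w\<bar>))"
      by (auto simp: indicator_def fun_eq_iff)
    ultimately show ?thesis by (simp only: measurable_compose [OF _ measurable_ennreal])
  qed
  let ?c = "emeasure lborel (cball m (d / 2))"
  have c: "?c \<noteq> 0" "?c \<noteq> \<infinity>"
  proof -
    show "?c \<noteq> \<infinity>" using emeasure_lborel_cball_finite [of m "d/2"] by auto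
    have "negligible (cball m (d / 2)) \<Longrightarrow> False" using d negligible_subset [of "cball m (d/2)" "ball m (d/2)"]
      by (metis ball_eq_empty ball_subset_cball half_gt_zero not_le open_ball open_not_negligible)
    then show "?c \<noteq> 0" by (auto simp: negligible_iff_emeasure0)
  qed
  have sc: "emeasure lborel (cball w d) = ennreal (2 ^ ?n) * ?c" for w :: "real^'n"
  proof -
    have h: "0 < d / 2" using d by simp
    show ?thesis unfolding emeasure_lborel_cball_scale [OF d] emeasure_lborel_cball_scale [OF h]
      using d by (simp add: power_divide mult.assoc [symmetric] flip: ennreal_mult)
  qed
  have "ennreal \<bar>v x - v y\<bar> * ?c = (\<integral>\<^sup>+z\<in>cball m (d/2). ennreal \<bar>v x - v y\<bar> \<partial>lborel)"
    by (rule nn_integral_cmult_indicator [symmetric]) auto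
  also have "\<dots> \<le> (\<integral>\<^sup>+z. ennreal \<bar>v z - v x\<bar> * indicator (cball m (d/2)) z + ennreal \<bar>v z - v y\<bar> * indicator (cball m (d/2)) z \<partial>lborel)"
    by (rule nn_integral_mono) (auto simp: indicator_def simp flip: ennreal_plus)
  also have "\<dots> = (\<integral>\<^sup>+z\<in>cball m (d/2). ennreal \<bar>v z - v x\<bar> \<partial>lborel) + (\<integral>\<^sup>+z\<in>cball m (d/2). ennreal \<bar>v z - v y\<bar> \<partial>lborel)"
    by (rule nn_integral_add) (use meas in auto)
  also have "\<dots> \<le> ennreal (d * \<tau>) * (ennreal (2 ^ ?n) * ?c) + ennreal (d * \<tau>) * (ennreal (2 ^ ?n) * ?c)"
    using est [of x] est [of y] by (intro add_mono) (auto simp: sc)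
  also have "\<dots> = ennreal (2 ^ (?n + 1) * \<tau> * d) * ?c"
  proof -
    have "ennreal (d * \<tau>) * (ennreal (2 ^ ?n) * ?c) = ennreal (d * \<tau> * 2 ^ ?n) * ?c"
      using d \<tau> by (simp add: mult.assoc [symmetric] flip: ennreal_mult)
    moreover have "ennreal (d * \<tau> * 2 ^ ?n) + ennreal (d * \<tau> * 2 ^ ?n) = ennreal (2 ^ (?n + 1) * \<tau> * d)"
      using d \<tau> by (subst ennreal_plus [symmetric]) (auto simp: algebra_simps)
    ultimately show ?thesis by (simp only: distrib_right [symmetric])
  qed
  finally have "?c * ennreal \<bar>v x - v y\<bar> \<le> ?c * ennreal (2 ^ (?n + 1) * \<tau> * d)"
    by (simp add: mult.commute)
  then have "ennreal \<bar>v x - v y\<bar> \<le> ennreal (2 ^ (?n + 1) * \<tau> * d)"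
    using c by (subst (asm) ennreal_mult_le_mult_iff) auto
  then show ?thesis using d \<tau> by (subst (asm) ennreal_le_iff) (auto simp: d_def)
qed simp

text \<open>Continuity from below along an enumeration of \<open>C\<close>. It lets the covering
  argument below work with finite sums.\<close>

lemma emeasure_countable_UN_le:
  fixes B c :: ennreal
  assumes C: "countable C" and A: "\<And>x. x \<in> C \<Longrightarrow> A x \<in> sets M"
    and fin: "\<And>F. finite F \<Longrightarrow> F \<subseteq> C \<Longrightarrow> c * emeasure M (\<Union>x\<in>F. A x) \<le> B"
  shows "c * emeasure M (\<Union>x\<in>C. A x) \<le> B"
proof (cases "C = {}")
  case True
  then show ?thesis by simp
next
  case False
  let ?e = "from_nat_into C"
  have e: "range ?e = C" using range_from_nat_into [OF False C] .
  define U where "U n = (\<Union>x\<in>?e ` {..n}. A x)" for n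
  have "(\<Union>x\<in>C. A x) = (\<Union>n. U n)"
    unfolding U_def by (subst e [symmetric]) auto
  moreover have "emeasure M (\<Union>n. U n) = (SUP n. emeasure M (U n))"
  proof (rule SUP_emeasure_incseq [symmetric])
    show "range U \<subseteq> sets M" unfolding U_def using A from_nat_into [OF False] by (auto intro!: sets.finite_UN)
    show "incseq U" unfolding U_def incseq_def by (auto intro: order_trans)
  qed
  moreover have "c * emeasure M (U n) \<le> B" for n
    unfolding U_def by (rule fin) (use from_nat_into [OF False] in auto)
  ultimately show ?thesis by (simp only: SUP_mult_left_ennreal SUP_least)
qed

text \<open>The Hardy-Littlewood weak type estimate for radii up to \<open>R\<close>, by Vitali's
  covering lemma; the enlargement of the radii by 5 accounts for the constant. The exceptional set
  \<open>N\<close> is the union of the enlarged balls and not the set where the maximal function is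
  large, so it is Borel by construction and \<open>S\<close> may be arbitrary.\<close>

lemma maximal_weak_type:
  fixes f :: "real^'n::finite \<Rightarrow> ennreal"
  assumes f [measurable]: "f \<in> borel_measurable borel" and T: "T \<in> sets borel"
    and sub: "\<And>x t. x \<in> S \<Longrightarrow> 0 < t \<Longrightarrow> t \<le> R \<Longrightarrow> cball x t \<subseteq> T"
  obtains N where "N \<in> sets borel"
    "ennreal \<tau> * emeasure lborel N \<le> ennreal (5 ^ DIM(real^'n)) * (\<integral>\<^sup>+z\<in>T. f z \<partial>lborel)"
    "\<And>x t. x \<in> S - N \<Longrightarrow> 0 < t \<Longrightarrow> t \<le> R \<Longrightarrow>
       (\<integral>\<^sup>+z\<in>cball x t. f z \<partial>lborel) \<le> ennreal \<tau> * emeasure lborel (cball x t)"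
proof -
  let ?n = "DIM(real^'n)"
  define E where "E = {x \<in> S. \<exists>t. 0 < t \<and> t \<le> R \<and>
      ennreal \<tau> * emeasure lborel (cball x t) < (\<integral>\<^sup>+z\<in>cball x t. f z \<partial>lborel)}"
  have "\<exists>\<rho>. \<forall>x\<in>E. 0 < \<rho> x \<and> \<rho> x \<le> R \<and>
      ennreal \<tau> * emeasure lborel (cball x (\<rho> x)) < (\<integral>\<^sup>+z\<in>cball x (\<rho> x). f z \<partial>lborel)"
    by (rule bchoice) (auto simp: E_def)
  then obtain \<rho> where \<rho>: "\<And>x. x \<in> E \<Longrightarrow> 0 < \<rho> x \<and> \<rho> x \<le> R"
      "\<And>x. x \<in> E \<Longrightarrow> ennreal \<tau> * emeasure lborel (cball x (\<rho> x)) < (\<integral>\<^sup>+z\<in>cball x (\<rho> x). f z \<partial>lborel)"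
    by blast
  have "E \<subseteq> (\<Union>x\<in>E. cball x (\<rho> x))" using \<rho>(1) by (force intro: less_imp_le)
  from Vitali_covering_lemma_cballs [OF this \<rho>(1)]
  obtain C where C: "countable C" "C \<subseteq> E"
     "pairwise (\<lambda>i j. disjnt (cball i (\<rho> i)) (cball j (\<rho> j))) C"
     "E \<subseteq> (\<Union>x\<in>C. cball x (5 * \<rho> x))" by blast
  define N where "N = (\<Union>x\<in>C. cball x (5 * \<rho> x))"
  have "N \<in> sets borel" unfolding N_def using C(1) by (intro sets.countable_UN') auto
  moreover have "ennreal \<tau> * emeasure lborel N \<le> ennreal (5 ^ ?n) * (\<integral>\<^sup>+z\<in>T. f z \<partial>lborel)"
    unfolding N_def
  proof (rule emeasure_countable_UN_le [OF C(1)])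
    fix F assume F: "finite F" "F \<subseteq> C"
    have FE: "x \<in> E" if "x \<in> F" for x using F C(2) that by blast
    have disj: "disjoint_family_on (\<lambda>x. cball x (\<rho> x)) F"
      using C(3) F(2) unfolding disjoint_family_on_def pairwise_def disjnt_def by blast
    have "ennreal \<tau> * emeasure lborel (\<Union>x\<in>F. cball x (5 * \<rho> x))
        \<le> ennreal \<tau> * (\<Sum>x\<in>F. emeasure lborel (cball x (5 * \<rho> x)))"
      by (intro mult_left_mono emeasure_subadditive_finite F) auto
    also have "\<dots> = ennreal (5 ^ ?n) * (\<Sum>x\<in>F. ennreal \<tau> * emeasure lborel (cball x (\<rho> x)))"
    proof -
      have "emeasure lborel (cball x (5 * \<rho> x)) = ennreal (5 ^ ?n) * emeasure lborel (cball x (\<rho> x))" if "x \<in> F" for x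
      proof -
        have p: "0 < \<rho> x" "0 < 5 * \<rho> x" using \<rho>(1) [OF FE [OF that]] by auto
        show ?thesis unfolding emeasure_lborel_cball_scale [OF p(1)] emeasure_lborel_cball_scale [OF p(2)]
          using p by (simp add: power_mult_distrib ennreal_mult mult.assoc)
      qed
      then show ?thesis by (simp add: sum_distrib_left mult_ac)
    qed
    also have "\<dots> \<le> ennreal (5 ^ ?n) * (\<Sum>x\<in>F. \<integral>\<^sup>+z\<in>cball x (\<rho> x). f z \<partial>lborel)"
      by (intro mult_left_mono sum_mono less_imp_le \<rho>(2) FE) auto
    also have "(\<Sum>x\<in>F. \<integral>\<^sup>+z\<in>cball x (\<rho> x). f z \<partial>lborel) = (\<integral>\<^sup>+z. (\<Sum>x\<in>F. f z * indicator (cball x (\<rho> x)) z) \<partial>lborel)"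
      by (rule nn_integral_sum [symmetric]) measurable
    also have "\<dots> \<le> (\<integral>\<^sup>+z\<in>T. f z \<partial>lborel)"
    proof (rule nn_integral_mono)
      fix z
      have "(\<Sum>x\<in>F. indicator (cball x (\<rho> x)) z) = (indicator (\<Union>x\<in>F. cball x (\<rho> x)) z :: ennreal)"
        by (rule indicator_UN_disjoint [OF F(1) disj, symmetric])
      moreover have "(\<Union>x\<in>F. cball x (\<rho> x)) \<subseteq> T" using sub \<rho>(1) FE by (fastforce simp: E_def)
      then have "indicator (\<Union>x\<in>F. cball x (\<rho> x)) z \<le> (indicator T z :: ennreal)"
        by (auto simp: indicator_def subset_iff)
      ultimately have "(\<Sum>x\<in>F. indicator (cball x (\<rho> x)) z) \<le> (indicator T z :: ennreal)"
        by (simp only:)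
      from mult_left_mono [OF this, of "f z"]
      show "(\<Sum>x\<in>F. f z * indicator (cball x (\<rho> x)) z) \<le> f z * indicator T z"
        by (simp only: sum_distrib_left zero_le)
    qed
    finally show "ennreal \<tau> * emeasure lborel (\<Union>x\<in>F. cball x (5 * \<rho> x))
        \<le> ennreal (5 ^ ?n) * (\<integral>\<^sup>+z\<in>T. f z \<partial>lborel)"
      by (simp add: mult_left_mono)
  qed auto
  moreover have "(\<integral>\<^sup>+z\<in>cball x t. f z \<partial>lborel) \<le> ennreal \<tau> * emeasure lborel (cball x t)"
    if "x \<in> S - N" "0 < t" "t \<le> R" for x t
  proof (rule ccontr)
    assume "\<not> ?thesis"
    then have "x \<in> E" using that by (auto simp: E_def not_le)
    then show False using C(4) that by (auto simp: N_def)
  qed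
  ultimately show ?thesis using that by blast
qed

section \<open>Differentiability of Sobolev functions relative to large sets\<close>

lemma telescope_bound:
  fixes w :: "nat \<Rightarrow> real"
  assumes "\<And>k. \<bar>w (Suc k) - w k\<bar> \<le> B * (1/2) ^ k" "k \<le> m" "0 \<le> B"
  shows "\<bar>w m - w k\<bar> \<le> 2 * B * (1/2) ^ k"
proof -
  \<comment> \<open>The subtracted tail makes the bound inductive: each step uses exactly the
    difference of two consecutive tails.\<close>
  have "\<bar>w m - w k\<bar> \<le> 2 * B * ((1/2) ^ k - (1/2) ^ m)"
    using assms(2)
  proof (induction m rule: dec_induct)
    case (step m)
    then show ?case using assms(1) [of m] by (simp add: algebra_simps)
  qed simp
  also have "\<dots> \<le> 2 * B * (1/2) ^ k" using assms(3) by (simp add: algebra_simps)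
  finally show ?thesis .
qed

text \<open>Two kinds of points are removed: \<open>N k\<close>, where averages of the increment
  \<open>E k\<close> of the gradients exceed its threshold, and \<open>P k\<close>, where the k-th
  gradient is still far from \<open>g\<close>. Both thresholds are of order \<open>(1/2) ^ k\<close>
  while the L1 errors are of order \<open>(1/4) ^ k\<close>, so the removed sets have summable
  measure. On the rest the increments of the functions have summable Lipschitz constants.\<close>

lemma weak_grad_differentiable_within_ball:
  fixes u :: "real^'n::finite \<Rightarrow> real"
  assumes \<Omega>: "open \<Omega>" and u: "continuous_on \<Omega> u" and wg: "is_weak_grad \<Omega> u g"
    and R: "0 < R" "cball a (3 * R) \<subseteq> \<Omega>" and \<epsilon>: "0 < \<epsilon>"
  obtains A where "A \<in> sets lebesgue" "A \<subseteq> ball a R" "emeasure lebesgue (ball a R - A) \<le> ennreal \<epsilon>"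
    "\<And>x. x \<in> A \<Longrightarrow> (u has_derivative (\<lambda>h. h \<bullet> g x)) (at x within A)"
proof -
  let ?n = "DIM(real^'n)"
  \<comment> \<open>Two points of \<open>ball a R\<close> have distance below \<open>2 * R\<close>,
    and balls of that radius about them stay within distance \<open>3 * R\<close> of
    \<open>a\<close>.\<close>
  define K where "K = cball a (3 * R)"
  have K: "compact K" "K \<subseteq> \<Omega>" using R by (auto simp: K_def)
  have Kb: "K \<in> sets borel" by (simp add: K_def)
  obtain W v G where W: "open W" "K \<subseteq> W" "W \<subseteq> \<Omega>"
    and vd: "\<And>k x. x \<in> W \<Longrightarrow> (v k has_derivative (\<lambda>h. h \<bullet> G k x)) (at x)"
    and Gc: "\<And>k. continuous_on UNIV (G k)"
    and ul: "uniform_limit K v u sequentially"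
    and L1: "\<And>i. (\<lambda>k::nat. \<integral>\<^sup>+x\<in>K. ennreal \<bar>G k x $ i - g x $ i\<bar> \<partial>lebesgue) \<longlonglongrightarrow> 0"
  proof (rule weak_grad_C1_approx [OF \<Omega> wg u K], goal_cases)
    case (1 W v G)
    show ?case by (rule 1(1) [OF 1(2-8)])
  qed
  have gm: "(\<lambda>x. indicator K x * g x $ i) \<in> borel_measurable lebesgue" for i
    using loc_integrable_compact [OF _ K, of "\<lambda>x. g x $ i"] wg by (auto simp: is_weak_grad_def)
  have Gb [measurable]: "G k \<in> borel_measurable borel" for k
    by (rule borel_measurable_continuous_onI [OF Gc])
  have Gm: "(\<lambda>x. G k x $ i) \<in> borel_measurable lebesgue" for k i
    by (rule continuous_borel_measurable_lebesgue [OF continuous_on_component [OF Gc]])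
  have Km: "indicator K \<in> borel_measurable lebesgue" using Kb by (intro borel_measurable_indicator) auto
  have dm: "(\<lambda>x. ennreal \<bar>G k x $ i - g x $ i\<bar> * indicator K x) \<in> borel_measurable lebesgue" for k i
  proof -
    have "(\<lambda>x. ennreal \<bar>indicator K x * G k x $ i - indicator K x * g x $ i\<bar>) \<in> borel_measurable lebesgue"
      using gm Gm Km by measurable
    moreover have "(\<lambda>x. ennreal \<bar>G k x $ i - g x $ i\<bar> * indicator K x)
        = (\<lambda>x. ennreal \<bar>indicator K x * G k x $ i - indicator K x * g x $ i\<bar>)"
      by (auto simp: indicator_def fun_eq_iff)
    ultimately show ?thesis by (simp only:)
  qed
  define \<delta> where "\<delta> k = (\<Sum>i\<in>UNIV. \<integral>\<^sup>+x\<in>K. ennreal \<bar>G k x $ i - g x $ i\<bar> \<partial>lebesgue)" for k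
  have "\<delta> \<longlonglongrightarrow> (\<Sum>i\<in>(UNIV::'n set). 0)" unfolding \<delta>_def by (intro tendsto_sum L1)
  then have \<delta>0: "\<delta> \<longlonglongrightarrow> 0" by simp
  define D where "D k x = (\<Sum>i\<in>UNIV. ennreal \<bar>G k x $ i - g x $ i\<bar>) * indicator K x" for k x
  have Dm [measurable]: "D k \<in> borel_measurable lebesgue" for k
    unfolding D_def sum_distrib_right by (intro borel_measurable_sum dm)
  have D\<delta>: "(\<integral>\<^sup>+x. D k x \<partial>lebesgue) = \<delta> k" for k
    unfolding D_def \<delta>_def sum_distrib_right by (rule nn_integral_sum) (rule dm)
  have nD: "ennreal (norm (G k x - g x)) \<le> D k x" if "x \<in> K" for k x
  proof -
    have "ennreal (norm (G k x - g x)) \<le> ennreal (\<Sum>i\<in>UNIV. \<bar>(G k x - g x) $ i\<bar>)"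
      by (intro ennreal_leI norm_le_l1_cart)
    also have "\<dots> = D k x" using that by (simp add: D_def sum_ennreal)
    finally show ?thesis .
  qed
  \<comment> \<open>Chosen so that the geometric series of the bounds for \<open>N k\<close> and
    \<open>P k\<close>, with the weak type constant and the two error terms in \<open>E k\<close>,
    adds up to exactly \<open>\<epsilon>\<close>.\<close>
  define \<eta> where "\<eta> = \<epsilon> / (2 * (2 * 5 ^ ?n + 1))"
  have \<eta>: "0 < \<eta>" using \<epsilon> by (simp add: \<eta>_def add_pos_pos)
  \<comment> \<open>The condition \<open>k \<le> m\<close> makes the selected indices tend to
    infinity; they need not be monotone.\<close>
  have "\<exists>m. \<delta> m < ennreal (\<eta> * (1/4) ^ k) \<and> k \<le> m" for k :: nat
  proof -
    have "0 < ennreal (\<eta> * (1/4) ^ k)" using \<eta> by simp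
    from order_tendstoD(2) [OF \<delta>0 this]
    obtain M where "\<And>m. M \<le> m \<Longrightarrow> \<delta> m < ennreal (\<eta> * (1/4) ^ k)" by (auto simp: eventually_sequentially)
    then show ?thesis by (intro exI [of _ "max M k"]) auto
  qed
  then obtain s where s: "\<And>k. \<delta> (s k) < ennreal (\<eta> * (1/4) ^ k)" "\<And>k. k \<le> s k" by metis
  have sl: "filterlim s sequentially sequentially"
    by (rule filterlim_at_top_mono [OF filterlim_ident]) (use s(2) in auto)
  define E where "E k z = G (s (Suc k)) z - G (s k) z" for k z
  have Ec: "continuous_on UNIV (E k)" for k unfolding E_def by (intro continuous_intros Gc)
  have Eb [measurable]: "E k \<in> borel_measurable borel" for k
    by (rule borel_measurable_continuous_onI [OF Ec])
  have EI: "(\<integral>\<^sup>+z\<in>K. ennreal (norm (E k z)) \<partial>lborel) \<le> ennreal (2 * \<eta> * (1/4) ^ k)" for k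
  proof -
    have "(\<integral>\<^sup>+z\<in>K. ennreal (norm (E k z)) \<partial>lborel) = (\<integral>\<^sup>+z\<in>K. ennreal (norm (E k z)) \<partial>lebesgue)"
      by (simp add: nn_integral_completion)
    also have "\<dots> \<le> (\<integral>\<^sup>+z. D (s (Suc k)) z + D (s k) z \<partial>lebesgue)"
    proof (rule nn_integral_mono)
      fix z
      show "ennreal (norm (E k z)) * indicator K z \<le> D (s (Suc k)) z + D (s k) z"
      proof (cases "z \<in> K")
        case True
        have "norm (E k z) \<le> norm (G (s (Suc k)) z - g z) + norm (G (s k) z - g z)"
          using norm_triangle_ineq4 [of "G (s (Suc k)) z - g z" "G (s k) z - g z"] by (simp add: E_def)
        then have "ennreal (norm (E k z)) \<le> ennreal (norm (G (s (Suc k)) z - g z)) + ennreal (norm (G (s k) z - g z))"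
          by (simp add: ennreal_leI flip: ennreal_plus)
        also have "\<dots> \<le> D (s (Suc k)) z + D (s k) z" by (intro add_mono nD True)
        finally show ?thesis using True by simp
      qed simp
    qed
    also have "\<dots> = \<delta> (s (Suc k)) + \<delta> (s k)" by (simp add: nn_integral_add D\<delta>)
    also have "\<dots> \<le> ennreal (\<eta> * (1/4) ^ k) + ennreal (\<eta> * (1/4) ^ k)"
    proof (rule add_mono)
      have "\<delta> (s (Suc k)) \<le> ennreal (\<eta> * (1/4) ^ Suc k)" using s(1) [of "Suc k"] by simp
      also have "\<dots> \<le> ennreal (\<eta> * (1/4) ^ k)" using \<eta> by (intro ennreal_leI mult_left_mono) auto
      finally show "\<delta> (s (Suc k)) \<le> ennreal (\<eta> * (1/4) ^ k)" .
    qed (use s(1) [of k] in simp)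
    also have "\<dots> = ennreal (2 * \<eta> * (1/4) ^ k)" using \<eta> by (simp flip: ennreal_plus)
    finally show ?thesis .
  qed
  have sub: "cball x t \<subseteq> K" if "x \<in> ball a R" "t \<le> 2 * R" for x t
  proof
    fix z assume "z \<in> cball x t"
    then show "z \<in> K" using that dist_triangle [of a z x] by (auto simp: K_def)
  qed
  define Q where "Q k N \<longleftrightarrow> N \<in> sets borel \<and>
     ennreal ((1/2) ^ k) * emeasure lborel N \<le> ennreal (5 ^ ?n) * ennreal (2 * \<eta> * (1/4) ^ k) \<and>
     (\<forall>x t. x \<in> ball a R - N \<longrightarrow> 0 < t \<longrightarrow> t \<le> 2 * R \<longrightarrow>
       (\<integral>\<^sup>+z\<in>cball x t. ennreal (norm (E k z)) \<partial>lborel) \<le> ennreal ((1/2) ^ k) * emeasure lborel (cball x t))"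
    for k N
  have "\<exists>N. Q k N" for k
  proof -
    have m: "(\<lambda>z. ennreal (norm (E k z))) \<in> borel_measurable borel" by measurable
    obtain N where N: "N \<in> sets borel"
      "ennreal ((1/2) ^ k) * emeasure lborel N \<le> ennreal (5 ^ ?n) * (\<integral>\<^sup>+z\<in>K. ennreal (norm (E k z)) \<partial>lborel)"
      "\<And>x t. x \<in> ball a R - N \<Longrightarrow> 0 < t \<Longrightarrow> t \<le> 2 * R \<Longrightarrow>
       (\<integral>\<^sup>+z\<in>cball x t. ennreal (norm (E k z)) \<partial>lborel) \<le> ennreal ((1/2) ^ k) * emeasure lborel (cball x t)"
      using maximal_weak_type [OF m Kb sub, of "ball a R" "2 * R" "(1/2) ^ k"] by blast
    have "ennreal (5 ^ ?n) * (\<integral>\<^sup>+z\<in>K. ennreal (norm (E k z)) \<partial>lborel) \<le> ennreal (5 ^ ?n) * ennreal (2 * \<eta> * (1/4) ^ k)"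
      by (rule mult_left_mono [OF EI]) simp
    with N have "Q k N" unfolding Q_def by (meson order_trans)
    then show ?thesis ..
  qed
  then obtain N where NQ: "\<And>k. Q k (N k)" by metis
  have N: "\<And>k. N k \<in> sets borel"
      "\<And>k. ennreal ((1/2) ^ k) * emeasure lborel (N k) \<le> ennreal (5 ^ ?n) * ennreal (2 * \<eta> * (1/4) ^ k)"
      "\<And>k x t. x \<in> ball a R - N k \<Longrightarrow> 0 < t \<Longrightarrow> t \<le> 2 * R \<Longrightarrow>
       (\<integral>\<^sup>+z\<in>cball x t. ennreal (norm (E k z)) \<partial>lborel) \<le> ennreal ((1/2) ^ k) * emeasure lborel (cball x t)"
    using NQ unfolding Q_def by blast+
  \<comment> \<open>Markov's inequality with threshold \<open>(1/2) ^ k\<close>, multiplied out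
    because \<open>D\<close> takes values in \<open>ennreal\<close>.\<close>
  define P where "P k = {x \<in> space lebesgue. 1 \<le> ennreal (2 ^ k) * D (s k) x}" for k
  have Pm: "P k \<in> sets lebesgue" for k unfolding P_def by measurable
  have two: "ennreal (2 ^ k) * ennreal ((1/2) ^ k) = 1" for k
    by (simp add: power_one_over flip: ennreal_mult)
  have quarter: "(2::real) ^ k * (c * (1/4) ^ k) = c * (1/2) ^ k" for c k
    by (simp add: power_divide power_mult_distrib [symmetric] flip: power_mult_distrib) (simp add: field_simps flip: power_mult_distrib)
  have Nsmall: "emeasure lebesgue (N k) \<le> ennreal (5 ^ ?n * (2 * \<eta>) * (1/2) ^ k)" for k
  proof -
    have "emeasure lebesgue (N k) = ennreal (2 ^ k) * (ennreal ((1/2) ^ k) * emeasure lborel (N k))"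
      using N(1) two [of k] by (simp add: mult.assoc [symmetric])
    also have "\<dots> \<le> ennreal (2 ^ k) * (ennreal (5 ^ ?n) * ennreal (2 * \<eta> * (1/4) ^ k))"
      by (rule mult_left_mono [OF N(2)]) simp
    also have "\<dots> = ennreal (2 ^ k * (5 ^ ?n * (2 * \<eta> * (1/4) ^ k)))"
      using \<eta> by (simp flip: ennreal_mult)
    also have "2 ^ k * (5 ^ ?n * (2 * \<eta> * (1/4) ^ k)) = 5 ^ ?n * (2 * \<eta>) * (1/2) ^ k"
      using quarter [of k "5 ^ ?n * (2 * \<eta>)"] by (simp add: mult_ac)
    finally show ?thesis .
  qed
  have Psmall: "emeasure lebesgue (P k) \<le> ennreal (\<eta> * (1/2) ^ k)" for k
  proof -
    have "emeasure lebesgue (P k) \<le> ennreal (2 ^ k) * (\<integral>\<^sup>+x. D (s k) x * indicator (space lebesgue) x \<partial>lebesgue)"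
      unfolding P_def by (rule nn_integral_Markov_inequality) auto
    also have "\<dots> \<le> ennreal (2 ^ k) * ennreal (\<eta> * (1/4) ^ k)"
      using s(1) [of k] by (intro mult_left_mono) (auto simp: D\<delta>)
    also have "\<dots> = ennreal (\<eta> * (1/2) ^ k)" using \<eta> quarter [of k \<eta>] by (simp flip: ennreal_mult)
    finally show ?thesis .
  qed
  define A where "A = ball a R - (\<Union>k. N k \<union> P k)"
  have NPm: "N k \<union> P k \<in> sets lebesgue" for k using N(1) Pm by auto
  have A: "A \<in> sets lebesgue" unfolding A_def using NPm by (intro sets.Diff sets.countable_UN) auto
  have small: "emeasure lebesgue (ball a R - A) \<le> ennreal \<epsilon>"
  proof -
    have "emeasure lebesgue (ball a R - A) \<le> emeasure lebesgue (\<Union>k. N k \<union> P k)"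
      by (rule emeasure_mono) (use NPm in \<open>auto simp: A_def\<close>)
    also have "\<dots> \<le> (\<Sum>k. emeasure lebesgue (N k \<union> P k))"
      by (rule emeasure_subadditive_countably) (use NPm in auto)
    also have "\<dots> \<le> (\<Sum>k. ennreal ((5 ^ ?n * (2 * \<eta>) + \<eta>) * (1/2) ^ k))"
    proof (rule suminf_le)
      fix k
      have "emeasure lebesgue (N k \<union> P k) \<le> emeasure lebesgue (N k) + emeasure lebesgue (P k)"
        by (rule emeasure_subadditive) (use N Pm in auto)
      also have "\<dots> \<le> ennreal (5 ^ ?n * (2 * \<eta>) * (1/2) ^ k) + ennreal (\<eta> * (1/2) ^ k)"
        by (intro add_mono Nsmall Psmall)
      also have "\<dots> = ennreal ((5 ^ ?n * (2 * \<eta>) + \<eta>) * (1/2) ^ k)"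
        using \<eta> by (simp add: distrib_right flip: ennreal_plus)
      finally show "emeasure lebesgue (N k \<union> P k) \<le> ennreal ((5 ^ ?n * (2 * \<eta>) + \<eta>) * (1/2) ^ k)" .
    qed auto
    also have "\<dots> = ennreal (\<Sum>k. (5 ^ ?n * (2 * \<eta>) + \<eta>) * (1/2) ^ k)"
      using \<eta> by (intro suminf_ennreal2) (auto intro!: summable_mult summable_geometric)
    also have "(\<Sum>k. (5 ^ ?n * (2 * \<eta>) + \<eta>) * (1/2 :: real) ^ k) = (5 ^ ?n * (2 * \<eta>) + \<eta>) * 2"
      by (subst suminf_mult) (auto intro!: summable_geometric simp: suminf_geometric)
    also have "\<dots> = \<epsilon>"
    proof -
      have "(5 ^ ?n * (2 * \<eta>) + \<eta>) * 2 = \<eta> * (2 * (2 * 5 ^ ?n + 1))" by (simp add: algebra_simps)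
      also have "\<dots> = \<epsilon>" unfolding \<eta>_def by (rule nonzero_eq_divide_eq [THEN iffD1]) (auto simp: add_pos_pos pos_add_strict add_nonneg_eq_0_iff)
      finally show ?thesis .
    qed
    finally show ?thesis .
  qed
  \<comment> \<open>The constant of the two-point estimate times the factor 2 from summing the
    geometric series.\<close>
  define C where "C = (2 ^ (?n + 1) * 2 :: real)"
  have C: "0 < C" by (simp add: C_def)
  have AK: "x \<in> K" "x \<in> W" if "x \<in> A" for x
  proof -
    show "x \<in> K" using sub [of x 0] that R by (auto simp: A_def)
    then show "x \<in> W" using W by blast
  qed
  have Agrad: "norm (G (s k) x - g x) \<le> (1/2) ^ k" if "x \<in> A" for k x
  proof -
    have "x \<notin> P k" using that by (auto simp: A_def)
    then have "ennreal (2 ^ k) * D (s k) x \<le> 1" by (simp add: P_def not_le less_imp_le)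
    then have "ennreal (2 ^ k) * ennreal (norm (G (s k) x - g x)) \<le> 1"
      by (rule order_trans [rotated]) (intro mult_left_mono nD AK(1) [OF that] zero_le)
    then have "2 ^ k * norm (G (s k) x - g x) \<le> 1"
      by (simp flip: ennreal_mult)
    then show ?thesis by (simp add: power_one_over field_simps)
  qed
  have ptlim: "(\<lambda>m. v (s m) x) \<longlonglongrightarrow> u x" if "x \<in> K" for x
    using filterlim_compose [OF tendsto_uniform_limitI [OF ul that] sl] .
  \<comment> \<open>The two-point estimate controls each increment from index \<open>k\<close> on,
    since \<open>x\<close> and \<open>y\<close> avoid every \<open>N j\<close>. Telescoping and
    pointwise convergence then replace the last approximation by \<open>u\<close>.\<close>
  have key: "\<bar>(u x - v (s k) x) - (u y - v (s k) y)\<bar> \<le> C * (1/2) ^ k * dist x y" if xy: "x \<in> A" "y \<in> A" for x y k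
  proof -
    define w where "w j = v (s j) x - v (s j) y" for j
    have d: "dist x y \<le> 2 * R"
      using xy dist_triangle2 [of x y a] by (auto simp: A_def dist_commute)
    have "\<bar>w (Suc j) - w j\<bar> \<le> (2 ^ (?n + 1) * dist x y) * (1/2) ^ j" for j
    proof -
      let ?v = "\<lambda>z. v (s (Suc j)) z - v (s j) z"
      have "\<bar>?v x - ?v y\<bar> \<le> 2 ^ (?n + 1) * (1/2) ^ j * dist x y"
      proof (rule maximal_two_point_estimate [where G = "E j"])
        fix z assume "z \<in> cball x (dist x y) \<union> cball y (dist x y)"
        then have "z \<in> K" using sub [OF _ d, of x] sub [OF _ d, of y] xy by (auto simp: A_def)
        then have "z \<in> W" using W by blast
        from has_derivative_diff [OF vd [OF this] vd [OF this]]
        show "(?v has_derivative (\<lambda>h. h \<bullet> E j z)) (at z)"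
          by (simp add: E_def inner_diff_right)
      next
        fix t w assume "w \<in> {x, y}" "0 < t" "t \<le> dist x y"
        then show "(\<integral>\<^sup>+z\<in>cball w t. ennreal (norm (E j z)) \<partial>lborel) \<le> ennreal ((1/2) ^ j) * emeasure lborel (cball w t)"
          by (intro N(3)) (use xy d in \<open>auto simp: A_def\<close>)
      qed (use Ec in auto)
      then show ?thesis by (simp add: w_def algebra_simps)
    qed
    from telescope_bound [OF this]
    have tb: "\<bar>w m - w k\<bar> \<le> 2 * (2 ^ (?n + 1) * dist x y) * (1/2) ^ k" if "k \<le> m" for m using that by simp
    have "w \<longlonglongrightarrow> u x - u y" unfolding w_def by (intro tendsto_diff ptlim AK xy)
    then have "(\<lambda>m. \<bar>w m - w k\<bar>) \<longlonglongrightarrow> \<bar>(u x - u y) - w k\<bar>"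
      by (intro tendsto_intros)
    then have "\<bar>(u x - u y) - w k\<bar> \<le> 2 * (2 ^ (?n + 1) * dist x y) * (1/2) ^ k"
      by (rule tendsto_upperbound) (use tb in \<open>auto simp: eventually_sequentially\<close>)
    moreover have "(u x - v (s k) x) - (u y - v (s k) y) = (u x - u y) - w k" by (simp add: w_def)
    moreover have "2 * (2 ^ (?n + 1) * dist x y) * (1/2) ^ k = C * (1/2) ^ k * dist x y" by (simp add: C_def)
    ultimately show ?thesis by (simp only:)
  qed
  have "(u has_derivative (\<lambda>h. h \<bullet> g x)) (at x within A)" if x: "x \<in> A" for x
    unfolding has_derivative_within_alt
  proof (intro conjI allI impI)
    show "bounded_linear (\<lambda>h. h \<bullet> g x)" by (rule bounded_linear_inner_left)
    fix e :: real assume e: "0 < e"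
    \<comment> \<open>With \<open>k\<close> fixed here, the Lipschitz error of
      \<open>u - v (s k)\<close> and the deviation of the gradient at \<open>x\<close> together cost
      at most half of \<open>e\<close>. The other half is the classical differentiability of
      \<open>v (s k)\<close> at \<open>x\<close>.\<close>
    obtain k where k: "(1/2 :: real) ^ k < e / (2 * (C + 1))"
      using real_arch_pow_inv [of "e / (2 * (C + 1))" "1/2"] e C by auto
    have k': "(C + 1) * (1/2) ^ k \<le> e / 2"
    proof -
      have "(C + 1) * (1/2) ^ k \<le> (C + 1) * (e / (2 * (C + 1)))" using k C by (intro mult_left_mono) auto
      also have "\<dots> = e / 2" using C by (simp add: divide_simps)
      finally show ?thesis .
    qed
    obtain d where d: "0 < d" "\<And>y. norm (y - x) < d \<Longrightarrow>
        norm (v (s k) y - v (s k) x - (y - x) \<bullet> G (s k) x) \<le> e / 2 * norm (y - x)"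
      using vd [OF AK(2) [OF x], of "s k"] e unfolding has_derivative_at_alt by (meson half_gt_zero)
    show "\<exists>d>0. \<forall>y\<in>A. norm (y - x) < d \<longrightarrow> norm (u y - u x - (y - x) \<bullet> g x) \<le> e * norm (y - x)"
    proof (intro exI [of _ d] conjI ballI impI d(1))
      fix y assume y: "y \<in> A" "norm (y - x) < d"
      have 1: "\<bar>v (s k) y - v (s k) x - (y - x) \<bullet> G (s k) x\<bar> \<le> e / 2 * norm (y - x)" using d(2) [OF y(2)] by simp
      have 2: "\<bar>(u y - v (s k) y) - (u x - v (s k) x)\<bar> \<le> C * (1/2) ^ k * norm (y - x)"
        using key [OF y(1) x, of k] by (simp add: dist_norm)
      have "\<bar>(y - x) \<bullet> (G (s k) x - g x)\<bar> \<le> norm (y - x) * norm (G (s k) x - g x)" by (rule Cauchy_Schwarz_ineq2)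
      also have "\<dots> \<le> norm (y - x) * (1/2) ^ k" by (intro mult_left_mono Agrad x) simp
      finally have 3: "\<bar>(y - x) \<bullet> G (s k) x - (y - x) \<bullet> g x\<bar> \<le> (1/2) ^ k * norm (y - x)"
        by (simp add: inner_diff_right mult.commute)
      have "\<bar>u y - u x - (y - x) \<bullet> g x\<bar> \<le> (e / 2 + (C + 1) * (1/2) ^ k) * norm (y - x)"
      proof -
        have "u y - u x - (y - x) \<bullet> g x = (v (s k) y - v (s k) x - (y - x) \<bullet> G (s k) x) +
            ((u y - v (s k) y) - (u x - v (s k) x)) + ((y - x) \<bullet> G (s k) x - (y - x) \<bullet> g x)" by simp
        then have "\<bar>u y - u x - (y - x) \<bullet> g x\<bar> \<le> \<bar>v (s k) y - v (s k) x - (y - x) \<bullet> G (s k) x\<bar> +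
            \<bar>(u y - v (s k) y) - (u x - v (s k) x)\<bar> + \<bar>(y - x) \<bullet> G (s k) x - (y - x) \<bullet> g x\<bar>"
          by (simp only: abs_triangle_ineq order_trans [OF abs_triangle_ineq add_right_mono])
        also have "\<dots> \<le> e / 2 * norm (y - x) + C * (1/2) ^ k * norm (y - x) + (1/2) ^ k * norm (y - x)"
          by (intro add_mono 1 2 3)
        finally show ?thesis by (simp add: distrib_right)
      qed
      also have "\<dots> \<le> e * norm (y - x)" using k' by (intro mult_right_mono) auto
      finally show "norm (u y - u x - (y - x) \<bullet> g x) \<le> e * norm (y - x)" by simp
    qed
  qed
  then show thesis using that [of A] A small by (auto simp: A_def)
qed

text \<open>In a ball the sets found for the components are intersected. Countably many balls cover
  \<open>\<Omega>\<close> by Lindelof, and in each of them the errors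
  \<open>inverse (Suc m)\<close>, over all \<open>m\<close>, leave only a null set
  uncovered.\<close>

proposition weak_jacobian_differentiable_within:
  fixes \<phi> :: "real^'n::finite \<Rightarrow> real^'m::finite" and D :: "real^'n \<Rightarrow> real^'n^'m"
  assumes \<Omega>: "open \<Omega>" "continuous_on \<Omega> \<phi>"
    and wg: "\<And>l. is_weak_grad \<Omega> (\<lambda>x. \<phi> x $ l) (\<lambda>x. D x $ l)"
  obtains \<A> where "countable \<A>" "\<And>A. A \<in> \<A> \<Longrightarrow> A \<in> sets lebesgue \<and> A \<subseteq> \<Omega>"
    "\<And>A x. A \<in> \<A> \<Longrightarrow> x \<in> A \<Longrightarrow> (\<phi> has_derivative (\<lambda>h. D x *v h)) (at x within A)"
    "\<Omega> - \<Union>\<A> \<in> null_sets lebesgue"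
proof -
  define \<F> where "\<F> = {ball a R | a R. 0 < R \<and> cball a (3 * R) \<subseteq> \<Omega>}"
  have "\<exists>A. A \<in> sets lebesgue \<and> A \<subseteq> S \<and> emeasure lebesgue (S - A) \<le> ennreal (inverse (Suc m)) \<and>
      (\<forall>x\<in>A. (\<phi> has_derivative (\<lambda>h. D x *v h)) (at x within A))" if S: "S \<in> \<F>" for S and m :: nat
  proof -
    from S obtain a R where R: "S = ball a R" "0 < R" "cball a (3 * R) \<subseteq> \<Omega>" by (auto simp: \<F>_def)
    \<comment> \<open>An equal share of the permitted measure for each component.\<close>
    define \<epsilon> where "\<epsilon> = inverse (Suc m) / CARD('m)"
    have \<epsilon>: "0 < \<epsilon>" by (simp add: \<epsilon>_def)
    have "\<exists>A. A \<in> sets lebesgue \<and> A \<subseteq> S \<and> emeasure lebesgue (S - A) \<le> ennreal \<epsilon> \<and>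
      (\<forall>x\<in>A. ((\<lambda>x. \<phi> x $ l) has_derivative (\<lambda>h. h \<bullet> D x $ l)) (at x within A))" for l
      using weak_grad_differentiable_within_ball [OF \<Omega>(1) continuous_on_component [OF \<Omega>(2)] wg [of l] R(2,3) \<epsilon>]
      unfolding R(1) by metis
    then obtain A where A: "\<And>l. A l \<in> sets lebesgue" "\<And>l. A l \<subseteq> S"
        "\<And>l. emeasure lebesgue (S - A l) \<le> ennreal \<epsilon>"
        "\<And>l x. x \<in> A l \<Longrightarrow> ((\<lambda>x. \<phi> x $ l) has_derivative (\<lambda>h. h \<bullet> D x $ l)) (at x within A l)"
      by metis
    have Sm: "S \<in> sets lebesgue" by (simp add: R(1))
    have "emeasure lebesgue (S - (\<Inter>l. A l)) = emeasure lebesgue (\<Union>l. S - A l)"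
      by (rule arg_cong [where f = "emeasure lebesgue"]) auto
    also have "\<dots> \<le> (\<Sum>l\<in>UNIV. emeasure lebesgue (S - A l))"
      by (rule emeasure_subadditive_finite) (use A Sm in auto)
    also have "\<dots> \<le> (\<Sum>l\<in>(UNIV::'m set). ennreal \<epsilon>)" by (intro sum_mono A)
    also have "\<dots> = ennreal (inverse (Suc m))" using \<epsilon> by (simp add: \<epsilon>_def ennreal_of_nat_eq_real_of_nat flip: ennreal_mult)
    finally have 1: "emeasure lebesgue (S - (\<Inter>l. A l)) \<le> ennreal (inverse (Suc m))" .
    have 2: "(\<phi> has_derivative (\<lambda>h. D x *v h)) (at x within (\<Inter>l. A l))" if x: "x \<in> (\<Inter>l. A l)" for x
    proof -
      have "((\<lambda>x. \<phi> x $ l) has_derivative (\<lambda>h. h \<bullet> D x $ l)) (at x within (\<Inter>l. A l))" for l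
        by (rule has_derivative_subset [OF A(4)]) (use x in auto)
      from has_derivative_vec_inner [OF this]
      have "((\<lambda>x. \<chi> l. \<phi> x $ l) has_derivative (\<lambda>h. \<chi> l. h \<bullet> D x $ l)) (at x within (\<Inter>l. A l))" .
      moreover have "(\<lambda>h. \<chi> l. h \<bullet> D x $ l) = (\<lambda>h. D x *v h)"
        by (simp add: fun_eq_iff vec_eq_iff matrix_vector_mult_def inner_vec_def mult.commute)
      ultimately show ?thesis by simp
    qed
    have "(\<Inter>l. A l) \<in> sets lebesgue" using A(1) by (intro sets.finite_INT) auto
    moreover have "(\<Inter>l. A l) \<subseteq> S" using A(2) by blast
    ultimately show ?thesis using 1 2 by blast
  qed
  then obtain A where A: "\<And>S m. S \<in> \<F> \<Longrightarrow> A S m \<in> sets lebesgue" "\<And>S m. S \<in> \<F> \<Longrightarrow> A S m \<subseteq> S"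
     "\<And>S m. S \<in> \<F> \<Longrightarrow> emeasure lebesgue (S - A S m) \<le> ennreal (inverse (Suc m))"
     "\<And>S m x. S \<in> \<F> \<Longrightarrow> x \<in> A S m \<Longrightarrow> (\<phi> has_derivative (\<lambda>h. D x *v h)) (at x within A S m)"
    by metis
  have "\<And>S. S \<in> \<F> \<Longrightarrow> open S" by (auto simp: \<F>_def)
  then obtain \<F>' where \<F>': "\<F>' \<subseteq> \<F>" "countable \<F>'" "\<Union>\<F>' = \<Union>\<F>" using Lindelof by metis
  have sub: "S \<subseteq> \<Omega>" if "S \<in> \<F>" for S
  proof -
    from that obtain a R where R: "S = ball a R" "0 < R" "cball a (3 * R) \<subseteq> \<Omega>" by (auto simp: \<F>_def)
    have "ball a R \<subseteq> cball a (3 * R)" using R(2) by (intro order_trans [OF ball_subset_cball] subset_cball) auto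
    then show ?thesis using R by blast
  qed
  have cover: "\<Omega> \<subseteq> \<Union>\<F>"
  proof
    fix x assume "x \<in> \<Omega>"
    then obtain e where e: "0 < e" "cball x e \<subseteq> \<Omega>" using \<Omega>(1) open_contains_cball by metis
    then have "ball x (e / 3) \<in> \<F>" unfolding \<F>_def by (auto intro!: exI [of _ x] exI [of _ "e / 3"])
    then show "x \<in> \<Union>\<F>" using e by (auto intro!: bexI [of _ "ball x (e / 3)"])
  qed
  define \<A> where "\<A> = (\<lambda>(S, m). A S m) ` (\<F>' \<times> (UNIV :: nat set))"
  show thesis
  proof (rule that [of \<A>])
    show "countable \<A>" unfolding \<A>_def using \<F>'(2) by (intro countable_image countable_SIGMA) auto
    show "B \<in> sets lebesgue \<and> B \<subseteq> \<Omega>" if "B \<in> \<A>" for B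
    proof -
      from that obtain S m where B: "B = A S m" "S \<in> \<F>" using \<F>'(1) by (auto simp: \<A>_def)
      then show ?thesis using A(1,2) sub by blast
    qed
    show "(\<phi> has_derivative (\<lambda>h. D x *v h)) (at x within B)" if "B \<in> \<A>" "x \<in> B" for B x
      using that A(4) \<F>'(1) by (auto simp: \<A>_def)
    have null: "S - (\<Union>m. A S m) \<in> null_sets lebesgue" if S: "S \<in> \<F>" for S
    proof -
      have Sm: "S \<in> sets lebesgue" using S by (auto simp: \<F>_def)
      have m: "S - (\<Union>m. A S m) \<in> sets lebesgue" using Sm A(1) [OF S] by (intro sets.Diff sets.countable_UN) auto
      have "emeasure lebesgue (S - (\<Union>m. A S m)) \<le> ennreal (inverse (Suc m))" for m
        by (rule order_trans [OF emeasure_mono A(3) [OF S]]) (use Sm A(1) [OF S] in auto)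
      moreover have "(\<lambda>m. ennreal (inverse (Suc m))) \<longlonglongrightarrow> ennreal 0"
        by (rule tendsto_ennrealI [OF LIMSEQ_inverse_real_of_nat])
      ultimately have "emeasure lebesgue (S - (\<Union>m. A S m)) \<le> ennreal 0"
        by (intro LIMSEQ_le_const) auto
      with m show ?thesis by (auto simp: null_sets_def)
    qed
    have "(\<Union>S\<in>\<F>'. S - (\<Union>m. A S m)) \<in> null_sets lebesgue"
      by (rule null_sets_UN') (use \<F>' null in auto)
    moreover have "\<Omega> - \<Union>\<A> \<subseteq> (\<Union>S\<in>\<F>'. S - (\<Union>m. A S m))"
      using cover \<F>'(3) by (fastforce simp: \<A>_def)
    ultimately show "\<Omega> - \<Union>\<A> \<in> null_sets lebesgue"
      using null_sets_completion_subset by blast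
  qed
qed

section \<open>Change of variables\<close>

text \<open>The library's change of variables theorem needs a well-ordered index type. Every finite
  index type has a well-ordered copy, and renaming coordinates changes neither Lebesgue measure
  nor determinants.\<close>

typedef 'a ordered_copy = "UNIV :: 'a set"
  morphisms of_copy to_copy ..

lemma bij_of_copy: "bij of_copy"
  by (rule bijI') (auto simp: of_copy_inject intro: to_copy_inverse [symmetric])

lemma bij_to_copy: "bij to_copy"
  by (rule bijI') (auto simp: to_copy_inject intro: of_copy_inverse [symmetric])

instance ordered_copy :: (finite) finite
proof
  show "finite (UNIV :: 'a ordered_copy set)"
    unfolding bij_is_surj [OF bij_to_copy, symmetric] by (rule finite_imageI [OF finite])
qed

definition copy_index :: "'a::finite ordered_copy \<Rightarrow> nat" where
  "copy_index = (SOME f. inj f)"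

lemma inj_copy_index: "inj (copy_index :: 'a::finite ordered_copy \<Rightarrow> nat)"
proof -
  have "\<exists>f :: 'a ordered_copy \<Rightarrow> nat. inj f"
    using finite_imp_inj_to_nat_seg [OF finite] by blast
  then show ?thesis unfolding copy_index_def by (rule someI_ex)
qed

instantiation ordered_copy :: (finite) wellorder
begin

definition less_eq_ordered_copy :: "'a ordered_copy \<Rightarrow> 'a ordered_copy \<Rightarrow> bool" where
  "x \<le> y \<longleftrightarrow> copy_index x \<le> copy_index y"

definition less_ordered_copy :: "'a ordered_copy \<Rightarrow> 'a ordered_copy \<Rightarrow> bool" where
  "x < y \<longleftrightarrow> copy_index x < copy_index y"

instance
proof
  fix x y z :: "'a ordered_copy"
  show "x \<le> y \<Longrightarrow> y \<le> x \<Longrightarrow> x = y"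
    by (rule injD [OF inj_copy_index]) (simp add: less_eq_ordered_copy_def)
next
  fix P :: "'a ordered_copy \<Rightarrow> bool" and a :: "'a ordered_copy"
  assume step: "\<And>x. (\<And>y. y < x \<Longrightarrow> P y) \<Longrightarrow> P x"
  show "P a"
  proof (induction a rule: measure_induct_rule [where f = copy_index])
    case (less x)
    show ?case by (rule step, rule less) (simp add: less_ordered_copy_def)
  qed
qed (auto simp: less_eq_ordered_copy_def less_ordered_copy_def)

end

section \<open>Renaming of coordinates\<close>

definition reindex :: "('m::finite \<Rightarrow> 'n::finite) \<Rightarrow> real^'n \<Rightarrow> real^'m" where
  "reindex p x = (\<chi> j. x $ p j)"

lemma linear_reindex: "linear (reindex p)"
  by (rule linearI) (simp_all add: reindex_def vec_eq_iff)

lemma bounded_linear_reindex: "bounded_linear (reindex p)"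
  using linear_reindex linear_conv_bounded_linear by blast

lemma reindex_reindex: "(\<And>i. p (q i) = i) \<Longrightarrow> reindex q (reindex p x) = x"
  by (simp add: reindex_def vec_eq_iff)

lemma prod_Basis_vec:
  fixes f :: "real^'n::finite \<Rightarrow> real"
  shows "(\<Prod>b\<in>Basis. f b) = (\<Prod>i\<in>UNIV. f (axis i 1))"
proof -
  have B: "(Basis :: (real^'n) set) = (\<lambda>i. axis i 1) ` UNIV" by (auto simp: Basis_vec_def)
  have "inj (\<lambda>i. axis i (1::real) :: real^'n)" by (auto simp: inj_def axis_eq_axis)
  from prod.reindex [OF this, of f] show ?thesis unfolding B by simp
qed

lemma measurable_reindex [measurable]: "reindex p \<in> borel_measurable borel"
  by (rule borel_measurable_continuous_onI)
    (rule linear_continuous_on [OF bounded_linear_reindex])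

text \<open>A bijection of the indices carries boxes to boxes with the same side lengths in another
  order, and the values on boxes determine the measure.\<close>

lemma lborel_distr_reindex:
  fixes p :: "'m::finite \<Rightarrow> 'n::finite"
  assumes p: "bij p"
  shows "distr lborel borel (reindex p) = lborel"
proof (rule lborel_eqI [symmetric])
  fix l u :: "real^'m"
  assume le: "\<And>b. b \<in> Basis \<Longrightarrow> l \<bullet> b \<le> u \<bullet> b"
  have le': "l $ j \<le> u $ j" for j using le [of "axis j 1"] by (auto simp: inner_axis Basis_vec_def)
  define q where "q = inv p"
  have pq: "p (q i) = i" for i unfolding q_def by (rule surj_f_inv_f [OF bij_is_surj [OF p]])
  have qp: "q (p i) = i" for i unfolding q_def by (rule inv_f_f [OF bij_is_inj [OF p]])
  have "reindex p -` box l u = box (reindex q l) (reindex q u)"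
  proof (rule set_eqI)
    fix x
    have "(\<forall>j. l $ j < x $ p j \<and> x $ p j < u $ j) \<longleftrightarrow> (\<forall>i. l $ q i < x $ i \<and> x $ i < u $ q i)"
      by (metis pq qp)
    then show "x \<in> reindex p -` box l u \<longleftrightarrow> x \<in> box (reindex q l) (reindex q u)"
      by (simp add: mem_box_cart reindex_def)
  qed
  then have "emeasure (distr lborel borel (reindex p)) (box l u)
      = emeasure lborel (box (reindex q l) (reindex q u))"
    by (subst emeasure_distr) auto
  also have "\<dots> = (\<Prod>b\<in>Basis. (reindex q u - reindex q l) \<bullet> b)"
    using le' by (intro emeasure_lborel_box) (auto simp: Basis_vec_def inner_axis reindex_def)
  also have "(\<Prod>b\<in>Basis. (reindex q u - reindex q l) \<bullet> b) = (\<Prod>i\<in>UNIV. (u - l) $ q i)"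
    by (simp add: prod_Basis_vec inner_axis reindex_def)
  also have "\<dots> = (\<Prod>j\<in>UNIV. (u - l) $ j)"
    unfolding q_def using prod.reindex_bij_betw [OF bij_imp_bij_inv [OF p], of "\<lambda>j. (u - l) $ j"] by simp
  also have "\<dots> = (\<Prod>b\<in>Basis. (u - l) \<bullet> b)" by (simp add: prod_Basis_vec inner_axis)
  finally show "emeasure (distr lborel borel (reindex p)) (box l u) = (\<Prod>b\<in>Basis. (u - l) \<bullet> b)" .
qed simp

lemma
  fixes p :: "'m::finite \<Rightarrow> 'n::finite"
  assumes p: "bij p"
  shows lebesgue_measurable_reindex: "reindex p \<in> lebesgue \<rightarrow>\<^sub>M lebesgue"
    and lebesgue_distr_reindex: "distr lebesgue lebesgue (reindex p) = lebesgue"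
proof -
  have m: "reindex p \<in> lborel \<rightarrow>\<^sub>M lborel" by simp
  have d: "distr lebesgue lborel (reindex p) = lborel"
    using distr_completion [OF m] lborel_distr_reindex [OF p] by (simp cong: distr_cong)
  then have eq: "null_sets (distr lebesgue lborel (reindex p)) = null_sets lborel" by simp
  show meas: "reindex p \<in> lebesgue \<rightarrow>\<^sub>M lebesgue"
    by (rule completion.measurable_completion2) (use eq m in \<open>auto intro: measurable_completion\<close>)
  show "distr lebesgue lebesgue (reindex p) = lebesgue"
    using completion.completion_distr_eq [OF measurable_completion [OF m] eq] d by simp
qed

lemma set_integral_reindex:
  fixes p :: "'m::finite \<Rightarrow> 'n::finite" and f :: "real^'m \<Rightarrow> real"
  assumes p: "bij p" and f: "set_integrable lebesgue S f"
  shows "set_integrable lebesgue (reindex p -` S) (\<lambda>x. f (reindex p x))"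
    and "(LINT x:(reindex p -` S)|lebesgue. f (reindex p x)) = (LINT y:S|lebesgue. f y)"
proof -
  let ?g = "\<lambda>y. indicator S y *\<^sub>R f y"
  have g: "integrable lebesgue ?g" using f by (simp add: set_integrable_def)
  have i: "?g (reindex p x) = indicator (reindex p -` S) x *\<^sub>R f (reindex p x)" for x
    by (simp add: indicator_def)
  have "integrable (distr lebesgue lebesgue (reindex p)) ?g"
    unfolding lebesgue_distr_reindex [OF p] by (rule g)
  then have "integrable lebesgue (\<lambda>x. ?g (reindex p x))"
    by (rule integrable_distr [OF lebesgue_measurable_reindex [OF p]])
  then show "set_integrable lebesgue (reindex p -` S) (\<lambda>x. f (reindex p x))"
    unfolding set_integrable_def i .
  have "(\<integral>y. ?g y \<partial>lebesgue) = (\<integral>y. ?g y \<partial>distr lebesgue lebesgue (reindex p))"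
    unfolding lebesgue_distr_reindex [OF p] ..
  also have "\<dots> = (\<integral>x. ?g (reindex p x) \<partial>lebesgue)"
    by (rule integral_distr [OF lebesgue_measurable_reindex [OF p]]) (use g in auto)
  finally show "(LINT x:(reindex p -` S)|lebesgue. f (reindex p x)) = (LINT y:S|lebesgue. f y)"
    unfolding set_lebesgue_integral_def i ..
qed

text \<open>Rows and columns are renamed together, so conjugation by \<open>p\<close> matches the
  terms of the Leibniz formula and preserves signs; no orientation enters.\<close>

lemma det_reindex:
  fixes p :: "'m::finite \<Rightarrow> 'n::finite" and A :: "real^'n^'n"
  assumes p: "bij p"
  shows "det (\<chi> j k. A $ p j $ p k) = det A"
proof -
  define q where "q = inv p"
  have pq: "p (q i) = i" for i unfolding q_def by (rule surj_f_inv_f [OF bij_is_surj [OF p]])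
  have qp: "q (p i) = i" for i unfolding q_def by (rule inv_f_f [OF bij_is_inj [OF p]])
  have bq: "bij q" unfolding q_def by (rule bij_imp_bij_inv [OF p])
  have "det (\<chi> j k. A $ p j $ p k) =
      (\<Sum>\<sigma>\<in>{\<sigma>. \<sigma> permutes (UNIV :: 'm set)}. of_int (sign \<sigma>) * (\<Prod>j\<in>UNIV. A $ p j $ p (\<sigma> j)))"
    by (simp add: det_def)
  also have "\<dots> = (\<Sum>\<tau>\<in>{\<tau>. \<tau> permutes (UNIV :: 'n set)}. of_int (sign \<tau>) * (\<Prod>i\<in>UNIV. A $ i $ \<tau> i))"
  proof (rule sum.reindex_bij_witness [where i = "map_permutation UNIV q" and j = "map_permutation UNIV p"])
    fix \<sigma> assume \<sigma>: "\<sigma> \<in> {\<sigma>. \<sigma> permutes (UNIV :: 'm set)}"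
    show "map_permutation UNIV p \<sigma> \<in> {\<tau>. \<tau> permutes UNIV}"
      using map_permutation_permutes [OF p] \<sigma> by simp
    show "map_permutation UNIV q (map_permutation UNIV p \<sigma>) = \<sigma>"
      by (rule map_permutation_compose_inv [OF p]) (use \<sigma> qp in auto)
    have s: "sign (map_permutation UNIV p \<sigma>) = sign \<sigma>"
      by (rule sign_map_permutation) (use \<sigma> bij_is_inj [OF p] in auto)
    have "(\<Prod>i\<in>UNIV. A $ i $ map_permutation UNIV p \<sigma> i) =
        (\<Prod>j\<in>UNIV. A $ p j $ map_permutation UNIV p \<sigma> (p j))"
      using prod.reindex_bij_betw [OF p, of "\<lambda>i. A $ i $ map_permutation UNIV p \<sigma> i"] by simp
    also have "\<dots> = (\<Prod>j\<in>UNIV. A $ p j $ p (\<sigma> j))"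
      using map_permutation_apply [of p UNIV] bij_is_inj [OF p] by simp
    finally show "of_int (sign (map_permutation UNIV p \<sigma>)) * (\<Prod>i\<in>UNIV. A $ i $ map_permutation UNIV p \<sigma> i)
        = of_int (sign \<sigma>) * (\<Prod>j\<in>UNIV. A $ p j $ p (\<sigma> j))" by (simp add: s)
  next
    fix \<tau> assume \<tau>: "\<tau> \<in> {\<tau>. \<tau> permutes (UNIV :: 'n set)}"
    show "map_permutation UNIV q \<tau> \<in> {\<sigma>. \<sigma> permutes UNIV}"
      using map_permutation_permutes [OF bq] \<tau> by simp
    show "map_permutation UNIV p (map_permutation UNIV q \<tau>) = \<tau>"
      by (rule map_permutation_compose_inv [OF bq]) (use \<tau> pq in auto)
  qed
  also have "\<dots> = det A" by (simp add: det_def)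
  finally show ?thesis .
qed

text \<open>The statement is transported by the renaming \<open>T\<close> and its inverse
  \<open>T'\<close> to a well-ordered index type and back. The derivative is required only relative
  to \<open>S\<close>, which is what the pieces of the decomposition of the domain provide.\<close>

proposition change_of_variables_within:
  fixes \<phi> :: "real^'n::finite \<Rightarrow> real^'n" and w :: "real^'n \<Rightarrow> real"
  assumes S: "S \<in> sets lebesgue"
    and der: "\<And>x. x \<in> S \<Longrightarrow> (\<phi> has_derivative (\<lambda>h. D x *v h)) (at x within S)"
    and inj: "inj_on \<phi> S" and w: "set_integrable lebesgue (\<phi> ` S) w"
  shows "set_integrable lebesgue S (\<lambda>x. \<bar>det (D x)\<bar> * w (\<phi> x))"
    and "(LINT x:S|lebesgue. \<bar>det (D x)\<bar> * w (\<phi> x)) = (LINT y:\<phi> ` S|lebesgue. w y)"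
proof -
  define T where "T = reindex (of_copy :: 'n ordered_copy \<Rightarrow> 'n)"
  define T' where "T' = reindex (to_copy :: 'n \<Rightarrow> 'n ordered_copy)"
  have TT' [simp]: "T (T' y) = y" "T' (T x) = x" for x y
    unfolding T_def T'_def by (auto intro: reindex_reindex simp: to_copy_inverse of_copy_inverse)
  have blT: "bounded_linear T" "bounded_linear T'" unfolding T_def T'_def by (rule bounded_linear_reindex)+
  have TS: "T ` X = T' -` X" for X by (rule set_eqI) (metis TT' image_iff vimage_eq)
  have T'S: "T -` (T ` X) = X" for X by (rule set_eqI) (metis TT'(2) image_iff vimage_eq)
  define \<phi>' where "\<phi>' y = T (\<phi> (T' y))" for y
  define D' where "D' y = (\<chi> j k. D (T' y) $ of_copy j $ of_copy k)" for y :: "real^'n ordered_copy"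
  define S' where "S' = T ` S"
  have detD': "det (D' y) = det (D (T' y))" for y
    unfolding D'_def by (rule det_reindex [OF bij_of_copy])
  have D'T: "D' y *v T h = T (D (T' y) *v h)" for y h
  proof -
    have "(\<Sum>k\<in>UNIV. D (T' y) $ of_copy j $ of_copy k * h $ of_copy k)
        = (\<Sum>i\<in>UNIV. D (T' y) $ of_copy j $ i * h $ i)" for j
      using sum.reindex_bij_betw [OF bij_of_copy, of "\<lambda>i. D (T' y) $ of_copy j $ i * h $ i"] by simp
    then show ?thesis
      by (simp add: vec_eq_iff matrix_vector_mult_def D'_def T_def reindex_def)
  qed
  have S'm: "S' \<in> sets lebesgue"
  proof -
    have "T' -` S \<inter> space lebesgue \<in> sets lebesgue"
      unfolding T'_def by (rule measurable_sets [OF lebesgue_measurable_reindex [OF bij_to_copy] S])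
    then show ?thesis by (simp add: S'_def TS)
  qed
  have T'S': "T' ` S' = S" by (auto simp: S'_def image_iff)
  have der': "(\<phi>' has_derivative (\<lambda>h. D' y *v h)) (at y within S')" if y: "y \<in> S'" for y
  proof -
    have yS: "T' y \<in> S" using y T'S' by blast
    have "(T' has_derivative T') (at y within S')" by (rule bounded_linear_imp_has_derivative [OF blT(2)])
    moreover have "(\<phi> has_derivative (\<lambda>h. D (T' y) *v h)) (at (T' y) within T' ` S')"
      unfolding T'S' by (rule der [OF yS])
    ultimately have "(\<phi> \<circ> T' has_derivative (\<lambda>h. D (T' y) *v h) \<circ> T') (at y within S')"
      by (rule diff_chain_within)
    then have "((\<lambda>y. T ((\<phi> \<circ> T') y)) has_derivative (\<lambda>h. T (((\<lambda>h. D (T' y) *v h) \<circ> T') h))) (at y within S')"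
      by (rule bounded_linear.has_derivative [OF blT(1)])
    moreover have "(\<lambda>h. T (((\<lambda>h. D (T' y) *v h) \<circ> T') h)) = (\<lambda>h. D' y *v h)"
      using D'T [of y "T' _"] by auto
    ultimately show ?thesis by (simp add: \<phi>'_def [abs_def] o_def)
  qed
  have inj': "inj_on \<phi>' S'"
  proof (rule inj_onI)
    fix y z assume yz: "y \<in> S'" "z \<in> S'" "\<phi>' y = \<phi>' z"
    then have "\<phi> (T' y) = \<phi> (T' z)" unfolding \<phi>'_def by (metis TT'(2))
    then have "T' y = T' z" using inj yz T'S' by (metis imageI inj_onD)
    then show "y = z" by (metis TT'(1))
  qed
  have im: "\<phi>' ` S' = T' -` (\<phi> ` S)"
    unfolding TS [symmetric] S'_def by (simp add: \<phi>'_def image_image)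
  have wi: "set_integrable lebesgue (\<phi>' ` S') (\<lambda>y. w (T' y))"
    and weq: "(LINT y:(\<phi>' ` S')|lebesgue. w (T' y)) = (LINT y:\<phi> ` S|lebesgue. w y)"
    unfolding im T'_def by (rule set_integral_reindex [OF bij_to_copy w])+
  have mat: "matrix (\<lambda>h. D' y *v h) = D' y" for y by (rule matrix_of_matrix_vector_mul)
  \<comment> \<open>The cited theorem is about vector-valued integrands, so the scalar
    \<open>w\<close> is wrapped as a vector with one component and unwrapped afterwards.\<close>
  have cov: "(\<lambda>y. \<bar>det (D' y)\<bar> *\<^sub>R vec (w (T' (\<phi>' y))) :: real^1) absolutely_integrable_on S' \<and>
      integral S' (\<lambda>y. \<bar>det (D' y)\<bar> *\<^sub>R vec (w (T' (\<phi>' y))) :: real^1) = integral (\<phi>' ` S') (\<lambda>y. vec (w (T' y)))"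
    using has_absolute_integral_change_of_variables [OF S'm der' inj',
        of "\<lambda>y. vec (w (T' y)) :: real^1" "integral (\<phi>' ` S') (\<lambda>y. vec (w (T' y)) :: real^1)"] wi
    by (simp add: mat absolutely_integrable_on_1_iff)
  have s1: "\<bar>det (D' y)\<bar> *\<^sub>R vec (w (T' (\<phi>' y))) = (vec (\<bar>det (D' y)\<bar> * w (T' (\<phi>' y))) :: real^1)" for y
    by (simp add: vec_eq_iff)
  have ci: "set_integrable lebesgue S' (\<lambda>y. \<bar>det (D' y)\<bar> * w (T' (\<phi>' y)))"
    using cov unfolding s1 by (simp add: absolutely_integrable_on_1_iff)
  have "integral S' (\<lambda>y. \<bar>det (D' y)\<bar> * w (T' (\<phi>' y))) = integral (\<phi>' ` S') (\<lambda>y. w (T' y))"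
    using cov unfolding s1 by (simp add: integral_on_1_eq vec_eq_iff)
  then have ceq: "(LINT y:S'|lebesgue. \<bar>det (D' y)\<bar> * w (T' (\<phi>' y))) = (LINT y:\<phi>' ` S'|lebesgue. w (T' y))"
    using set_lebesgue_integral_eq_integral(2) [OF ci] set_lebesgue_integral_eq_integral(2) [OF wi] by simp
  have e: "(\<lambda>x. \<bar>det (D' (T x))\<bar> * w (T' (\<phi>' (T x)))) = (\<lambda>x. \<bar>det (D x)\<bar> * w (\<phi> x))"
    by (simp add: detD' \<phi>'_def)
  have "set_integrable lebesgue (T -` S') (\<lambda>x. \<bar>det (D' (T x))\<bar> * w (T' (\<phi>' (T x))))"
    and "(LINT x:(T -` S')|lebesgue. \<bar>det (D' (T x))\<bar> * w (T' (\<phi>' (T x)))) = (LINT y:S'|lebesgue. \<bar>det (D' y)\<bar> * w (T' (\<phi>' y)))"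
    unfolding T_def by (rule set_integral_reindex [OF bij_of_copy ci [unfolded T_def]])+
  then show "set_integrable lebesgue S (\<lambda>x. \<bar>det (D x)\<bar> * w (\<phi> x))"
    and "(LINT x:S|lebesgue. \<bar>det (D x)\<bar> * w (\<phi> x)) = (LINT y:\<phi> ` S|lebesgue. w y)"
    unfolding e ceq weq by (simp_all add: S'_def T'S)
qed

section \<open>The chain rule for functions with bounded gradient\<close>

lemma wgrad_weak_grad: "weakly_diff U f \<Longrightarrow> is_weak_grad U f (wgrad U f)"
  unfolding weakly_diff_def wgrad_def by (rule someI_ex [where P = "is_weak_grad U f"])

lemma loc_integrable_measurable:
  fixes f :: "real^'n::finite \<Rightarrow> real"
  assumes U: "open U" and f: "loc_integrable U f"
  shows "(\<lambda>x. indicator U x * f x) \<in> borel_measurable lebesgue"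
proof -
  obtain C :: "nat \<Rightarrow> (real^'n) set" where C: "\<And>n. compact (C n)" "\<And>n. C n \<subseteq> U"
      "\<And>n. C n \<subseteq> interior (C (Suc n))" "\<Union>(range C) = U"
    using open_Union_compact_subsets [OF U] by metis
  have mono: "C m \<subseteq> C n" if "m \<le> n" for m n
    using that C(3) interior_subset by (induction n rule: dec_induct) blast+
  show ?thesis
  proof (rule borel_measurable_LIMSEQ_real)
    show "(\<lambda>x. indicator (C n) x * f x) \<in> borel_measurable lebesgue" for n
      using loc_integrable_compact [OF f C(1,2)] by auto
    fix x
    show "(\<lambda>n. indicator (C n) x * f x) \<longlonglongrightarrow> indicator U x * f x"
    proof (cases "x \<in> U")
      case True
      then obtain m where "x \<in> C m" using C(4) by blast
      then have "\<And>n. m \<le> n \<Longrightarrow> x \<in> C n" using mono by blast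
      then show ?thesis using True
        by (intro tendsto_eventually) (auto simp: eventually_sequentially intro!: exI [of _ m])
    next
      case False
      then have "x \<notin> C n" for n using C(2) by blast
      then show ?thesis using False by simp
    qed
  qed
qed

lemma borel_measurable_vec_lambda:
  fixes f :: "'a \<Rightarrow> 'b::euclidean_space^'n::finite"
  assumes "\<And>i. (\<lambda>x. f x $ i) \<in> borel_measurable M"
  shows "f \<in> borel_measurable M"
proof (subst borel_measurable_euclidean_space, rule ballI)
  fix b :: "'b^'n" assume "b \<in> Basis"
  then obtain i u where b: "b = axis i u" by (auto simp: Basis_vec_def)
  show "(\<lambda>x. f x \<bullet> b) \<in> borel_measurable M"
    unfolding b inner_axis using assms by measurable
qed

section \<open>Operator norm and smallest stretching of a matrix\<close>

lemma norm_matrix_vector_mult_le: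
  fixes A :: "real^'n::finite^'m::finite"
  shows "norm (A *v h) \<le> norm A * norm h"
proof -
  have "norm (A *v h) = L2_set (\<lambda>i. \<bar>A $ i \<bullet> h\<bar>) UNIV"
    by (simp add: norm_vec_def matrix_vector_mul_component)
  also have "\<dots> \<le> L2_set (\<lambda>i. norm (A $ i) * norm h) UNIV"
    by (intro L2_set_mono Cauchy_Schwarz_ineq2) auto
  also have "\<dots> = norm A * norm h"
    by (simp add: norm_vec_def [of A] L2_set_left_distrib)
  finally show ?thesis .
qed

text \<open>Exchanging \<open>A\<close> and \<open>B\<close> makes the one-sided hypothesis
  two-sided. It is applied to \<open>lmin\<close> and to the operator norm, whose continuity gives
  the measurability of the distortion and of the norm of the Jacobi matrix.\<close>

lemma continuous_of_norm_lipschitz: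
  fixes F :: "'a::real_normed_vector \<Rightarrow> real"
  assumes "\<And>A B. F A \<le> F B + norm (A - B)"
  shows "continuous_on UNIV F"
proof -
  have "\<bar>F A - F B\<bar> \<le> norm (A - B)" for A B
    using assms [of A B] assms [of B A] by (simp add: norm_minus_commute abs_le_iff)
  then have "1-lipschitz_on UNIV F" by (intro lipschitz_onI) (auto simp: dist_norm)
  then show ?thesis by (rule lipschitz_on_continuous_on)
qed

lemma lmin_le:
  fixes A :: "real^'n::finite^'n"
  assumes "norm h = 1"
  shows "lmin A \<le> norm (A *v h)"
  unfolding lmin_def by (rule cInf_lower) (use assms in \<open>auto intro!: bdd_belowI [of _ 0]\<close>)

lemma lmin_greatest:
  fixes A :: "real^'n::finite^'n"
  assumes "\<And>h. norm h = 1 \<Longrightarrow> c \<le> norm (A *v h)"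
  shows "c \<le> lmin A"
  unfolding lmin_def
proof (rule cInf_greatest)
  have "norm (axis undefined 1 :: real^'n) = 1" by simp
  then show "{norm (A *v h) |h. norm h = 1} \<noteq> {}" by blast
qed (use assms in auto)

lemma continuous_lmin: "continuous_on UNIV (lmin :: real^'n::finite^'n \<Rightarrow> real)"
proof (rule continuous_of_norm_lipschitz)
  fix A B :: "real^'n^'n"
  have "lmin A - norm (A - B) \<le> lmin B"
  proof (rule lmin_greatest)
    fix h :: "real^'n" assume h: "norm h = 1"
    have "lmin A \<le> norm (B *v h + (A - B) *v h)"
      using lmin_le [OF h, of A] by (simp add: matrix_vector_mult_diff_rdistrib)
    also have "\<dots> \<le> norm (B *v h) + norm ((A - B) *v h)" by (rule norm_triangle_ineq)
    also have "norm ((A - B) *v h) \<le> norm (A - B)" using norm_matrix_vector_mult_le [of "A - B" h] h by simp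
    finally show "lmin A - norm (A - B) \<le> norm (B *v h)" by simp
  qed
  then show "lmin A \<le> lmin B + norm (A - B)" by simp
qed

lemma continuous_onorm_matrix:
  "continuous_on UNIV (\<lambda>A :: real^'n::finite^'m::finite. onorm (\<lambda>h. A *v h))"
proof (rule continuous_of_norm_lipschitz)
  fix A B :: "real^'n^'m"
  have "(\<lambda>h. A *v h) = (\<lambda>h. B *v h + (A - B) *v h)"
    by (simp add: matrix_vector_mult_diff_rdistrib)
  then have "onorm (\<lambda>h. A *v h) \<le> onorm (\<lambda>h. B *v h) + onorm (\<lambda>h. (A - B) *v h)"
    using onorm_triangle [OF matrix_vector_mul_bounded_linear matrix_vector_mul_bounded_linear, of B "A - B"]
    by simp
  also have "onorm (\<lambda>h. (A - B) *v h) \<le> norm (A - B)"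
    by (rule onorm_le) (rule norm_matrix_vector_mult_le)
  finally show "onorm (\<lambda>h. A *v h) \<le> onorm (\<lambda>h. B *v h) + norm (A - B)" by simp
qed

text \<open>The adjoint has no larger norm: the square of the left side is the inner product of
  \<open>v\<close> with the image under \<open>A\<close> of the vector on the left.\<close>

lemma norm_transpose_mult_le_onorm:
  fixes A :: "real^'n::finite^'m::finite"
  shows "norm (transpose A *v v) \<le> onorm (\<lambda>h. A *v h) * norm v"
proof (cases "transpose A *v v = 0")
  case True
  then show ?thesis by (simp add: onorm_pos_le matrix_vector_mul_bounded_linear)
next
  case False
  let ?t = "transpose A *v v"
  have "norm ?t * norm ?t = v \<bullet> (A *v ?t)"
    by (metis dot_lmul_matrix dot_square_norm inner_commute power2_eq_square transpose_matrix_vector)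
  also have "\<dots> \<le> norm v * norm (A *v ?t)" by (rule norm_cauchy_schwarz)
  also have "\<dots> \<le> norm v * (onorm (\<lambda>h. A *v h) * norm ?t)"
    by (intro mult_left_mono onorm matrix_vector_mul_bounded_linear) auto
  finally have "norm ?t * norm ?t \<le> (onorm (\<lambda>h. A *v h) * norm v) * norm ?t" by (simp add: mult_ac)
  then show ?thesis using False by (simp add: mult_le_cancel_right)
qed

text \<open>A left inverse \<open>B\<close> forces the image of every unit vector to have length at
  least \<open>1 / norm B\<close>.\<close>

lemma lmin_pos:
  fixes A :: "real^'n::finite^'n"
  assumes "det A \<noteq> 0"
  shows "0 < lmin A"
proof -
  obtain B where B: "B ** A = mat 1" using assms invertible_det_nz invertible_left_inverse by blast
  have *: "1 \<le> norm B * norm (A *v h)" if "norm h = 1" for h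
  proof -
    have "h = B *v (A *v h)" by (simp add: matrix_vector_mul_assoc B)
    then show ?thesis using norm_matrix_vector_mult_le [of B "A *v h"] that by metis
  qed
  have "norm B \<noteq> 0" using *[of "axis undefined 1"] by auto
  then have nB: "0 < norm B" by simp
  have "1 / norm B \<le> lmin A"
    by (rule lmin_greatest) (use * nB in \<open>simp add: divide_simps mult.commute\<close>)
  then show ?thesis using nB by (meson divide_pos_pos less_le_trans zero_less_one)
qed

text \<open>A matrix and its transpose have the same smallest singular value. The transpose is
  needed because it is what acts on the gradient in the chain rule, while \<open>lmin\<close> is
  taken of the Jacobi matrix. The proof pairs the vector on the right with the preimage
  \<open>h\<close> of \<open>v\<close> under \<open>A\<close>, whose length \<open>lmin A\<close>
  controls.\<close>

lemma lmin_transpose_le: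
  fixes A :: "real^'n::finite^'n"
  assumes "det A \<noteq> 0"
  shows "lmin A * norm v \<le> norm (transpose A *v v)"
proof (cases "v = 0")
  case False
  obtain B where B: "A ** B = mat 1" using assms invertible_det_nz invertible_right_inverse by blast
  define h where "h = B *v v"
  have Ah: "A *v h = v" by (simp add: h_def matrix_vector_mul_assoc B)
  then have h0: "h \<noteq> 0" using False by auto
  have "lmin A \<le> norm (A *v (h /\<^sub>R norm h))" using h0 by (intro lmin_le) simp
  also have "\<dots> = norm v / norm h" by (simp add: matrix_vector_mult_scaleR Ah divide_inverse mult.commute)
  finally have l: "lmin A * norm h \<le> norm v" using h0 by (simp add: divide_simps)
  have "norm v * norm v = h \<bullet> (transpose A *v v)"
    by (metis Ah dot_lmul_matrix dot_square_norm inner_commute power2_eq_square transpose_matrix_vector)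
  also have "\<dots> \<le> norm h * norm (transpose A *v v)" by (rule norm_cauchy_schwarz)
  finally have "lmin A * (norm v * norm v) \<le> lmin A * (norm h * norm (transpose A *v v))"
    using lmin_pos [OF assms] by (intro mult_left_mono) auto
  also have "\<dots> \<le> norm v * norm (transpose A *v v)"
    using mult_right_mono [OF l norm_ge_zero] by (simp add: mult.assoc)
  finally have "norm v * (lmin A * norm v) \<le> norm v * norm (transpose A *v v)" by (simp add: mult_ac)
  then show ?thesis using False by (simp add: mult_le_cancel_left)
qed simp

lemma measurable_det [measurable]:
  fixes D :: "'a \<Rightarrow> real^'n::finite^'n"
  assumes [measurable]: "\<And>i j. (\<lambda>x. D x $ i $ j) \<in> borel_measurable M"
  shows "(\<lambda>x. det (D x)) \<in> borel_measurable M"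
  unfolding det_def by measurable

lemma AE_lebesgue_obtains_null:
  assumes "AE y in lebesgue. P y"
  obtains N where "N \<in> null_sets lebesgue" "{y. \<not> P y} \<subseteq> N"
proof (rule AE_E [OF assms])
  fix N assume "{y \<in> space lebesgue. \<not> P y} \<subseteq> N" "emeasure lebesgue N = 0" "N \<in> sets lebesgue"
  then show thesis by (intro that [of N] null_setsI) auto
qed

section \<open>Preimages of null sets and the chain rule\<close>

lemma null_pullback_within:
  fixes \<phi> :: "real^'n::finite \<Rightarrow> real^'n"
  assumes S: "S \<in> sets lebesgue"
    and der: "\<And>x. x \<in> S \<Longrightarrow> (\<phi> has_derivative (\<lambda>h. D x *v h)) (at x within S)"
    and inj: "inj_on \<phi> S" and N: "N \<in> null_sets lebesgue"
  shows "AE x in lebesgue. x \<in> S \<longrightarrow> \<phi> x \<in> N \<longrightarrow> det (D x) = 0"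
proof -
  \<comment> \<open>Change of variables for the indicator of a null set: the integral of the
    absolute Jacobian over the part of \<open>S\<close> that is mapped into \<open>N\<close> is 0,
    so the Jacobian vanishes almost everywhere there.\<close>
  let ?w = "indicator N :: real^'n \<Rightarrow> real"
  have null: "\<phi> ` S \<inter> N \<in> null_sets lebesgue" using null_sets_completion_subset [OF _ N] by auto
  have eq: "(\<lambda>y. indicator (\<phi> ` S) y *\<^sub>R ?w y) = indicator (\<phi> ` S \<inter> N)"
    by (auto simp: indicator_def)
  have w: "set_integrable lebesgue (\<phi> ` S) ?w"
    unfolding set_integrable_def eq using null by (auto simp: null_sets_def)
  have w0: "(LINT y:\<phi> ` S|lebesgue. ?w y) = 0"
    unfolding set_lebesgue_integral_def eq using null by (simp add: null_sets_def measure_def)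
  note cov = change_of_variables_within [OF S der inj w]
  have "(\<integral>x. indicator S x *\<^sub>R (\<bar>det (D x)\<bar> * ?w (\<phi> x)) \<partial>lebesgue) = 0"
    using cov(2) w0 by (simp add: set_lebesgue_integral_def)
  then have "AE x in lebesgue. indicator S x *\<^sub>R (\<bar>det (D x)\<bar> * ?w (\<phi> x)) = 0"
    using integral_nonneg_eq_0_iff_AE [OF cov(1) [unfolded set_integrable_def]] by (simp add: indicator_def)
  then show ?thesis by eventually_elim (auto simp: indicator_def split: if_splits)
qed

text \<open>This replaces the property that preimages of null sets are null, which
  \<open>\<phi>\<close> may lack. Null sets are pulled back on each piece separately, and
  countability of the family joins the exceptional sets.\<close>

lemma AE_pullback:
  fixes \<phi> :: "real^'n::finite \<Rightarrow> real^'n"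
  assumes \<A>: "countable \<A>" "\<And>A. A \<in> \<A> \<Longrightarrow> A \<in> sets lebesgue \<and> A \<subseteq> \<Omega>"
      "\<And>A x. A \<in> \<A> \<Longrightarrow> x \<in> A \<Longrightarrow> (\<phi> has_derivative (\<lambda>h. D x *v h)) (at x within A)"
      "\<Omega> - \<Union>\<A> \<in> null_sets lebesgue"
    and inj: "inj_on \<phi> \<Omega>" and P: "AE y in lebesgue. P y"
  shows "AE x in lebesgue. x \<in> \<Omega> \<longrightarrow> P (\<phi> x) \<or> det (D x) = 0"
proof -
  obtain N where N: "N \<in> null_sets lebesgue" "{y. \<not> P y} \<subseteq> N"
    by (rule AE_lebesgue_obtains_null [OF P])
  have "AE x in lebesgue. x \<in> A \<longrightarrow> \<phi> x \<in> N \<longrightarrow> det (D x) = 0" if "A \<in> \<A>" for A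
    using \<A>(2) [OF that] \<A>(3) [OF that] inj_on_subset [OF inj] N(1) by (intro null_pullback_within) auto
  then have "AE x in lebesgue. \<forall>A\<in>\<A>. x \<in> A \<longrightarrow> \<phi> x \<in> N \<longrightarrow> det (D x) = 0"
    by (intro AE_ball_countable [OF \<A>(1), THEN iffD2] ballI)
  moreover have "AE x in lebesgue. x \<notin> \<Omega> - \<Union>\<A>" by (rule AE_not_in [OF \<A>(4)])
  ultimately show ?thesis by eventually_elim (use N(2) in blast)
qed

text \<open>\<open>f\<close> is replaced by its mollifications, to which
  \<open>weak_chain_rule_C1\<close> applies. A subsequence of their gradients converges almost
  everywhere on the image of \<open>K\<close>, and \<open>pull\<close> transfers this to the domain.
  The common bound \<open>M\<close> makes the gradients of the compositions dominated by a multiple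
  of the entries of \<open>D\<close>.\<close>

lemma weak_chain_rule_bounded_gradient:
  fixes \<phi> :: "real^'n::finite \<Rightarrow> real^'m::finite" and D :: "real^'n \<Rightarrow> real^'n^'m"
  assumes \<Omega>: "open \<Omega>" "continuous_on \<Omega> \<phi>" and \<Omega>': "open \<Omega>'" "\<phi> ` \<Omega> \<subseteq> \<Omega>'"
    and wg: "\<And>l. is_weak_grad \<Omega> (\<lambda>x. \<phi> x $ l) (\<lambda>x. D x $ l)"
    and f: "continuous_on \<Omega>' f" "is_weak_grad \<Omega>' f g" "AE y in lebesgue. y \<in> \<Omega>' \<longrightarrow> norm (g y) \<le> M"
    and pull: "\<And>P. AE y in lebesgue. P y \<Longrightarrow> AE x in lebesgue. x \<in> \<Omega> \<longrightarrow> P (\<phi> x) \<or> D x = 0"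
  shows "is_weak_grad \<Omega> (f \<circ> \<phi>) (\<lambda>x. transpose (D x) *v g (\<phi> x))"
proof -
  have comp: "(transpose (D x) *v g (\<phi> x)) $ i = (\<Sum>l\<in>UNIV. g (\<phi> x) $ l * D x $ l $ i)" for x i
    by (simp add: matrix_vector_mult_def transpose_def mult.commute)
  have main: "integrable lebesgue (\<lambda>x. indicator K x * (\<Sum>l\<in>UNIV. g (\<phi> x) $ l * D x $ l $ i)) \<and>
      (\<forall>\<psi>. smooth_fun \<psi> \<longrightarrow> (\<forall>x. x \<notin> K \<longrightarrow> \<psi> x = 0) \<longrightarrow>
        (\<integral>x. f (\<phi> x) * partial i \<psi> x \<partial>lebesgue)
          = - (\<integral>x. (\<Sum>l\<in>UNIV. g (\<phi> x) $ l * D x $ l $ i) * \<psi> x \<partial>lebesgue))"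
    if K: "compact K" "K \<subseteq> \<Omega>" for K i
  proof -
    define L where "L = \<phi> ` K"
    have L: "compact L" unfolding L_def
      using K \<Omega> by (intro compact_continuous_image) (auto intro: continuous_on_subset)
    have L': "L \<subseteq> \<Omega>'" using K \<Omega>' by (auto simp: L_def)
    obtain W v G where W: "open W" "L \<subseteq> W" "W \<subseteq> \<Omega>'"
      and vd: "\<And>k y. y \<in> W \<Longrightarrow> (v k has_derivative (\<lambda>h. h \<bullet> G k y)) (at y)"
      and Gc: "\<And>k. continuous_on UNIV (G k)"
      and ul: "uniform_limit L v f sequentially"
      and L1: "\<And>i. (\<lambda>k::nat. \<integral>\<^sup>+y\<in>L. ennreal \<bar>G k y $ i - g y $ i\<bar> \<partial>lebesgue) \<longlonglongrightarrow> 0"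
      and GM: "\<And>k y i. y \<in> W \<Longrightarrow> \<bar>G k y $ i\<bar> \<le> M"
    proof (rule weak_grad_C1_approx [OF \<Omega>'(1) f(2,1) L L'], goal_cases)
      case (1 W v G)
      show ?case by (rule 1(1) [OF 1(2-8) 1(9) [OF f(3)]])
    qed
    have intc: "integrable lebesgue (\<lambda>x. indicator L x * b x)" if "continuous_on L b" for b :: "real^'m \<Rightarrow> real"
    proof -
      have "integrable lborel (\<lambda>x. indicator L x *\<^sub>R b x)" by (rule borel_integrable_compact [OF L that])
      moreover from this have "(\<lambda>x. indicator L x *\<^sub>R b x) \<in> borel_measurable lborel" by auto
      ultimately show ?thesis by (simp add: integrable_completion)
    qed
    define e where "e k l y = indicator L y * (G k y $ l - g y $ l)" for k l y
    have ei: "integrable lebesgue (e k l)" for k l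
    proof -
      have "integrable lebesgue (\<lambda>y. indicator L y * G k y $ l - indicator L y * g y $ l)"
        using f(2) L L' by (intro Bochner_Integration.integrable_diff intc continuous_on_component
            continuous_on_subset [OF Gc] loc_integrable_compact) (auto simp: is_weak_grad_def)
      moreover have "(\<lambda>y. indicator L y * G k y $ l - indicator L y * g y $ l) = e k l"
        by (simp add: e_def fun_eq_iff algebra_simps)
      ultimately show ?thesis by simp
    qed
    \<comment> \<open>Summing over the components yields one subsequence that serves all of
      them.\<close>
    define U where "U k y = (\<Sum>l\<in>UNIV. \<bar>e k l y\<bar>)" for k y
    have Ui: "integrable lebesgue (U k)" for k
      unfolding U_def by (intro Bochner_Integration.integrable_sum integrable_abs ei)
    have el: "(\<lambda>k. \<integral>y. \<bar>e k l y\<bar> \<partial>lebesgue) \<longlonglongrightarrow> 0" for l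
    proof -
      have "(\<integral>y. \<bar>e k l y\<bar> \<partial>lebesgue) = enn2real (\<integral>\<^sup>+y\<in>L. ennreal \<bar>G k y $ l - g y $ l\<bar> \<partial>lebesgue)" for k
      proof -
        have "(\<integral>y. \<bar>e k l y\<bar> \<partial>lebesgue) = enn2real (\<integral>\<^sup>+y. ennreal \<bar>e k l y\<bar> \<partial>lebesgue)"
          using ei [of k l] by (intro integral_eq_nn_integral) auto
        also have "(\<integral>\<^sup>+y. ennreal \<bar>e k l y\<bar> \<partial>lebesgue) = (\<integral>\<^sup>+y\<in>L. ennreal \<bar>G k y $ l - g y $ l\<bar> \<partial>lebesgue)"
          by (intro nn_integral_cong) (auto simp: e_def indicator_def)
        finally show ?thesis .
      qed
      moreover have "(\<lambda>k. enn2real (\<integral>\<^sup>+y\<in>L. ennreal \<bar>G k y $ l - g y $ l\<bar> \<partial>lebesgue)) \<longlonglongrightarrow> 0"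
        by (rule tendsto_enn2real) (use L1 [of l] in auto)
      ultimately show ?thesis by simp
    qed
    have "(\<lambda>k. \<integral>y. norm (U k y) \<partial>lebesgue) \<longlonglongrightarrow> 0"
    proof -
      have "(\<integral>y. norm (U k y) \<partial>lebesgue) = (\<Sum>l\<in>UNIV. \<integral>y. \<bar>e k l y\<bar> \<partial>lebesgue)" for k
        using ei by (simp add: U_def sum_nonneg)
      moreover have "(\<lambda>k. \<Sum>l\<in>UNIV. \<integral>y. \<bar>e k l y\<bar> \<partial>lebesgue) \<longlonglongrightarrow> (\<Sum>l\<in>(UNIV::'m set). 0)"
        by (intro tendsto_sum el)
      ultimately show ?thesis by simp
    qed
    from tendsto_L1_AE_subseq [OF Ui this]
    obtain r where r: "strict_mono r" "AE y in lebesgue. (\<lambda>k. U (r k) y) \<longlonglongrightarrow> 0" by blast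
    have rl: "filterlim r sequentially sequentially" by (rule filterlim_subseq [OF r(1)])
    have "AE y in lebesgue. y \<in> L \<longrightarrow> (\<forall>l. (\<lambda>k. G (r k) y $ l) \<longlonglongrightarrow> g y $ l)"
      using r(2)
    proof eventually_elim
      case (elim y)
      show ?case
      proof (intro impI allI)
        fix l assume y: "y \<in> L"
        have "(\<lambda>k. G (r k) y $ l - g y $ l) \<longlonglongrightarrow> 0"
        proof (rule tendsto_rabs_zero_cancel, rule tendsto_sandwich [OF _ _ tendsto_const elim])
          have "\<bar>e k l y\<bar> \<le> U k y" for k unfolding U_def by (rule member_le_sum) auto
          then show "\<forall>\<^sub>F k in sequentially. \<bar>G (r k) y $ l - g y $ l\<bar> \<le> U (r k) y"
            using y by (simp add: e_def)
        qed auto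
        then show "(\<lambda>k. G (r k) y $ l) \<longlonglongrightarrow> g y $ l" by (rule LIM_zero_cancel)
      qed
    qed
    from pull [OF this]
    have conv: "AE x in lebesgue. x \<in> K \<longrightarrow> (\<lambda>k. \<Sum>l\<in>UNIV. G (r k) (\<phi> x) $ l * D x $ l $ i)
        \<longlonglongrightarrow> (\<Sum>l\<in>UNIV. g (\<phi> x) $ l * D x $ l $ i)"
    proof eventually_elim
      case (elim x)
      show ?case
      proof
        assume x: "x \<in> K"
        \<comment> \<open>Where the convergence cannot be pulled back, \<open>D x\<close> vanishes
          and both sides are 0 whatever the gradients do.\<close>
        then consider "D x = 0" | "\<And>l. (\<lambda>k. G (r k) (\<phi> x) $ l) \<longlonglongrightarrow> g (\<phi> x) $ l"
          using elim K(2) by (auto simp: L_def)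
        then show "(\<lambda>k. \<Sum>l\<in>UNIV. G (r k) (\<phi> x) $ l * D x $ l $ i) \<longlonglongrightarrow> (\<Sum>l\<in>UNIV. g (\<phi> x) $ l * D x $ l $ i)"
        proof cases
          case 2
          then show ?thesis by (intro tendsto_sum tendsto_mult tendsto_const)
        qed simp
      qed
    qed
    have Di: "integrable lebesgue (\<lambda>x. indicator K x * D x $ l $ i)" for l
      by (rule loc_integrable_compact [OF _ K]) (use wg [of l] in \<open>auto simp: is_weak_grad_def\<close>)
    have \<phi>K: "continuous_on K \<phi>" using \<Omega>(2) K(2) continuous_on_subset by blast
    define a where "a k x = indicator K x * (\<Sum>l\<in>UNIV. G (r k) (\<phi> x) $ l * D x $ l $ i)" for k x
    define a' where "a' x = indicator K x * (\<Sum>l\<in>UNIV. g (\<phi> x) $ l * D x $ l $ i)" for x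
    have ai: "integrable lebesgue (a k)" for k
    proof -
      have "continuous_on K (\<lambda>x. G (r k) (\<phi> x) $ l)" for l
        by (intro continuous_on_component continuous_on_compose2 [OF Gc \<phi>K]) simp
      then have "integrable lebesgue (\<lambda>x. \<Sum>l\<in>UNIV. indicator K x * (G (r k) (\<phi> x) $ l * D x $ l $ i))"
        by (intro Bochner_Integration.integrable_sum compact_mult_integrable K Di)
      then show ?thesis by (simp add: a_def [abs_def] sum_distrib_left)
    qed
    \<comment> \<open>Domination holds at every point of \<open>K\<close>, because the approximating
      gradients obey the bound \<open>M\<close> on all of \<open>W\<close> and not just almost
      everywhere.\<close>
    define w where "w x = (\<Sum>l\<in>UNIV. M * \<bar>indicator K x * D x $ l $ i\<bar>)" for x
    have wi: "integrable lebesgue w"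
      unfolding w_def by (intro Bochner_Integration.integrable_sum integrable_mult_right integrable_abs Di)
    have aw: "\<bar>a k x\<bar> \<le> w x" for k x
    proof (cases "x \<in> K")
      case True
      have "\<bar>\<Sum>l\<in>UNIV. G (r k) (\<phi> x) $ l * D x $ l $ i\<bar> \<le> (\<Sum>l\<in>UNIV. \<bar>G (r k) (\<phi> x) $ l * D x $ l $ i\<bar>)"
        by (rule sum_abs)
      also have "\<dots> \<le> (\<Sum>l\<in>UNIV. M * \<bar>D x $ l $ i\<bar>)"
        unfolding abs_mult by (intro sum_mono mult_right_mono GM) (use True W in \<open>auto simp: L_def\<close>)
      finally show ?thesis using True by (simp add: a_def w_def)
    qed (simp add: a_def w_def)
    have aconv: "AE x in lebesgue. (\<lambda>k. a k x) \<longlonglongrightarrow> a' x"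
      using conv
    proof eventually_elim
      case (elim x)
      then show ?case by (cases "x \<in> K") (auto simp: a_def a'_def)
    qed
    \<comment> \<open>Composing the Lebesgue measurable \<open>g\<close> with a continuous map gives
      no measurability by itself. It is obtained instead for an almost everywhere limit of
      measurable functions, using that Lebesgue measure is complete.\<close>
    have a'm: "a' \<in> borel_measurable lebesgue"
    proof -
      obtain Z where Z: "Z \<in> null_sets lebesgue" "{x. \<not> (\<lambda>k. a k x) \<longlonglongrightarrow> a' x} \<subseteq> Z"
        by (rule AE_lebesgue_obtains_null [OF aconv])
      have "(\<lambda>x. indicator (- Z) x * a' x) \<in> borel_measurable lebesgue"
      proof (rule borel_measurable_LIMSEQ_real)
        show "(\<lambda>x. indicator (- Z) x * a k x) \<in> borel_measurable lebesgue" for k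
        proof -
          have "- Z \<in> sets lebesgue" using Z by (auto simp: Compl_in_sets_lebesgue)
          then show ?thesis using ai [of k] by measurable
        qed
        show "(\<lambda>k. indicator (- Z) x * a k x) \<longlonglongrightarrow> indicator (- Z) x * a' x" for x
          using Z(2) by (cases "x \<in> Z") auto
      qed
      moreover have "AE x in lebesgue. indicator (- Z) x * a' x = a' x"
        using AE_not_in [OF Z(1)] by eventually_elim simp
      ultimately show ?thesis
        by (rule borel_measurable_AE)
    qed
    have a'i: "integrable lebesgue a'"
      by (rule integrable_dominated_convergence [OF a'm _ wi aconv]) (use ai aw in auto)
    have eqn: "(\<integral>x. f (\<phi> x) * partial i \<psi> x \<partial>lebesgue)
          = - (\<integral>x. (\<Sum>l\<in>UNIV. g (\<phi> x) $ l * D x $ l $ i) * \<psi> x \<partial>lebesgue)"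
      if \<psi>: "smooth_fun \<psi>" "\<And>x. x \<notin> K \<Longrightarrow> \<psi> x = 0" for \<psi>
    proof -
      have p0: "x \<notin> K \<Longrightarrow> partial i \<psi> x = 0" for x
        by (rule partial_eq_0_outside [OF \<psi>(2) compact_imp_closed [OF K(1)]])
      have \<psi>c: "continuous_on UNIV \<psi>" by (rule smooth_fun_continuous [OF \<psi>(1)])
      obtain B where B: "0 \<le> B" "\<And>x. norm (\<psi> x) \<le> B"
        using compact_support_bounded [OF \<psi>c K(1) \<psi>(2)] by metis
      have \<psi>m: "\<psi> \<in> borel_measurable lebesgue" by (rule continuous_borel_measurable_lebesgue [OF \<psi>c])
      have eqk: "(\<integral>x. indicator K x * (v (r k) (\<phi> x) * partial i \<psi> x) \<partial>lebesgue) = - (\<integral>x. a k x * \<psi> x \<partial>lebesgue)" for k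
      proof -
        have "(\<integral>x. v (r k) (\<phi> x) * partial i \<psi> x \<partial>lebesgue)
          = - (\<integral>x. (\<Sum>l\<in>UNIV. G (r k) (\<phi> x) $ l * D x $ l $ i) * \<psi> x \<partial>lebesgue)"
          by (rule weak_chain_rule_C1 [OF \<Omega> wg K W(1) W(2) [unfolded L_def] vd continuous_on_subset [OF Gc] \<psi>]) auto
        moreover have "(\<lambda>x. v (r k) (\<phi> x) * partial i \<psi> x) = (\<lambda>x. indicator K x * (v (r k) (\<phi> x) * partial i \<psi> x))"
          using p0 by (auto simp: indicator_def fun_eq_iff)
        moreover have "(\<lambda>x. (\<Sum>l\<in>UNIV. G (r k) (\<phi> x) $ l * D x $ l $ i) * \<psi> x) = (\<lambda>x. a k x * \<psi> x)"
          using \<psi>(2) by (auto simp: a_def indicator_def fun_eq_iff)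
        ultimately show ?thesis by (simp only:)
      qed
      have "(\<lambda>k. \<integral>x. a k x * \<psi> x \<partial>lebesgue) \<longlonglongrightarrow> (\<integral>x. a' x * \<psi> x \<partial>lebesgue)"
      proof (rule integral_dominated_convergence [where w = "\<lambda>x. w x * B"])
        show "AE x in lebesgue. (\<lambda>k. a k x * \<psi> x) \<longlonglongrightarrow> a' x * \<psi> x"
          using aconv by eventually_elim (intro tendsto_intros)
        show "AE x in lebesgue. norm (a k x * \<psi> x) \<le> w x * B" for k
        proof (rule AE_I2)
          fix x
          have "0 \<le> w x" using aw [of k x] by linarith
          then show "norm (a k x * \<psi> x) \<le> w x * B"
            using aw [of k x] B(2) [of x] by (simp add: abs_mult mult_mono)
        qed
      qed (use ai a'm \<psi>m wi in auto)
      then have lim1: "(\<lambda>k. - (\<integral>x. a k x * \<psi> x \<partial>lebesgue)) \<longlonglongrightarrow> - (\<integral>x. a' x * \<psi> x \<partial>lebesgue)"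
        by (rule tendsto_minus)
      have vL: "continuous_on L (v k)" for k
        by (intro continuous_at_imp_continuous_on ballI, rule has_derivative_continuous [OF vd]) (use W in blast)
      have fL: "continuous_on L f" using f(1) L' continuous_on_subset by blast
      have ulK: "uniform_limit K (\<lambda>k x. v (r k) (\<phi> x)) (\<lambda>x. f (\<phi> x)) sequentially"
      proof (rule uniform_limitI)
        fix d :: real assume "0 < d"
        from uniform_limitD [OF filterlim_compose [OF ul rl] this]
        show "\<forall>\<^sub>F k in sequentially. \<forall>x\<in>K. dist (v (r k) (\<phi> x)) (f (\<phi> x)) < d"
          by eventually_elim (auto simp: L_def)
      qed
      have p: "integrable lebesgue (\<lambda>x. indicator K x * partial i \<psi> x)"
      proof -
        have "integrable lebesgue (partial i \<psi>)"
          by (rule compact_support_integrable_lebesgue [OF _ K(1) p0])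
            (rule smooth_fun_continuous [OF smooth_fun_partial [OF \<psi>(1)]])
        moreover have "(\<lambda>x. indicator K x * partial i \<psi> x) = partial i \<psi>"
          using p0 by (auto simp: indicator_def fun_eq_iff)
        ultimately show ?thesis by (simp only:)
      qed
      have "(\<lambda>k. \<integral>x. indicator K x * (v (r k) (\<phi> x) * partial i \<psi> x) \<partial>lebesgue)
          \<longlonglongrightarrow> (\<integral>x. indicator K x * (f (\<phi> x) * partial i \<psi> x) \<partial>lebesgue)"
        by (rule integral_mult_uniform_L1_limit [OF K(1) _ _ ulK p p])
          (auto intro!: continuous_on_compose2 [OF vL \<phi>K] continuous_on_compose2 [OF fL \<phi>K] simp: L_def)
      then have "(\<integral>x. indicator K x * (f (\<phi> x) * partial i \<psi> x) \<partial>lebesgue) = - (\<integral>x. a' x * \<psi> x \<partial>lebesgue)"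
        using lim1 unfolding eqk by (rule LIMSEQ_unique)
      moreover have "(\<lambda>x. f (\<phi> x) * partial i \<psi> x) = (\<lambda>x. indicator K x * (f (\<phi> x) * partial i \<psi> x))"
        using p0 by (auto simp: indicator_def fun_eq_iff)
      moreover have "(\<lambda>x. (\<Sum>l\<in>UNIV. g (\<phi> x) $ l * D x $ l $ i) * \<psi> x) = (\<lambda>x. a' x * \<psi> x)"
        using \<psi>(2) by (auto simp: a'_def indicator_def fun_eq_iff)
      ultimately show ?thesis by (simp only:)
    qed
    show ?thesis using a'i eqn unfolding a'_def by blast
  qed
  have fc: "continuous_on \<Omega> (\<lambda>x. f (\<phi> x))" by (rule continuous_on_compose2 [OF f(1) \<Omega>(2) \<Omega>'(2)])
  show ?thesis
    unfolding is_weak_grad_def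
  proof (intro conjI allI impI)
    show "loc_integrable \<Omega> (f \<circ> \<phi>)"
      unfolding loc_integrable_def set_integrable_def
    proof (intro allI impI)
      fix K assume K: "compact K \<and> K \<subseteq> \<Omega>"
      then have "integrable lborel (\<lambda>x. indicator K x *\<^sub>R f (\<phi> x))"
        by (intro borel_integrable_compact continuous_on_subset [OF fc]) auto
      moreover from this have "(\<lambda>x. indicator K x *\<^sub>R f (\<phi> x)) \<in> borel_measurable lborel" by auto
      ultimately show "integrable lebesgue (\<lambda>x. indicator K x *\<^sub>R (f \<circ> \<phi>) x)"
        by (simp add: integrable_completion)
    qed
    show "loc_integrable \<Omega> (\<lambda>x. (transpose (D x) *v g (\<phi> x)) $ i)" for i
      unfolding loc_integrable_def set_integrable_def comp using main by auto
    fix \<psi> i assume "test_fun \<Omega> \<psi>"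
    then have \<psi>: "smooth_fun \<psi>" and K: "compact (closure {x. \<psi> x \<noteq> 0})" "closure {x. \<psi> x \<noteq> 0} \<subseteq> \<Omega>"
      by (auto simp: test_fun_def)
    have z: "\<psi> x = 0" if "x \<notin> closure {x. \<psi> x \<noteq> 0}" for x
      using that closure_subset [of "{x. \<psi> x \<noteq> 0}"] by blast
    have p0: "partial i \<psi> x = 0" if "x \<notin> closure {x. \<psi> x \<noteq> 0}" for x
      by (rule partial_eq_0_outside [OF z closed_closure that])
    have out: "\<psi> x = 0" "partial i \<psi> x = 0" if "x \<notin> \<Omega>" for x
      using z [of x] p0 [of x] K(2) that by blast+
    have "(\<integral>x. f (\<phi> x) * partial i \<psi> x \<partial>lebesgue)
          = - (\<integral>x. (\<Sum>l\<in>UNIV. g (\<phi> x) $ l * D x $ l $ i) * \<psi> x \<partial>lebesgue)"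
      by (rule main [OF K, THEN conjunct2, rule_format, OF \<psi> z])
    moreover have "(\<lambda>x. indicator \<Omega> x *\<^sub>R ((f \<circ> \<phi>) x * partial i \<psi> x)) = (\<lambda>x. f (\<phi> x) * partial i \<psi> x)"
      by (auto simp: indicator_def fun_eq_iff out)
    moreover have "(\<lambda>x. indicator \<Omega> x *\<^sub>R ((transpose (D x) *v g (\<phi> x)) $ i * \<psi> x))
        = (\<lambda>x. (\<Sum>l\<in>UNIV. g (\<phi> x) $ l * D x $ l $ i) * \<psi> x)"
      unfolding comp by (auto simp: indicator_def fun_eq_iff out)
    ultimately show "(LINT x:\<Omega>|lebesgue. (f \<circ> \<phi>) x * partial i \<psi> x) =
        - (LINT x:\<Omega>|lebesgue. (transpose (D x) *v g (\<phi> x)) $ i * \<psi> x)"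
      unfolding set_lebesgue_integral_def by (simp only:)
  qed
qed

section \<open>Lebesgue norms and the main estimate\<close>

text \<open>On disjoint pieces the change of variables is an equality, and summation recovers the
  whole image up to the image of a null set. The majorant \<open>H\<close> is where the caller
  inserts the gradient of the composition, so that the comparison of integrands needs to hold only
  almost everywhere in the domain.\<close>

lemma area_inequality:
  fixes \<phi> :: "real^'n::finite \<Rightarrow> real^'n" and w :: "real^'n \<Rightarrow> real" and H :: "real^'n \<Rightarrow> ennreal"
  assumes \<A>: "countable \<A>" "\<And>A. A \<in> \<A> \<Longrightarrow> A \<in> sets lebesgue \<and> A \<subseteq> \<Omega>"
      "\<And>A x. A \<in> \<A> \<Longrightarrow> x \<in> A \<Longrightarrow> (\<phi> has_derivative (\<lambda>h. D x *v h)) (at x within A)"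
      "\<Omega> - \<Union>\<A> \<in> null_sets lebesgue"
    and inj: "inj_on \<phi> \<Omega>" and luzin: "luzin_N \<Omega> \<phi>"
    and w: "set_integrable lebesgue (\<phi> ` \<Omega>) w" "\<And>y. 0 \<le> w y"
    and H: "(\<lambda>x. H x * indicator \<Omega> x) \<in> borel_measurable lebesgue"
      "AE x in lebesgue. x \<in> \<Omega> \<longrightarrow> ennreal (\<bar>det (D x)\<bar> * w (\<phi> x)) \<le> H x"
  shows "(\<integral>\<^sup>+y\<in>\<phi> ` \<Omega>. ennreal (w y) \<partial>lebesgue) \<le> (\<integral>\<^sup>+x\<in>\<Omega>. H x \<partial>lebesgue)"
proof -
  \<comment> \<open>The empty set is inserted so that the enumeration makes sense even if the family
    is empty; \<open>disjointed\<close> avoids counting points twice on the right-hand side.\<close>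
  define B where "B = disjointed (from_nat_into (insert {} \<A>))"
  have r: "range (from_nat_into (insert {} \<A>)) = insert {} \<A>"
    using \<A>(1) by (intro range_from_nat_into) auto
  have e: "from_nat_into (insert {} \<A>) m \<in> insert {} \<A>" for m using r by blast
  have Bsub: "\<exists>A\<in>insert {} \<A>. B m \<subseteq> A" for m
    using e [of m] disjointed_subset [of "from_nat_into (insert {} \<A>)" m] by (auto simp: B_def)
  have "range (from_nat_into (insert {} \<A>)) \<subseteq> sets lebesgue"
    unfolding r using \<A>(2) by auto
  then have Bm: "B m \<in> sets lebesgue" for m
    unfolding B_def using sets.range_disjointed_sets by blast
  have B\<Omega>: "B m \<subseteq> \<Omega>" for m using Bsub [of m] \<A>(2) by blast
  have Bdisj: "disjoint_family B" unfolding B_def by (rule disjoint_family_disjointed)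
  have BU: "(\<Union>m. B m) = \<Union>\<A>" unfolding B_def UN_disjointed_eq using r by auto
  have der: "(\<phi> has_derivative (\<lambda>h. D x *v h)) (at x within B m)" if x: "x \<in> B m" for m x
  proof -
    obtain A where A: "A \<in> \<A>" "B m \<subseteq> A" using Bsub [of m] x by blast
    show ?thesis by (rule has_derivative_subset [OF \<A>(3) [OF A(1)] A(2)]) (use A x in blast)
  qed
  have injB: "inj_on \<phi> (B m)" for m by (rule inj_on_subset [OF inj B\<Omega>])
  have imB: "\<phi> ` B m \<in> sets lebesgue" for m
    by (rule differentiable_image_in_sets_lebesgue [OF Bm])
      (auto simp: differentiable_on_def differentiable_def intro: der)
  have wB: "set_integrable lebesgue (\<phi> ` B m) w" for m
    by (rule set_integrable_subset [OF w(1) imB]) (use B\<Omega> in blast)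
  have piece: "(\<integral>\<^sup>+y\<in>\<phi> ` B m. ennreal (w y) \<partial>lebesgue) \<le> (\<integral>\<^sup>+x\<in>B m. H x \<partial>lebesgue)" for m
  proof -
    note cov = change_of_variables_within [OF Bm der injB wB]
    have "(\<integral>\<^sup>+y\<in>\<phi> ` B m. ennreal (w y) \<partial>lebesgue) = (\<integral>\<^sup>+y. ennreal (indicator (\<phi> ` B m) y *\<^sub>R w y) \<partial>lebesgue)"
      by (intro nn_integral_cong) (auto simp: indicator_def)
    also have "\<dots> = ennreal (LINT y:\<phi> ` B m|lebesgue. w y)"
      unfolding set_lebesgue_integral_def
      by (rule nn_integral_eq_integral) (use wB w(2) in \<open>auto simp: set_integrable_def\<close>)
    also have "\<dots> = ennreal (LINT x:B m|lebesgue. \<bar>det (D x)\<bar> * w (\<phi> x))" by (simp only: cov(2))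
    also have "\<dots> = (\<integral>\<^sup>+x. ennreal (indicator (B m) x *\<^sub>R (\<bar>det (D x)\<bar> * w (\<phi> x))) \<partial>lebesgue)"
      unfolding set_lebesgue_integral_def
      by (rule nn_integral_eq_integral [symmetric]) (use cov(1) w(2) in \<open>auto simp: set_integrable_def\<close>)
    also have "\<dots> \<le> (\<integral>\<^sup>+x\<in>B m. H x \<partial>lebesgue)"
    proof (rule nn_integral_mono_AE, use H(2) in eventually_elim)
      case (elim x)
      then show ?case using B\<Omega> [of m] by (auto simp: indicator_def)
    qed
    finally show ?thesis .
  qed
  \<comment> \<open>Luzin's property: the part of the domain outside all pieces has a null image and
    does not contribute to the left-hand integral.\<close>
  have null: "\<phi> ` (\<Omega> - \<Union>\<A>) \<in> null_sets lebesgue"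
    by (intro luzin [unfolded luzin_N_def, rule_format] conjI Diff_subset \<A>(4))
  have "(\<integral>\<^sup>+y\<in>\<phi> ` \<Omega>. ennreal (w y) \<partial>lebesgue) \<le> (\<integral>\<^sup>+y. (\<Sum>m. ennreal (w y) * indicator (\<phi> ` B m) y) \<partial>lebesgue)"
  proof (rule nn_integral_mono_AE, use AE_not_in [OF null] in eventually_elim)
    case (elim y)
    show ?case
    proof (cases "y \<in> \<phi> ` \<Omega>")
      case True
      then obtain x where x: "x \<in> \<Omega>" "y = \<phi> x" by blast
      then have "x \<in> \<Union>\<A>" using elim by blast
      then obtain m where "x \<in> B m" using BU by blast
      then have m: "y \<in> \<phi> ` B m" using x by blast
      have "ennreal (w y) * indicator (\<phi> ` \<Omega>) y = (\<Sum>k\<in>{m}. ennreal (w y) * indicator (\<phi> ` B k) y)"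
        using True m by simp
      also have "\<dots> \<le> (\<Sum>k. ennreal (w y) * indicator (\<phi> ` B k) y)"
        by (rule sum_le_suminf) auto
      finally show ?thesis .
    qed simp
  qed
  also have "\<dots> = (\<Sum>m. \<integral>\<^sup>+y\<in>\<phi> ` B m. ennreal (w y) \<partial>lebesgue)"
  proof (rule nn_integral_suminf)
    fix m
    have "(\<lambda>y. ennreal (indicator (\<phi> ` B m) y *\<^sub>R w y)) \<in> borel_measurable lebesgue"
      using wB [of m] by (auto simp: set_integrable_def)
    moreover have "(\<lambda>y. ennreal (w y) * indicator (\<phi> ` B m) y) = (\<lambda>y. ennreal (indicator (\<phi> ` B m) y *\<^sub>R w y))"
      by (auto simp: indicator_def fun_eq_iff)
    ultimately show "(\<lambda>y. ennreal (w y) * indicator (\<phi> ` B m) y) \<in> borel_measurable lebesgue" by (simp only:)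
  qed
  also have "\<dots> \<le> (\<Sum>m. \<integral>\<^sup>+x\<in>B m. H x \<partial>lebesgue)"
    by (intro suminf_le piece) auto
  also have "\<dots> = (\<integral>\<^sup>+x. (\<Sum>m. H x * indicator (B m) x) \<partial>lebesgue)"
  proof (rule nn_integral_suminf [symmetric])
    fix m
    have "(\<lambda>x. (H x * indicator \<Omega> x) * indicator (B m) x) \<in> borel_measurable lebesgue"
      by (rule borel_measurable_times_ennreal [OF H(1) borel_measurable_indicator [OF Bm]])
    moreover have "(\<lambda>x. H x * indicator (B m) x) = (\<lambda>x. (H x * indicator \<Omega> x) * indicator (B m) x)"
      using B\<Omega> [of m] by (auto simp: indicator_def fun_eq_iff)
    ultimately show "(\<lambda>x. H x * indicator (B m) x) \<in> borel_measurable lebesgue" by (simp only:)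
  qed
  also have "\<dots> \<le> (\<integral>\<^sup>+x\<in>\<Omega>. H x \<partial>lebesgue)"
  proof (rule nn_integral_mono)
    fix x
    have "(\<Sum>m. H x * indicator (B m) x) = H x * (\<Sum>m. indicator (B m) x)" by (rule ennreal_suminf_cmult)
    also have "(\<Sum>m. indicator (B m) x) = (indicator (\<Union>m. B m) x :: ennreal)"
      by (rule suminf_indicator [OF Bdisj])
    also have "H x * indicator (\<Union>m. B m) x \<le> H x * indicator \<Omega> x"
      using B\<Omega> by (intro mult_left_mono) (auto simp: indicator_def)
    finally show "(\<Sum>m. H x * indicator (B m) x) \<le> H x * indicator \<Omega> x" .
  qed
  finally show ?thesis .
qed

section \<open>Lebesgue norms with values in \<open>ennreal\<close> and Hoelder's inequality\<close>

lemma Linf_norm_AE: "AE x in lebesgue. x \<in> U \<longrightarrow> ennreal \<bar>h x\<bar> \<le> Linf_norm U h"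
proof -
  let ?S = "{c. AE x in lebesgue. x \<in> U \<longrightarrow> ennreal \<bar>h x\<bar> \<le> c}"
  \<comment> \<open>The infimum is the infimum of a sequence of admissible constants, and countably
    many exceptional null sets may be discarded together.\<close>
  have "top \<in> ?S" by simp
  then obtain c :: "nat \<Rightarrow> ennreal" where c: "range c \<subseteq> ?S" "Inf ?S = (INF i. c i)"
    using ennreal_Inf_countable_INF [of ?S] by blast
  have "AE x in lebesgue. \<forall>i. x \<in> U \<longrightarrow> ennreal \<bar>h x\<bar> \<le> c i"
    unfolding AE_all_countable using c(1) by blast
  then show ?thesis
    unfolding Linf_norm_def c(2) by eventually_elim (auto intro: INF_greatest)
qed

text \<open>The outer operation of \<open>Lp_norm\<close>, split off so that integrals can be
  estimated before the root is taken.\<close>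

definition ennroot :: "real \<Rightarrow> ennreal \<Rightarrow> ennreal" where
  "ennroot p I = (if I = \<infinity> then \<infinity> else ennreal (enn2real I powr (1 / p)))"

lemma Lp_norm_ennroot:
  "Lp_norm U p h = ennroot p (\<integral>\<^sup>+x\<in>U. ennreal (\<bar>h x\<bar> powr p) \<partial>lebesgue)"
  by (simp add: Lp_norm_def ennroot_def Let_def mult.commute)

lemma ennroot_le:
  assumes p: "0 < p" and C: "0 \<le> C" and le: "I \<le> ennreal (C powr p) * J"
  shows "ennroot p I \<le> ennreal C * ennroot p J"
proof (cases "J = \<infinity>")
  case True
  show ?thesis
  \<comment> \<open>In \<open>ennreal\<close> the product of 0 and infinity is 0, so for
    \<open>C = 0\<close> the hypothesis forces \<open>I = 0\<close> even though \<open>J\<close> is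
    infinite.\<close>
  proof (cases "C = 0")
    case True
    then have "I = 0" using le by simp
    then show ?thesis by (simp add: ennroot_def)
  next
    case False
    then show ?thesis using True C by (simp add: ennroot_def ennreal_mult_eq_top_iff)
  qed
next
  case False
  then obtain j where j: "J = ennreal j" "0 \<le> j" by (cases J) auto
  have le': "I \<le> ennreal (C powr p * j)" using le j by (simp add: ennreal_mult)
  then obtain i where i: "I = ennreal i" "0 \<le> i" by (cases I) (auto simp: top_unique)
  have "i \<le> C powr p * j" using le' i j by (simp add: ennreal_le_iff)
  then have "i powr (1 / p) \<le> (C powr p * j) powr (1 / p)" using i p by (intro powr_mono2) auto
  also have "\<dots> = C * j powr (1 / p)" using p C j by (simp add: powr_mult powr_powr)
  finally show ?thesis using i j C by (simp add: ennroot_def ennreal_leI flip: ennreal_mult)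
qed

lemma ennroot_eq_0_iff: "ennroot p I = 0 \<longleftrightarrow> I = 0"
  by (cases I) (auto simp: ennroot_def)

lemma powr_ennroot:
  assumes "0 < p" "ennroot p I = ennreal a" "0 \<le> a"
  shows "I = ennreal (a powr p)"
proof (cases I)
  case (real i)
  then have "i powr (1 / p) = a" using assms by (simp add: ennroot_def)
  then have "a powr p = i" using assms real by (auto simp: powr_powr)
  then show ?thesis using real by simp
qed (use assms in \<open>simp add: ennroot_def\<close>)

lemma Lp_norm_mono_AE:
  fixes U :: "(real^'n::finite) set"
  assumes p: "0 < p" and C: "0 \<le> C" and m: "(\<lambda>x. indicator U x * b x) \<in> borel_measurable lebesgue"
    and le: "AE x in lebesgue. x \<in> U \<longrightarrow> \<bar>a x\<bar> \<le> C * \<bar>b x\<bar>"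
  shows "Lp_norm U p a \<le> ennreal C * Lp_norm U p b"
  unfolding Lp_norm_ennroot
proof (rule ennroot_le [OF p C])
  have b: "(\<lambda>x. ennreal (\<bar>b x\<bar> powr p) * indicator U x) \<in> borel_measurable lebesgue"
  proof -
    have "(\<lambda>x. ennreal (\<bar>indicator U x * b x\<bar> powr p)) \<in> borel_measurable lebesgue" using m by measurable
    moreover have "(\<lambda>x. ennreal (\<bar>b x\<bar> powr p) * indicator U x) = (\<lambda>x. ennreal (\<bar>indicator U x * b x\<bar> powr p))"
      by (auto simp: indicator_def fun_eq_iff)
    ultimately show ?thesis by (simp only:)
  qed
  have "(\<integral>\<^sup>+x\<in>U. ennreal (\<bar>a x\<bar> powr p) \<partial>lebesgue)
      \<le> (\<integral>\<^sup>+x. ennreal (C powr p) * (ennreal (\<bar>b x\<bar> powr p) * indicator U x) \<partial>lebesgue)"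
  proof (rule nn_integral_mono_AE, use le in eventually_elim)
    case (elim x)
    show ?case
    proof (cases "x \<in> U")
      case True
      have "\<bar>a x\<bar> powr p \<le> (C * \<bar>b x\<bar>) powr p" using elim True p by (intro powr_mono2) auto
      also have "\<dots> = C powr p * \<bar>b x\<bar> powr p" using C by (simp add: powr_mult)
      finally show ?thesis using True by (simp add: ennreal_leI flip: ennreal_mult)
    qed simp
  qed
  also have "\<dots> = ennreal (C powr p) * (\<integral>\<^sup>+x\<in>U. ennreal (\<bar>b x\<bar> powr p) \<partial>lebesgue)"
    by (rule nn_integral_cmult [OF b])
  finally show "(\<integral>\<^sup>+x\<in>U. ennreal (\<bar>a x\<bar> powr p) \<partial>lebesgue)
      \<le> ennreal (C powr p) * (\<integral>\<^sup>+x\<in>U. ennreal (\<bar>b x\<bar> powr p) \<partial>lebesgue)" .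
qed

text \<open>Hoelder's inequality for \<open>1 / s = 1 / q + 1 / \<kappa>\<close>, obtained from
  Young's inequality with the weights \<open>s / q\<close> and \<open>s / \<kappa>\<close> after
  both functions have been divided by their norms.\<close>

lemma Lp_norm_product_le:
  fixes U :: "(real^'n::finite) set" and a b :: "real^'n \<Rightarrow> real"
  assumes sq: "0 < s" "s < q" and \<kappa>: "\<kappa> = 1 / (1 / s - 1 / q)"
    and ma: "(\<lambda>x. indicator U x * a x) \<in> borel_measurable lebesgue"
    and mb: "(\<lambda>x. indicator U x * b x) \<in> borel_measurable lebesgue"
  shows "ennroot s (\<integral>\<^sup>+x\<in>U. ennreal (\<bar>a x * b x\<bar> powr s) \<partial>lebesgue) \<le> Lp_norm U \<kappa> b * Lp_norm U q a"
proof -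
  have q: "0 < q" using sq by simp
  have inv: "1 / q < 1 / s" using sq by (simp add: frac_less2)
  then have \<kappa>0: "0 < \<kappa>" by (simp add: \<kappa>)
  have sum1: "s / q + s / \<kappa> = 1" using sq by (simp add: \<kappa> algebra_simps)
  have mp: "(\<lambda>x. ennreal (\<bar>c x\<bar> powr r) * indicator U x) \<in> borel_measurable lebesgue"
    if "(\<lambda>x. indicator U x * c x) \<in> borel_measurable lebesgue" for c :: "real^'n \<Rightarrow> real" and r
  proof -
    have "(\<lambda>x. ennreal (\<bar>indicator U x * c x\<bar> powr r)) \<in> borel_measurable lebesgue" using that by measurable
    moreover have "(\<lambda>x. ennreal (\<bar>c x\<bar> powr r) * indicator U x) = (\<lambda>x. ennreal (\<bar>indicator U x * c x\<bar> powr r))"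
      by (auto simp: indicator_def fun_eq_iff)
    ultimately show ?thesis by (simp only:)
  qed
  have zero: "AE x in lebesgue. x \<in> U \<longrightarrow> c x = 0" if "Lp_norm U r c = 0" "(\<lambda>x. indicator U x * c x) \<in> borel_measurable lebesgue"
    for c :: "real^'n \<Rightarrow> real" and r
  proof -
    have "(\<integral>\<^sup>+x\<in>U. ennreal (\<bar>c x\<bar> powr r) \<partial>lebesgue) = 0"
      using that(1) by (simp add: Lp_norm_ennroot ennroot_eq_0_iff)
    then have "AE x in lebesgue. ennreal (\<bar>c x\<bar> powr r) * indicator U x = 0"
      using nn_integral_0_iff_AE [OF mp [OF that(2)]] by simp
    then show ?thesis by eventually_elim (auto simp: indicator_def split: if_splits)
  qed
  \<comment> \<open>A vanishing norm comes first: against an infinite one the right side would be 0,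
    and the claim then holds because the product vanishes almost everywhere. Only with both norms
    positive and finite can the functions be normalised.\<close>
  consider "Lp_norm U \<kappa> b = 0 \<or> Lp_norm U q a = 0"
    | "Lp_norm U \<kappa> b * Lp_norm U q a = \<infinity>"
    | A B where "0 < A" "0 < B" "Lp_norm U q a = ennreal A" "Lp_norm U \<kappa> b = ennreal B"
  proof (cases "Lp_norm U \<kappa> b"; cases "Lp_norm U q a")
    fix B A assume "0 \<le> B" "Lp_norm U \<kappa> b = ennreal B" "0 \<le> A" "Lp_norm U q a = ennreal A"
    then show thesis using that(1,3) by (cases "A = 0"; cases "B = 0") auto
  qed (use that(1,2) in \<open>auto simp: ennreal_mult_eq_top_iff\<close>)
  then show ?thesis
  proof cases
    case 1
    have "AE x in lebesgue. x \<in> U \<longrightarrow> a x * b x = 0"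
    proof (cases "Lp_norm U \<kappa> b = 0")
      case True
      from zero [OF this mb] show ?thesis by eventually_elim auto
    next
      case False
      with 1 have "Lp_norm U q a = 0" by simp
      from zero [OF this ma] show ?thesis by eventually_elim auto
    qed
    then have "(\<integral>\<^sup>+x\<in>U. ennreal (\<bar>a x * b x\<bar> powr s) \<partial>lebesgue) = (\<integral>\<^sup>+x. 0 \<partial>(lebesgue :: (real^'n) measure))"
      by (intro nn_integral_cong_AE) (auto elim!: eventually_mono simp: indicator_def)
    then show ?thesis by (simp add: ennroot_def)
  next
    case 2
    then show ?thesis by simp
  next
    case (3 A B)
    have IA: "(\<integral>\<^sup>+x\<in>U. ennreal (\<bar>a x\<bar> powr q) \<partial>lebesgue) = ennreal (A powr q)"
      using 3 q by (intro powr_ennroot) (auto simp: Lp_norm_ennroot)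
    have IB: "(\<integral>\<^sup>+x\<in>U. ennreal (\<bar>b x\<bar> powr \<kappa>) \<partial>lebesgue) = ennreal (B powr \<kappa>)"
      using 3 \<kappa>0 by (intro powr_ennroot) (auto simp: Lp_norm_ennroot)
    \<comment> \<open>Young's coefficients after the normalisation has been undone. Integrated, the
      two terms add up to \<open>(A * B) powr s\<close>, because
      \<open>s / q + s / \<kappa> = 1\<close>.\<close>
    define \<alpha> where "\<alpha> = (A * B) powr s * (s / q) / A powr q"
    define \<beta> where "\<beta> = (A * B) powr s * (s / \<kappa>) / B powr \<kappa>"
    have \<alpha>\<beta>: "0 \<le> \<alpha>" "0 \<le> \<beta>" using sq \<kappa>0 by (auto simp: \<alpha>_def \<beta>_def)
    have young: "\<bar>a x * b x\<bar> powr s \<le> \<alpha> * \<bar>a x\<bar> powr q + \<beta> * \<bar>b x\<bar> powr \<kappa>" for x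
    proof (cases "a x = 0 \<or> b x = 0")
      case True
      then have "\<bar>a x * b x\<bar> powr s = 0" by auto
      then show ?thesis using \<alpha>\<beta> by (metis add_nonneg_nonneg mult_nonneg_nonneg powr_ge_zero)
    next
      case False
      define u where "u = \<bar>a x\<bar> / A"
      define v where "v = \<bar>b x\<bar> / B"
      have uv: "0 < u" "0 < v" using False 3 by (auto simp: u_def v_def)
      have ab: "\<bar>a x * b x\<bar> = A * B * (u * v)" using 3 by (simp add: u_def v_def abs_mult)
      have "(u powr q) powr (s / q) * (v powr \<kappa>) powr (s / \<kappa>) \<le> s / q * u powr q + s / \<kappa> * v powr \<kappa>"
        using sq \<kappa>0 sum1 uv by (intro Youngs_inequality_0) auto
      then have y: "u powr s * v powr s \<le> s / q * u powr q + s / \<kappa> * v powr \<kappa>"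
        using q \<kappa>0 by (simp add: powr_powr)
      have "\<bar>a x * b x\<bar> powr s = (A * B) powr s * (u powr s * v powr s)"
        unfolding ab using 3 uv by (simp add: powr_mult)
      also have "\<dots> \<le> (A * B) powr s * (s / q * u powr q + s / \<kappa> * v powr \<kappa>)"
        by (rule mult_left_mono [OF y]) simp
      also have "\<dots> = \<alpha> * \<bar>a x\<bar> powr q + \<beta> * \<bar>b x\<bar> powr \<kappa>"
        using 3 by (simp add: \<alpha>_def \<beta>_def u_def v_def powr_divide distrib_left)
      finally show ?thesis .
    qed
    have "(\<integral>\<^sup>+x\<in>U. ennreal (\<bar>a x * b x\<bar> powr s) \<partial>lebesgue)
        \<le> (\<integral>\<^sup>+x. ennreal \<alpha> * (ennreal (\<bar>a x\<bar> powr q) * indicator U x) + ennreal \<beta> * (ennreal (\<bar>b x\<bar> powr \<kappa>) * indicator U x) \<partial>lebesgue)"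
    proof (rule nn_integral_mono)
      fix x
      have "ennreal (\<bar>a x * b x\<bar> powr s) \<le> ennreal \<alpha> * ennreal (\<bar>a x\<bar> powr q) + ennreal \<beta> * ennreal (\<bar>b x\<bar> powr \<kappa>)"
        using young [of x] \<alpha>\<beta> by (simp add: ennreal_leI flip: ennreal_mult ennreal_plus)
      then show "ennreal (\<bar>a x * b x\<bar> powr s) * indicator U x
          \<le> ennreal \<alpha> * (ennreal (\<bar>a x\<bar> powr q) * indicator U x) + ennreal \<beta> * (ennreal (\<bar>b x\<bar> powr \<kappa>) * indicator U x)"
        by (simp add: indicator_def)
    qed
    also have "\<dots> = ennreal \<alpha> * ennreal (A powr q) + ennreal \<beta> * ennreal (B powr \<kappa>)"
      using mp [OF ma, of q] mp [OF mb, of \<kappa>] by (simp add: nn_integral_add nn_integral_cmult IA IB)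
    also have "\<dots> = ennreal (\<alpha> * A powr q + \<beta> * B powr \<kappa>)" using \<alpha>\<beta> by (simp flip: ennreal_mult ennreal_plus)
    also have "\<alpha> * A powr q + \<beta> * B powr \<kappa> = (A * B) powr s * (s / q + s / \<kappa>)"
      using 3 by (simp add: \<alpha>_def \<beta>_def distrib_left)
    also have "\<dots> = (A * B) powr s" by (simp add: sum1)
    finally have "(\<integral>\<^sup>+x\<in>U. ennreal (\<bar>a x * b x\<bar> powr s) \<partial>lebesgue) \<le> ennreal ((A * B) powr s) * 1" by simp
    from ennroot_le [OF sq(1) _ this]
    have "ennroot s (\<integral>\<^sup>+x\<in>U. ennreal (\<bar>a x * b x\<bar> powr s) \<partial>lebesgue) \<le> ennreal (A * B) * ennroot s 1"
      using 3 by simp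
    also have "ennroot s 1 = 1" by (simp add: ennroot_def)
    finally show ?thesis using 3 by (simp add: ennreal_mult mult.commute)
  qed
qed

text \<open>For \<open>k = 0\<close> the hypothesis gives \<open>a = 0\<close>, and 0 divided by 0
  is 0 in \<open>ennreal\<close>; so the quotient in the lower bound is harmless for vanishing
  distortion.\<close>

lemma ennreal_divide_le_of_le_mult:
  fixes a b k :: ennreal
  assumes "a \<le> k * b" "k < \<infinity>"
  shows "a / k \<le> b"
proof (cases "k = 0")
  case True
  then show ?thesis using assms by simp
next
  case False
  have "a / k \<le> (b * k) / k" using assms by (intro divide_right_mono_ennreal) (simp add: mult.commute)
  also have "\<dots> = b" using False assms by (intro mult_divide_eq_ennreal) auto
  finally show ?thesis .
qed

text \<open>A function with essentially bounded weak gradient has a locally Lipschitz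
  representative, and continuity of \<open>f\<close> selects it. Weak differentiability of the
  composition belongs to the conclusion because \<open>wgrad\<close>, and with it
  \<open>sob_norm\<close>, is meaningful only for weakly differentiable functions.\<close>

theorem theorem3p5:
  fixes \<Omega> \<Omega>' :: "(real^'n::finite) set" and \<phi> :: "real^'n \<Rightarrow> real^'n"
    and q s :: real
  assumes "open \<Omega>" "connected \<Omega>" "bounded \<Omega>" "\<Omega> \<noteq> {}"
    and "open \<Omega>'" "connected \<Omega>'" "bounded \<Omega>'" "\<Omega>' \<noteq> {}"
    and "1 < q" "1 \<le> s" "s \<le> q"
    and "\<exists>\<psi>. homeomorphism \<Omega> \<Omega>' \<phi> \<psi>"
    and "finite_distortion \<Omega> \<phi>"
    and "map_in_L1p \<Omega> q \<phi>"
    and "luzin_N \<Omega> \<phi>"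
    and "KIqs \<Omega> q s \<phi> < \<infinity>"
  shows "\<forall>f. in_L1inf \<Omega>' f \<and> continuous_on \<Omega>' f \<longrightarrow>
           weakly_diff \<Omega> (f \<circ> \<phi>) \<and>
           sob_norm \<Omega>' s f / KIqs \<Omega> q s \<phi> \<le> sob_norm \<Omega> q (f \<circ> \<phi>) \<and>
           sob_norm \<Omega> q (f \<circ> \<phi>) \<le> map_sob_norm \<Omega> q \<phi> * sob_inf_norm \<Omega>' f"
proof (intro allI impI)
  fix f assume "in_L1inf \<Omega>' f \<and> continuous_on \<Omega>' f"
  then have f: "weakly_diff \<Omega>' f" "sob_inf_norm \<Omega>' f < \<infinity>" "continuous_on \<Omega>' f"
    by (auto simp: in_L1inf_def)
  have q: "0 < q" and s: "0 < s" using assms(9,10) by auto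
  have \<phi>: "continuous_on \<Omega> \<phi>" "\<phi> ` \<Omega> = \<Omega>'" "inj_on \<phi> \<Omega>"
    using assms(12) by (auto simp: homeomorphism_def intro: inj_on_inverseI)
  define D where "D = wjac \<Omega> \<phi>"
  have wg: "is_weak_grad \<Omega> (\<lambda>x. \<phi> x $ l) (\<lambda>x. D x $ l)" for l
    using wgrad_weak_grad [of \<Omega> "\<lambda>x. \<phi> x $ l"] assms(13)
    by (simp add: finite_distortion_def D_def wjac_def)
  have fd: "AE x in lebesgue. x \<in> \<Omega> \<and> det (D x) = 0 \<longrightarrow> D x = 0"
    using assms(13) by (simp add: finite_distortion_def D_def jac_def)
  obtain \<A> where \<A>: "countable \<A>" "\<And>A. A \<in> \<A> \<Longrightarrow> A \<in> sets lebesgue \<and> A \<subseteq> \<Omega>"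
      "\<And>A x. A \<in> \<A> \<Longrightarrow> x \<in> A \<Longrightarrow> (\<phi> has_derivative (\<lambda>h. D x *v h)) (at x within A)"
      "\<Omega> - \<Union>\<A> \<in> null_sets lebesgue"
    using weak_jacobian_differentiable_within [OF assms(1) \<phi>(1) wg] by blast
  \<comment> \<open>Finite distortion sharpens the exceptional alternative from a vanishing
    determinant to a vanishing matrix, as the chain rule requires.\<close>
  have pull: "AE x in lebesgue. x \<in> \<Omega> \<longrightarrow> P (\<phi> x) \<or> D x = 0" if "AE y in lebesgue. P y" for P
  proof -
    have "AE x in lebesgue. x \<in> \<Omega> \<longrightarrow> P (\<phi> x) \<or> det (D x) = 0"
      by (rule AE_pullback [OF \<A> \<phi>(3) that])
    then show ?thesis using fd by eventually_elim auto
  qed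

  define g where "g = wgrad \<Omega>' f"
  have g: "is_weak_grad \<Omega>' f g" unfolding g_def by (rule wgrad_weak_grad [OF f(1)])
  obtain M where M: "0 \<le> M" "sob_inf_norm \<Omega>' f = ennreal M"
    using f(2) by (cases "sob_inf_norm \<Omega>' f") auto
  have gM: "AE y in lebesgue. y \<in> \<Omega>' \<longrightarrow> norm (g y) \<le> M"
    using Linf_norm_AE [of \<Omega>' "\<lambda>y. norm (g y)"] M
    by (simp add: sob_inf_norm_def g_def ennreal_le_iff)
  have chain: "is_weak_grad \<Omega> (f \<circ> \<phi>) (\<lambda>x. transpose (D x) *v g (\<phi> x))"
    by (rule weak_chain_rule_bounded_gradient [OF assms(1) \<phi>(1) assms(5) _ wg f(3) g gM pull])
      (use \<phi>(2) in auto)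
  have wd: "weakly_diff \<Omega> (f \<circ> \<phi>)" using chain by (auto simp: weakly_diff_def)
  define h where "h = wgrad \<Omega> (f \<circ> \<phi>)"
  have h: "is_weak_grad \<Omega> (f \<circ> \<phi>) h" unfolding h_def by (rule wgrad_weak_grad [OF wd])
  \<comment> \<open>\<open>h\<close> is the weak gradient chosen by \<open>wgrad\<close>; uniqueness
    identifies it with the formula of the chain rule, and only this identity is used about
    \<open>h\<close> pointwise.\<close>
  have heq: "AE x in lebesgue. x \<in> \<Omega> \<longrightarrow> h x = transpose (D x) *v g (\<phi> x)"
    by (rule weak_grad_unique [OF assms(1) h chain])

  have \<Omega>m: "\<Omega> \<in> sets lebesgue" "\<Omega>' \<in> sets lebesgue" using assms(1,5) by auto
  \<comment> \<open>Outside \<open>\<Omega>\<close> the matrix \<open>D\<close> is an arbitrary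
    choice, so measurability is available only after cutting it off.\<close>
  have Dm: "(\<lambda>x. indicator \<Omega> x *\<^sub>R D x) \<in> borel_measurable lebesgue"
  proof (intro borel_measurable_vec_lambda)
    fix l i
    show "(\<lambda>x. (indicator \<Omega> x *\<^sub>R D x) $ l $ i) \<in> borel_measurable lebesgue"
      using loc_integrable_measurable [OF assms(1), of "\<lambda>x. D x $ l $ i"] wg [of l]
      by (simp add: is_weak_grad_def)
  qed
  have vec_meas: "(\<lambda>x. indicator U x * norm (v x)) \<in> borel_measurable lebesgue"
    if "open U" "is_weak_grad U u v" for U :: "(real^'n) set" and u v
  proof -
    have "(\<lambda>x. indicator U x *\<^sub>R v x) \<in> borel_measurable lebesgue"
    proof (rule borel_measurable_vec_lambda)
      fix i
      show "(\<lambda>x. (indicator U x *\<^sub>R v x) $ i) \<in> borel_measurable lebesgue"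
        using loc_integrable_measurable [OF that(1), of "\<lambda>x. v x $ i"] that(2)
        by (simp add: is_weak_grad_def)
    qed
    then have "(\<lambda>x. norm (indicator U x *\<^sub>R v x)) \<in> borel_measurable lebesgue" by measurable
    then show ?thesis by (simp add: indicator_def)
  qed
  have hm: "(\<lambda>x. indicator \<Omega> x * norm (h x)) \<in> borel_measurable lebesgue" by (rule vec_meas [OF assms(1) h])

  have upper: "sob_norm \<Omega> q (f \<circ> \<phi>) \<le> map_sob_norm \<Omega> q \<phi> * sob_inf_norm \<Omega>' f"
  proof -
    have "Lp_norm \<Omega> q (\<lambda>x. norm (h x)) \<le> ennreal M * Lp_norm \<Omega> q (\<lambda>x. onorm (\<lambda>v. D x *v v))"
    proof (rule Lp_norm_mono_AE [OF q M(1)])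
      have "(\<lambda>x. onorm (\<lambda>v. (indicator \<Omega> x *\<^sub>R D x) *v v)) \<in> borel_measurable lebesgue"
        by (rule measurable_compose [OF Dm borel_measurable_continuous_onI [OF continuous_onorm_matrix]])
      then have "(\<lambda>x. indicator \<Omega> x * onorm (\<lambda>v. (indicator \<Omega> x *\<^sub>R D x) *v v)) \<in> borel_measurable lebesgue"
        using \<Omega>m by measurable
      moreover have "(\<lambda>x. indicator \<Omega> x * onorm (\<lambda>v. (indicator \<Omega> x *\<^sub>R D x) *v v)) = (\<lambda>x. indicator \<Omega> x * onorm (\<lambda>v. D x *v v))"
        by (auto simp: indicator_def fun_eq_iff)
      ultimately show "(\<lambda>x. indicator \<Omega> x * onorm (\<lambda>v. D x *v v)) \<in> borel_measurable lebesgue" by (simp only:)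
      show "AE x in lebesgue. x \<in> \<Omega> \<longrightarrow> \<bar>norm (h x)\<bar> \<le> M * \<bar>onorm (\<lambda>v. D x *v v)\<bar>"
        using heq pull [OF gM]
      proof eventually_elim
        case (elim x)
        show ?case
        proof
          assume x: "x \<in> \<Omega>"
          have o: "0 \<le> onorm (\<lambda>v. D x *v v)" by (rule onorm_pos_le [OF matrix_vector_mul_bounded_linear])
          show "\<bar>norm (h x)\<bar> \<le> M * \<bar>onorm (\<lambda>v. D x *v v)\<bar>"
          \<comment> \<open>At such points the bound on \<open>g\<close> may fail at
            \<open>\<phi> x\<close>, but the chain rule makes \<open>h x\<close> vanish.\<close>
          proof (cases "D x = 0")
            case True
            then have "h x = 0" using elim x by (simp add: transpose_def matrix_vector_mult_def vec_eq_iff)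
            then show ?thesis using M o by simp
          next
            case False
            then have gx: "norm (g (\<phi> x)) \<le> M" using elim x \<phi>(2) by auto
            have "norm (h x) \<le> onorm (\<lambda>v. D x *v v) * norm (g (\<phi> x))"
              using elim x norm_transpose_mult_le_onorm [of "D x" "g (\<phi> x)"] by simp
            also have "\<dots> \<le> onorm (\<lambda>v. D x *v v) * M" by (rule mult_left_mono [OF gx o])
            finally show ?thesis using o by (simp add: mult.commute)
          qed
        qed
      qed
    qed
    then show ?thesis by (simp add: sob_norm_def h_def map_sob_norm_def D_def M(2) mult.commute)
  qed

  define k where "k = KI \<Omega> s \<phi>"
  have kD: "k x = (if det (D x) \<noteq> 0 then \<bar>det (D x)\<bar> powr (1 / s) / lmin (D x) else 0)" for x
    by (simp add: k_def KI_def jac_def D_def)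
  have km: "(\<lambda>x. indicator \<Omega> x * k x) \<in> borel_measurable lebesgue"
  proof -
    let ?E = "\<lambda>x. indicator \<Omega> x *\<^sub>R D x"
    have lm [measurable]: "(\<lambda>x. lmin (?E x)) \<in> borel_measurable lebesgue"
      by (rule measurable_compose [OF Dm borel_measurable_continuous_onI [OF continuous_lmin]])
    have "(\<lambda>x. ?E x $ i $ j) \<in> borel_measurable lebesgue" for i j
      by (rule measurable_compose [OF Dm borel_measurable_continuous_onI]) (intro continuous_intros)
    then have [measurable]: "(\<lambda>x. det (?E x)) \<in> borel_measurable lebesgue" by (rule measurable_det)
    have "(\<lambda>x. indicator \<Omega> x * (if det (?E x) \<noteq> 0 then \<bar>det (?E x)\<bar> powr (1 / s) / lmin (?E x) else 0))
        \<in> borel_measurable lebesgue"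
      using \<Omega>m by measurable
    moreover have "(\<lambda>x. indicator \<Omega> x * k x) =
        (\<lambda>x. indicator \<Omega> x * (if det (?E x) \<noteq> 0 then \<bar>det (?E x)\<bar> powr (1 / s) / lmin (?E x) else 0))"
      by (auto simp: kD indicator_def fun_eq_iff)
    ultimately show ?thesis by (simp only:)
  qed
  \<comment> \<open>Where the determinant is nonzero, \<open>lmin (D x)\<close> times the norm of
    \<open>g (\<phi> x)\<close> is at most the norm of \<open>h x\<close>; inserting the s-th root
    of the Jacobian produces exactly the factor \<open>k x\<close>. Elsewhere the left side is
    0.\<close>
  have pointwise: "AE x in lebesgue. x \<in> \<Omega> \<longrightarrow>
      ennreal (\<bar>det (D x)\<bar> * norm (g (\<phi> x)) powr s) \<le> ennreal (\<bar>norm (h x) * k x\<bar> powr s)"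
    using heq
  proof eventually_elim
    case (elim x)
    show ?case
    proof
      assume x: "x \<in> \<Omega>"
      show "ennreal (\<bar>det (D x)\<bar> * norm (g (\<phi> x)) powr s) \<le> ennreal (\<bar>norm (h x) * k x\<bar> powr s)"
      proof (cases "det (D x) = 0")
        case False
        let ?l = "lmin (D x)"
        have l: "0 < ?l" by (rule lmin_pos [OF False])
        have "norm (g (\<phi> x)) \<le> norm (h x) / ?l"
          using lmin_transpose_le [OF False, of "g (\<phi> x)"] elim x l by (simp add: field_simps)
        then have "norm (g (\<phi> x)) powr s \<le> (norm (h x) / ?l) powr s" using s by (intro powr_mono2) auto
        then have "\<bar>det (D x)\<bar> * norm (g (\<phi> x)) powr s \<le> \<bar>det (D x)\<bar> * (norm (h x) / ?l) powr s"
          by (rule mult_left_mono) simp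
        also have "\<dots> = (\<bar>det (D x)\<bar> powr (1 / s)) powr s * (norm (h x) / ?l) powr s"
          using s by (simp add: powr_powr)
        also have "\<dots> = (\<bar>det (D x)\<bar> powr (1 / s) * (norm (h x) / ?l)) powr s"
          using l by (subst powr_mult) auto
        also have "\<bar>det (D x)\<bar> powr (1 / s) * (norm (h x) / ?l) = \<bar>norm (h x) * k x\<bar>"
          using False l by (simp add: kD abs_mult)
        finally show ?thesis by (rule ennreal_leI)
      qed simp
    qed
  qed
  have gm: "(\<lambda>y. indicator \<Omega>' y * norm (g y)) \<in> borel_measurable lebesgue" by (rule vec_meas [OF assms(5) g])
  \<comment> \<open>A bounded gradient on a bounded domain: the constant \<open>M powr s\<close> is
    integrable over \<open>\<Omega>'\<close> and dominates.\<close>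
  have wint: "set_integrable lebesgue (\<phi> ` \<Omega>) (\<lambda>y. norm (g y) powr s)"
    unfolding set_integrable_def \<phi>(2)
  proof (rule Bochner_Integration.integrable_bound)
    have "\<Omega>' \<in> lmeasurable" using assms(5,7) by (rule lmeasurable_open [rotated])
    then show "integrable lebesgue (\<lambda>y. indicator \<Omega>' y * M powr s)" by (auto simp: fmeasurable_def)
    have "(\<lambda>y. (indicator \<Omega>' y * norm (g y)) powr s) \<in> borel_measurable lebesgue" using gm by measurable
    moreover have "(\<lambda>y. indicator \<Omega>' y *\<^sub>R norm (g y) powr s) = (\<lambda>y. (indicator \<Omega>' y * norm (g y)) powr s)"
      by (auto simp: indicator_def fun_eq_iff)
    ultimately show "(\<lambda>y. indicator \<Omega>' y *\<^sub>R norm (g y) powr s) \<in> borel_measurable lebesgue" by (simp only:)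
    show "AE y in lebesgue. norm (indicator \<Omega>' y *\<^sub>R norm (g y) powr s) \<le> norm (indicator \<Omega>' y * M powr s)"
      using gM
    proof eventually_elim
      case (elim y)
      then show ?case using s by (auto simp: indicator_def intro!: powr_mono2)
    qed
  qed
  have Hm: "(\<lambda>x. ennreal (\<bar>norm (h x) * k x\<bar> powr s) * indicator \<Omega> x) \<in> borel_measurable lebesgue"
  proof -
    have "(\<lambda>x. ennreal (\<bar>(indicator \<Omega> x * norm (h x)) * (indicator \<Omega> x * k x)\<bar> powr s)) \<in> borel_measurable lebesgue"
      using hm km by measurable
    moreover have "(\<lambda>x. ennreal (\<bar>norm (h x) * k x\<bar> powr s) * indicator \<Omega> x) =
        (\<lambda>x. ennreal (\<bar>(indicator \<Omega> x * norm (h x)) * (indicator \<Omega> x * k x)\<bar> powr s))"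
      by (auto simp: indicator_def fun_eq_iff)
    ultimately show ?thesis by (simp only:)
  qed
  have area: "(\<integral>\<^sup>+y\<in>\<Omega>'. ennreal (norm (g y) powr s) \<partial>lebesgue)
      \<le> (\<integral>\<^sup>+x\<in>\<Omega>. ennreal (\<bar>norm (h x) * k x\<bar> powr s) \<partial>lebesgue)"
    unfolding \<phi>(2) [symmetric]
    by (rule area_inequality [OF \<A> \<phi>(3) assms(15) wint _ Hm pointwise]) auto
  have "sob_norm \<Omega>' s f \<le> ennroot s (\<integral>\<^sup>+x\<in>\<Omega>. ennreal (\<bar>norm (h x) * k x\<bar> powr s) \<partial>lebesgue)"
    using ennroot_le [OF s, of 1, simplified, OF area] by (simp add: sob_norm_def Lp_norm_ennroot g_def)
  also have "\<dots> \<le> KIqs \<Omega> q s \<phi> * sob_norm \<Omega> q (f \<circ> \<phi>)"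
  \<comment> \<open>In this case the exponent \<open>\<kappa>\<close> is infinite and the essential
    bound of \<open>k\<close> is pulled out of the norm; otherwise Hoelder's inequality
    applies.\<close>
  proof (cases "s = q")
    case True
    then have K: "KIqs \<Omega> q s \<phi> = Linf_norm \<Omega> k" by (simp add: KIqs_def k_def)
    then obtain B where B: "0 \<le> B" "KIqs \<Omega> q s \<phi> = ennreal B"
      using assms(16) by (cases "KIqs \<Omega> q s \<phi>") auto
    have "Lp_norm \<Omega> s (\<lambda>x. norm (h x) * k x) \<le> ennreal B * Lp_norm \<Omega> s (\<lambda>x. norm (h x))"
    proof (rule Lp_norm_mono_AE [OF s B(1) hm])
      show "AE x in lebesgue. x \<in> \<Omega> \<longrightarrow> \<bar>norm (h x) * k x\<bar> \<le> B * \<bar>norm (h x)\<bar>"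
        using Linf_norm_AE [of \<Omega> k]
      proof eventually_elim
        case (elim x)
        show ?case
        proof
          assume "x \<in> \<Omega>"
          then have "ennreal \<bar>k x\<bar> \<le> ennreal B"
            using elim unfolding K [symmetric] B(2) by blast
          then have "\<bar>k x\<bar> \<le> B" using B(1) by (simp add: ennreal_le_iff)
          then show "\<bar>norm (h x) * k x\<bar> \<le> B * \<bar>norm (h x)\<bar>"
            by (simp add: abs_mult mult.commute mult_right_mono)
        qed
      qed
    qed
    then show ?thesis using True B by (simp add: Lp_norm_ennroot sob_norm_def h_def)
  next
    case False
    then have sq: "s < q" using assms(11) by simp
    have "KIqs \<Omega> q s \<phi> = Lp_norm \<Omega> (1 / (1 / s - 1 / q)) k" using False by (simp add: KIqs_def k_def)
    then show ?thesis
      using Lp_norm_product_le [OF s sq refl hm km] by (simp add: sob_norm_def h_def)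
  qed
  finally have "sob_norm \<Omega>' s f / KIqs \<Omega> q s \<phi> \<le> sob_norm \<Omega> q (f \<circ> \<phi>)"
    by (rule ennreal_divide_le_of_le_mult) (rule assms(16))
  with wd upper show "weakly_diff \<Omega> (f \<circ> \<phi>) \<and>
           sob_norm \<Omega>' s f / KIqs \<Omega> q s \<phi> \<le> sob_norm \<Omega> q (f \<circ> \<phi>) \<and>
           sob_norm \<Omega> q (f \<circ> \<phi>) \<le> map_sob_norm \<Omega> q \<phi> * sob_inf_norm \<Omega>' f"
    by blast
qed

end
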